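(* In the setting described in the context, let $F\colon H^1_0(D_{\mathrm{ref}})\to\mathbb R$ be a continuous linear functional. Let $\hat u_0(\mathbf z)\in H^1_0(D_{\mathrm{ref}})$ be the weak solution of $$-\operatorname{div}\big(\mathbf A_s(\mathbf z)\nabla\hat u_0(\mathbf z)\big)=f_{\mathrm{ref}}(\mathbf z)\ \text{ in }D_{\mathrm{ref}},\qquad \hat u_0(\mathbf z)=0\ \text{ on }\partial D_{\mathrm{ref}},$$ and let $\hat u_\varepsilon(\mathbf y,\mathbf z)\in H^1_0(D_{\mathrm{ref}})$ be the weak solution of $$-\operatorname{div}\big((\mathbf A_s(\mathbf z)+\varepsilon\mathbf A_r(\mathbf y,\mathbf z))\nabla\hat u_\varepsilon(\mathbf y,\mathbf z)\big)=f_{\mathrm{ref}}(\mathbf z)\ \text{ in }D_{\mathrm{ref}},\qquad \hat u_\varepsilon(\mathbf y,\mathbf z)=0\ \text{ on }\partial D_{\mathrm{ref}}.$$ Then, for $\varepsilon>0$ sufficiently small, $$\mathbb E[F(\hat u_\varepsilon)]=\mathbb E[F(\hat u_0)]+\mathcal O(\varepsilon^2),\qquad \mathbb V[F(\hat u_\varepsilon)]=\mathbb V[F(\hat u_0)]+\mathcal O(\varepsilon^2).$$ That is, there exist $\varepsilon_0>0$ and $C>0$ such that for all $0<\varepsilon\le\varepsilon_0$ both $|\mathbb E[F(\hat u_\varepsilon)]-\mathbb E[F(\hat u_0)]|\le C\varepsilon^2$ and $|\mathbb V[F(\hat u_\varepsilon)]-\mathbb V[F(\hat u_0)]|\le C\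varepsilon^2$.
   Context: Reference domain: $D_{\mathrm{ref}}\subset\mathbb R^d$, $d\in\mathbb N$, is a bounded domain with Lipschitz boundary. Parameters: $\Gamma=[-1,1]$; $\mathbf y=(y_1,\dots,y_N)\in\Gamma^N$ and $\mathbf z=(z_1,\dots,z_M)\in\Gamma^M$ are the values of two mutually independent families of independent, identically distributed, centered random variables, with product probability densities $\rho_X(\mathbf y)=\prod_{k=1}^N\rho_{X,k}(y_k)$ and $\rho_Y(\mathbf z)=\prod_{k=1}^M\rho_{Y,k}(z_k)$ with respect to Lebesgue measure, so that $\int_\Gamma y_k\rho_{X,k}(y_k)\,dy_k=0$ and $\int_\Gamma z_k\rho_{Y,k}(z_k)\,dz_k=0$ for all $k$. "Almost every" $\mathbf y$, $\mathbf z$ is meant with respect to $\rho_X\,d\mathbf y$, $\rho_Y\,d\mathbf z$. Random domain: $\mathbf V(\mathbf X,\mathbf z)=\mathbb E[\mathbf V](\mathbf X)+\sum_{k=1}^M\sqrt{\mu_k}\,\boldsymbol\varphi_k(\mathbf X)z_k$ (a truncated Karhunen–Loève expansion; $\mu_k\ge0$, $\mathbb E[\mathbf V],\boldsymbol\varphi_k\in C^1(\overline{D_{\mathrm{ref}}};\mathbb R^d)$). For almost every $\mathbf z$, $\mathbf V(\cdot,\mathbf z)$ is a $C^1$-diffeomorphism of $\overline{D_{\mathrm{ref}}}$ onto its image, with $D(\mathbf z)=\mathbf V(D_{\mathrm{ref}},\mathbf z)$, $\det\mathbf V'>0$, and $\|\mathbf V(\cdot,\mathbf z)\|_{C^1(\overline{D_{\mathrm{ref}}};\mathbb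 R^d)}\le C_{\mathrm{uni}}$, $\|\mathbf V(\cdot,\mathbf z)^{-1}\|_{C^1(\overline{D(\mathbf z)};\mathbb R^d)}\le C_{\mathrm{uni}}$ with $C_{\mathrm{uni}}$ independent of $\mathbf z$. Here $\mathbf V'$ is the Jacobian with respect to $\mathbf X$. The hold-all domain is $\mathcal D=\bigcup_{\mathbf z\in\Gamma^M}\mathbf V(D_{\mathrm{ref}},\mathbf z)$. Diffusion coefficient: $a(\mathbf x,\mathbf y)=a_s(\mathbf x)+\varepsilon a_r(\mathbf x,\mathbf y)$, where $a_s$ is a deterministic real-analytic function on $\mathcal D$ (real-analytic on an open neighbourhood of $\mathcal D$) with $0<\underline a\le a_s\le\overline a<\infty$ on $\mathcal D$, and $a_r(\mathbf x,\mathbf y)=\sum_{k=1}^N\sqrt{\lambda_k}\,\psi_k(\mathbf x)y_k$ (a truncated Karhunen–Loève expansion; $\lambda_k\ge0$, $\psi_k\in L^\infty(\mathcal D)$), with $\|a_r(\cdot,\mathbf y)\|_{L^\infty(D(\mathbf z))}\le1$ for almost every $(\mathbf y,\mathbf z)$. No smoothness of the $\psi_k$ is assumed. Load: $f\in L^2(\mathcal D)$. Transported data on $D_{\mathrm{ref}}$: $\mathbf A_s(\mathbf X,\mathbf z)=a_s(\mathbf V(\mathbf X,\mathbf z))\,(\mathbf V'^\top\mathbf V')^{-1}(\mathbf X,\mathbf z)\,\det\mathbf V'(\mathbf X,\mathbf z)$, $\mathbf A_r(\mathbf X,\mathbf y,\mathbf z)=a_r(\mathbf V(\mathbf X,\mathbf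 z),\mathbf y)\,(\mathbf V'^\top\mathbf V')^{-1}(\mathbf X,\mathbf z)\,\det\mathbf V'(\mathbf X,\mathbf z)$, $f_{\mathrm{ref}}(\mathbf X,\mathbf z)=f(\mathbf V(\mathbf X,\mathbf z))\,\det\mathbf V'(\mathbf X,\mathbf z)$. Expectation and variance of a real-valued $g=g(\mathbf y,\mathbf z)$: $\mathbb E[g]=\int_{\Gamma^N}\int_{\Gamma^M}g\,\rho_X(\mathbf y)\rho_Y(\mathbf z)\,d\mathbf z\,d\mathbf y$ and $\mathbb V[g]=\mathbb E\big[(g-\mathbb E[g])^2\big]$; functions of $\mathbf z$ only are regarded as constant in $\mathbf y$. *)

theory Defs
  imports "HOL-Probability.Probability"
begin

text \<open>Near each boundary point the domain is the strict epigraph, in some unit direction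
  \<open>e\<close>, of a Lipschitz function \<open>\<gamma>\<close> on the hyperplane orthogonal to \<open>e\<close>.\<close>

definition lipschitz_boundary :: "'a::euclidean_space set \<Rightarrow> bool" where
  "lipschitz_boundary D \<longleftrightarrow>
     (\<forall>p\<in>frontier D. \<exists>e \<gamma> L r. norm e = 1 \<and> r > 0 \<and> L-lipschitz_on {w. w \<bullet> e = 0} \<gamma> \<and>
        (\<forall>x\<in>ball p r. x \<in> D \<longleftrightarrow> \<gamma> (x - (x \<bullet> e) *\<^sub>R e) < x \<bullet> e))"

definition bounded_lipschitz_domain :: "'a::euclidean_space set \<Rightarrow> bool" where
  "bounded_lipschitz_domain D \<longleftrightarrow>
     open D \<and> connected D \<and> D \<noteq> {} \<and> bounded D \<and> lipschitz_boundary D"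

definition Gam :: "real set" where
  "Gam = {-1..1}"

definition cube :: "(real^'n) set" where
  "cube = {p. \<forall>k. p $ k \<in> Gam}"

text \<open>Lebesgue densities of identically distributed, centered random variables with values
  in \<open>Gam\<close>; independence is encoded by passing to the product density.\<close>

definition iid_centered_densities :: "('n \<Rightarrow> real \<Rightarrow> real) \<Rightarrow> bool" where
  "iid_centered_densities \<rho> \<longleftrightarrow>
     (\<forall>k. \<rho> k \<in> borel_measurable borel \<and> (\<forall>t\<in>Gam. 0 \<le> \<rho> k t) \<and>
          (LINT t:Gam|lborel. \<rho> k t) = 1 \<and> (LINT t:Gam|lborel. t * \<rho> k t) = 0) \<and>
     (\<forall>j k. AE t in lborel. t \<in> Gam \<longrightarrow> \<rho> j t = \<rho> k t)"

definition prod_density :: "('n::finite \<Rightarrow> real \<Rightarrow> real) \<Rightarrow> real^'n \<Rightarrow> real" where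
  "prod_density \<rho> p = (\<Prod>k\<in>UNIV. \<rho> k (p $ k))"

definition param_law :: "('n::finite \<Rightarrow> real \<Rightarrow> real) \<Rightarrow> (real^'n) measure" where
  "param_law \<rho> = density lborel (\<lambda>p. ennreal (prod_density \<rho> p) * indicator cube p)"

text \<open>The integrals are taken with respect to the completed Lebesgue measure: the integrands
  are only determined almost everywhere, which would not guarantee Borel measurability.\<close>

definition expect ::
  "('n::finite \<Rightarrow> real \<Rightarrow> real) \<Rightarrow> ('m::finite \<Rightarrow> real \<Rightarrow> real) \<Rightarrow> (real^'n \<Rightarrow> real^'m \<Rightarrow> real) \<Rightarrow> real"
  where
  "expect \<rho>X \<rho>Y g =
     (LINT y:cube|lebesgue. LINT z:cube|lebesgue. g y z * prod_density \<rho>X y * prod_density \<rho>Y z)"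

definition varc ::
  "('n::finite \<Rightarrow> real \<Rightarrow> real) \<Rightarrow> ('m::finite \<Rightarrow> real \<Rightarrow> real) \<Rightarrow> (real^'n \<Rightarrow> real^'m \<Rightarrow> real) \<Rightarrow> real"
  where
  "varc \<rho>X \<rho>Y g = expect \<rho>X \<rho>Y (\<lambda>y z. (g y z - expect \<rho>X \<rho>Y g)\<^sup>2)"

definition C1_closure :: "(real^'d) set \<Rightarrow> (real^'d \<Rightarrow> real^'d) \<Rightarrow> bool" where
  "C1_closure D v \<longleftrightarrow>
     continuous_on (closure D) v \<and>
     (\<exists>J. continuous_on (closure D) J \<and>
          (\<forall>x\<in>D. (v has_derivative (\<lambda>h. (J x :: real^'d^'d) *v h)) (at x)))"

text \<open>For functions of class \<open>C1_closure\<close> on a bounded open set the suprema are finite, and the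
  second one agrees with that of the continuous extension of the derivative to the closure.\<close>

definition C1_norm :: "(real^'d) set \<Rightarrow> (real^'d \<Rightarrow> real^'d) \<Rightarrow> real" where
  "C1_norm D v =
     (SUP x\<in>closure D. norm (v x)) + (SUP x\<in>D. onorm (frechet_derivative v (at x)))"

text \<open>For bounded \<open>D\<close> one has \<open>closure (v ` D) = v ` closure D\<close>, so the last conjunct is about
  the inverse on its full domain.\<close>

definition C1_diffeo :: "(real^'d) set \<Rightarrow> (real^'d \<Rightarrow> real^'d) \<Rightarrow> bool" where
  "C1_diffeo D v \<longleftrightarrow>
     C1_closure D v \<and> inj_on v (closure D) \<and> C1_closure (v ` D) (the_inv_into (closure D) v)"

text \<open>Local expansion into an absolutely convergent power series over all multi-indices.\<close>

definition real_analytic_on :: "(real^'d) set \<Rightarrow> (real^'d \<Rightarrow> real) \<Rightarrow> bool" where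
  "real_analytic_on U g \<longleftrightarrow>
     (\<forall>p\<in>U. \<exists>c r. r > 0 \<and>
        (\<forall>x. (\<forall>i. \<bar>x $ i - p $ i\<bar> < r) \<longrightarrow>
           ((\<lambda>\<alpha>::'d \<Rightarrow> nat. c \<alpha> * (\<Prod>i\<in>UNIV. (x $ i - p $ i) ^ \<alpha> i)) has_sum g x) UNIV))"

primrec Ck :: "nat \<Rightarrow> ('a::euclidean_space \<Rightarrow> real) \<Rightarrow> bool" where
  "Ck 0 g = continuous_on UNIV g"
| "Ck (Suc k) g = (\<exists>g'. (\<forall>x. (g has_derivative g' x) (at x)) \<and> (\<forall>v. Ck k (\<lambda>x. g' x v)))"

definition test_function :: "'a::euclidean_space set \<Rightarrow> ('a \<Rightarrow> real) \<Rightarrow> bool" where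
  "test_function D \<phi> \<longleftrightarrow>
     (\<forall>k. Ck k \<phi>) \<and> compact (closure {x. \<phi> x \<noteq> 0}) \<and> closure {x. \<phi> x \<noteq> 0} \<subseteq> D"

text \<open>Elements are represented by functions on the whole space, of which only the
  almost-everywhere class on the domain matters.\<close>

definition L2 :: "'a::euclidean_space set \<Rightarrow> ('a \<Rightarrow> real) \<Rightarrow> bool" where
  "L2 S g \<longleftrightarrow> g \<in> borel_measurable (lebesgue_on S) \<and> integrable (lebesgue_on S) (\<lambda>x. (g x)\<^sup>2)"

text \<open>This is \<open>\<infinity>\<close> when \<open>g\<close> is not Lebesgue measurable on \<open>S\<close>.\<close>

definition Linf_norm :: "'a::euclidean_space set \<Rightarrow> ('a \<Rightarrow> real) \<Rightarrow> ereal" where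
  "Linf_norm S g = esssup (lebesgue_on S) (\<lambda>x. ereal \<bar>g x\<bar>)"

definition Linf :: "'a::euclidean_space set \<Rightarrow> ('a \<Rightarrow> real) \<Rightarrow> bool" where
  "Linf S g \<longleftrightarrow> g \<in> borel_measurable (lebesgue_on S) \<and> Linf_norm S g < \<infinity>"

definition weak_gradient ::
  "(real^'d) set \<Rightarrow> (real^'d \<Rightarrow> real) \<Rightarrow> (real^'d \<Rightarrow> real^'d) \<Rightarrow> bool" where
  "weak_gradient D u G \<longleftrightarrow>
     (\<forall>\<phi> i. test_function D \<phi> \<longrightarrow>
        (LINT x|lebesgue_on D. u x * frechet_derivative \<phi> (at x) (axis i 1)) =
        - (LINT x|lebesgue_on D. G x $ i * \<phi> x))"

definition has_L2_gradient ::
  "(real^'d) set \<Rightarrow> (real^'d \<Rightarrow> real) \<Rightarrow> (real^'d \<Rightarrow> real^'d) \<Rightarrow> bool" where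
  "has_L2_gradient D u G \<longleftrightarrow> (\<forall>i. L2 D (\<lambda>x. G x $ i)) \<and> weak_gradient D u G"

definition H1 :: "(real^'d) set \<Rightarrow> (real^'d \<Rightarrow> real) \<Rightarrow> bool" where
  "H1 D u \<longleftrightarrow> L2 D u \<and> (\<exists>G. has_L2_gradient D u G)"

text \<open>A representative of the weak gradient, which is unique up to null sets.\<close>

definition wgrad :: "(real^'d) set \<Rightarrow> (real^'d \<Rightarrow> real) \<Rightarrow> real^'d \<Rightarrow> real^'d" where
  "wgrad D u = (SOME G. has_L2_gradient D u G)"

definition H1_norm :: "(real^'d) set \<Rightarrow> (real^'d \<Rightarrow> real) \<Rightarrow> real" where
  "H1_norm D u =
     sqrt ((LINT x|lebesgue_on D. (u x)\<^sup>2) + (LINT x|lebesgue_on D. (norm (wgrad D u x))\<^sup>2))"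

definition H10 :: "(real^'d) set \<Rightarrow> (real^'d \<Rightarrow> real) set" where
  "H10 D = {u. H1 D u \<and>
     (\<exists>\<phi>. (\<forall>n::nat. test_function D (\<phi> n)) \<and>
          (\<lambda>n. H1_norm D (\<lambda>x. u x - \<phi> n x)) \<longlonglongrightarrow> 0)}"

text \<open>Continuity with respect to the \<open>H1\<close> seminorm on functions implies that the value depends
  only on the almost-everywhere class.\<close>

definition continuous_linear_functional_H10 ::
  "(real^'d) set \<Rightarrow> ((real^'d \<Rightarrow> real) \<Rightarrow> real) \<Rightarrow> bool" where
  "continuous_linear_functional_H10 D F \<longleftrightarrow>
     (\<forall>u\<in>H10 D. \<forall>v\<in>H10 D. F (\<lambda>x. u x + v x) = F u + F v) \<and>
     (\<forall>c. \<forall>u\<in>H10 D. F (\<lambda>x. c * u x) = c * F u) \<and>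
     (\<forall>u\<in>H10 D. \<forall>e>0. \<exists>\<delta>>0. \<forall>v\<in>H10 D. H1_norm D (\<lambda>x. v x - u x) < \<delta> \<longrightarrow> \<bar>F v - F u\<bar> < e)"

text \<open>Weak form of \<open>- div (A \<nabla>u) = g\<close> in \<open>D\<close>, \<open>u = 0\<close> on the boundary.\<close>

definition weak_solution ::
  "(real^'d) set \<Rightarrow> (real^'d \<Rightarrow> real^'d^'d) \<Rightarrow> (real^'d \<Rightarrow> real) \<Rightarrow> (real^'d \<Rightarrow> real) \<Rightarrow> bool" where
  "weak_solution D A g u \<longleftrightarrow>
     u \<in> H10 D \<and>
     (\<forall>v\<in>H10 D. (LINT x|lebesgue_on D. (A x *v wgrad D u x) \<bullet> wgrad D v x) =
                 (LINT x|lebesgue_on D. g x * v x))"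

text \<open>Pull-backs under \<open>v\<close> of a scalar diffusion coefficient and of a load.\<close>

definition pullback_coeff ::
  "(real^'d \<Rightarrow> real^'d) \<Rightarrow> (real^'d \<Rightarrow> real) \<Rightarrow> real^'d \<Rightarrow> real^'d^'d" where
  "pullback_coeff v a X =
     (let J = jacobian v (at X) in (a (v X) * det J) *\<^sub>R matrix_inv (transpose J ** J))"

definition pullback_load ::
  "(real^'d \<Rightarrow> real^'d) \<Rightarrow> (real^'d \<Rightarrow> real) \<Rightarrow> real^'d \<Rightarrow> real" where
  "pullback_load v f X = f (v X) * det (jacobian v (at X))"

end

theory Submission
  imports Defs
begin

text \<open>
  For fixed \<open>z\<close> let \<open>B\<close> be the coercive form with coefficient \<open>A_s z\<close> and \<open>C\<^sub>y\<close> the bounded form with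
  coefficient \<open>A_r y z\<close>, which is linear in \<open>y\<close>. Let \<open>w\<close> represent \<open>F\<close> with respect to \<open>B\<close>. Testing
  the difference of the two equations with \<open>w\<close> gives
  \<open>F u\<^sub>\<epsilon> - F u\<^sub>0 = - \<epsilon> C\<^sub>y(u\<^sub>\<epsilon>, w) = - \<epsilon> C\<^sub>y(u\<^sub>0, w) + O(\<epsilon>\<^sup>2)\<close>, and the linear term has mean zero in \<open>y\<close>.
  All constants are uniform in \<open>z\<close>, so the bound for the expectation follows by Fubini; the one for the
  variance follows from \<open>g\<^sub>\<epsilon>\<^sup>2 - g\<^sub>0\<^sup>2 = 2 g\<^sub>0 (g\<^sub>\<epsilon> - g\<^sub>0) + (g\<^sub>\<epsilon> - g\<^sub>0)\<^sup>2\<close>, as \<open>g\<^sub>0\<close> does not depend on \<open>y\<close>.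

  It suffices to represent \<open>F\<close> up to an error \<open>\<epsilon>\<close> in the dual norm, which does not need completeness of
  \<open>H10\<close>. Fubini needs measurability of \<open>F u\<^sub>\<epsilon>\<close> in the parameters. Solutions minimise the energy, and the
  test functions contain a countable dense sequence on which the energies depend measurably on the
  parameters; the first almost minimiser in this sequence is a measurable selection, along which \<open>F\<close>
  converges to \<open>F u\<^sub>\<epsilon>\<close>.
\<close>

section \<open>Smooth bump functions and the fundamental lemma\<close>

text \<open>The functions \<psi> k, \<open>a_r\<close> and \<open>f\<close> are merely measurable.
  Composing them with \<open>V z\<close> is harmless almost everywhere because the inverse map is
  differentiable, so null sets pull back to null sets. Uniformity in \<open>z\<close> comes from the
  factorisation of the coefficient through the transposed inverse Jacobian: with J the Jacobian, the
  inverse of J^T J pairs x and y as the inner product of J^-T x and J^-T y. Coercivity and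
  boundedness then reduce to bounds for J, its inverse and its determinant, all expressed in one
  constant. The Poincare inequality allows the gradient norm to be used throughout. Only the
  \<open>y\<close>-mean of the first-order term vanishes, so the representative of \<open>F\<close>
  has to be chosen from \<open>z\<close> alone, before \<open>y\<close>. An error \<epsilon> in it
  costs only a second-order term, since it acts on the difference of the two solutions, which is
  itself of order \<epsilon>. The choices of solutions and representatives carry no measurability in
  \<open>z\<close>; the energies of a fixed test function do, because \<open>V\<close> is affine in
  \<open>z\<close>.\<close>

lemma Ck_continuous: "Ck k g \<Longrightarrow> continuous_on UNIV g"
  by (cases k) (auto simp: continuous_on_eq_continuous_at intro!: has_derivative_continuous)

lemma Ck_SucI:
  assumes "\<And>x. (g has_derivative g' x) (at x)" "\<And>v. Ck k (\<lambda>x. g' x v)"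
  shows "Ck (Suc k) g"
  using assms by auto

lemma Ck_SucD: "Ck (Suc k) g \<Longrightarrow> Ck k g"
proof (induction k arbitrary: g)
  case 0
  then show ?case using has_derivative_continuous by (fastforce intro!: continuous_at_imp_continuous_on)
next
  case (Suc k)
  then obtain g' where g': "\<And>x. (g has_derivative g' x) (at x)" "\<And>v. Ck (Suc k) (\<lambda>x. g' x v)"
    by (metis Ck.simps(2))
  show ?case by (rule Ck_SucI[OF g'(1)]) (use Suc.IH g'(2) in blast)
qed

lemma Ck_const: "Ck k (\<lambda>x. c)"
  by (induction k arbitrary: c) (auto intro!: exI[of _ "\<lambda>x v. 0"])

lemma Ck_add:
  assumes "Ck k f" "Ck k g" shows "Ck k (\<lambda>x. f x + g x)"
  using assms
proof (induction k arbitrary: f g)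
  case 0
  then show ?case by (auto intro: continuous_intros)
next
  case (Suc k)
  obtain f' where f': "\<And>x. (f has_derivative f' x) (at x)" "\<And>v. Ck k (\<lambda>x. f' x v)"
    using Suc.prems by auto
  obtain g' where g': "\<And>x. (g has_derivative g' x) (at x)" "\<And>v. Ck k (\<lambda>x. g' x v)"
    using Suc.prems by auto
  show ?case
    by (rule Ck_SucI[where g'="\<lambda>x v. f' x v + g' x v"])
      (auto intro!: derivative_eq_intros f' g' Suc.IH)
qed

lemma Ck_mult:
  assumes "Ck k f" "Ck k g" shows "Ck k (\<lambda>x. f x * g x)"
  using assms
proof (induction k arbitrary: f g)
  case 0
  then show ?case by (auto intro: continuous_intros)
next
  case (Suc k)
  obtain f' where f': "\<And>x. (f has_derivative f' x) (at x)" "\<And>v. Ck k (\<lambda>x. f' x v)"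
    using Suc.prems by auto
  obtain g' where g': "\<And>x. (g has_derivative g' x) (at x)" "\<And>v. Ck k (\<lambda>x. g' x v)"
    using Suc.prems by auto
  note * = Ck_SucD[OF Suc.prems(1)] Ck_SucD[OF Suc.prems(2)]
  show ?case
    by (rule Ck_SucI[where g'="\<lambda>x v. f x * g' x v + f' x v * g x"])
      (auto intro!: has_derivative_mult f' g' Suc.IH Ck_add *)
qed

lemma Ck_prod:
  assumes "\<And>i. i \<in> I \<Longrightarrow> Ck k (f i)" shows "Ck k (\<lambda>x. \<Prod>i\<in>I. f i x)"
  using assms by (induction I rule: infinite_finite_induct) (auto intro: Ck_const Ck_mult)

lemma Ck_compose_affine:
  fixes h :: "real \<Rightarrow> real" and b :: "'a::euclidean_space"
  assumes "Ck k h" shows "Ck k (\<lambda>x. h (x \<bullet> b - c))"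
  using assms
proof (induction k arbitrary: h)
  case 0
  then show ?case by (auto intro!: continuous_intros continuous_on_compose2[of UNIV h])
next
  case (Suc k)
  obtain h' where h': "\<And>x. (h has_derivative h' x) (at x)" "\<And>v. Ck k (\<lambda>x. h' x v)"
    using Suc.prems by auto
  show ?case
  proof (rule Ck_SucI)
    fix x
    have "((\<lambda>x. x \<bullet> b - c) has_derivative (\<lambda>v. v \<bullet> b)) (at x)"
      by (auto intro!: derivative_eq_intros)
    from diff_chain_at[OF this h'(1)]
    show "((\<lambda>x. h (x \<bullet> b - c)) has_derivative (\<lambda>v. h' (x \<bullet> b - c) (v \<bullet> b))) (at x)"
      by (simp add: o_def)
  qed (rule Suc.IH, rule h')
qed

text \<open>For \<open>p = 1\<close> this is the classical flat function exp(-1/t). The polynomial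
  in 1/t makes the family closed under differentiation: the derivative belongs to X^2 (p - p'), so
  one induction yields all orders of smoothness.\<close>

definition flat :: "real poly \<Rightarrow> real \<Rightarrow> real" where
  "flat p t = (if t > 0 then poly p (1 / t) * exp (- (1 / t)) else 0)"

lemma poly_div_exp_tendsto_0: "((\<lambda>s. poly p s / exp s) \<longlongrightarrow> (0::real)) at_top"
proof -
  have "((\<lambda>s. \<Sum>i\<le>degree p. coeff p i * (s ^ i / exp s)) \<longlongrightarrow> (\<Sum>i\<le>degree p. coeff p i * 0)) at_top"
    by (intro tendsto_sum tendsto_mult tendsto_const tendsto_power_div_exp_0)
  then show ?thesis by (simp add: poly_altdef sum_divide_distrib)
qed

lemma flat_has_derivative:
  "(flat p has_field_derivative flat (monom 1 2 * (p - pderiv p)) t) (at t)"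
proof (cases t "0::real" rule: linorder_cases)
  case less
  have "((\<lambda>t. 0) has_field_derivative 0) (at t)" by simp
  then have "(flat p has_field_derivative 0) (at t)"
    by (rule has_field_derivative_transform_within_open[where S="{..<0}"]) (use less in \<open>auto simp: flat_def\<close>)
  then show ?thesis using less by (simp add: flat_def)
next
  case greater
  have "((\<lambda>t. poly p (1 / t) * exp (- (1 / t))) has_field_derivative
     flat (monom 1 2 * (p - pderiv p)) t) (at t)"
    using greater
    by (auto intro!: derivative_eq_intros DERIV_chain2[OF poly_DERIV] simp: flat_def poly_monom field_simps power2_eq_square)
  then show ?thesis
    by (rule has_field_derivative_transform_within_open[where S="{0<..}"]) (use greater in \<open>auto simp: flat_def\<close>)
next
  case equal
  have "((\<lambda>h. flat p h / h) \<longlongrightarrow> 0) (at 0)"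

  proof (intro filterlim_split_at)
    show "((\<lambda>h. flat p h / h) \<longlongrightarrow> 0) (at_left 0)"
      by (rule tendsto_eventually) (auto simp: flat_def eventually_at_filter)
    \<comment> \<open>With s = 1/h the right difference quotient is s p(s) / exp s, and
      \<open>pCons 0 p\<close> is the polynomial s p(s).\<close>
    have "((\<lambda>h::real. poly (pCons 0 p) (inverse h) / exp (inverse h)) \<longlongrightarrow> 0) (at_right 0)"
      by (rule filterlim_compose[OF poly_div_exp_tendsto_0 filterlim_inverse_at_top_right])
    then show "((\<lambda>h. flat p h / h) \<longlongrightarrow> 0) (at_right 0)"
      by (rule Lim_transform_eventually)
        (auto simp: flat_def eventually_at_filter exp_minus field_simps)
  qed
  then show ?thesis using equal by (simp add: DERIV_def flat_def)
qed

lemma Ck_flat: "Ck k (flat p)"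
proof (induction k arbitrary: p)
  case 0
  show ?case
    by (auto simp: continuous_on_eq_continuous_at intro: DERIV_isCont flat_has_derivative)
next
  case (Suc k)
  show ?case
  proof (rule Ck_SucI)
    show "(flat p has_derivative (\<lambda>v. flat (monom 1 2 * (p - pderiv p)) x * v)) (at x)" for x
      using flat_has_derivative[of p x] by (simp add: has_field_derivative_def)
    show "Ck k (\<lambda>x. flat (monom 1 2 * (p - pderiv p)) x * v)" for v
      by (intro Ck_mult Ck_const Suc.IH)
  qed
qed

text \<open>Smooth functions that converge to the indicator of \<open>box a b\<close>: the factor
  \<open>Suc n\<close> sends each \<open>flat 1\<close> to 1 at interior points, while outside the
  box some factor is 0 for every \<open>n\<close>. All values stay in [0, 1], which supplies the
  dominating function later.\<close>

definition bump :: "nat \<Rightarrow> 'a::euclidean_space \<Rightarrow> 'a \<Rightarrow> 'a \<Rightarrow> real" where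
  "bump n a b x = (\<Prod>i\<in>Basis. flat 1 (real (Suc n) * (x \<bullet> i - a \<bullet> i)) * flat 1 (real (Suc n) * (b \<bullet> i - x \<bullet> i)))"

lemma flat_1_bounds: "0 \<le> flat 1 t" "flat 1 t \<le> 1"
  by (auto simp: flat_def)

lemma bump_bounds: "0 \<le> bump n a b x" "bump n a b x \<le> 1"
  unfolding bump_def
  by (auto intro!: prod_nonneg prod_le_1 flat_1_bounds mult_nonneg_nonneg mult_le_one)

lemma bump_eq_0: "x \<notin> box a b \<Longrightarrow> bump n a b x = 0"
  unfolding bump_def box_def mem_Collect_eq
  by (subst prod_zero_iff) (auto simp: flat_def mult_le_0_iff zero_less_mult_iff)

lemma bump_tendsto: "(\<lambda>n. bump n a b x) \<longlonglongrightarrow> indicator (box a b) x"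
proof (cases "x \<in> box a b")
  case True
  have *: "(\<lambda>n. flat 1 (real (Suc n) * c)) \<longlonglongrightarrow> 1" if "c > 0" for c
  proof -
    have "(\<lambda>n. 1 / c * inverse (real (Suc n))) \<longlonglongrightarrow> 1 / c * 0"
      by (intro tendsto_mult tendsto_const LIMSEQ_inverse_real_of_nat)
    then have "(\<lambda>n. exp (- (1 / c * inverse (real (Suc n))))) \<longlonglongrightarrow> exp (- (1 / c * 0))"
      by (intro tendsto_exp tendsto_minus)
    moreover have "flat 1 (real (Suc n) * c) = exp (- (1 / c * inverse (real (Suc n))))" for n
      using that by (simp add: flat_def zero_less_mult_iff field_simps del: of_nat_Suc)
    ultimately show ?thesis by simp
  qed
  have "(\<lambda>n. bump n a b x) \<longlonglongrightarrow> (\<Prod>i\<in>(Basis :: 'a set). 1 * 1)"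
    unfolding bump_def
  proof (rule tendsto_prod)
    fix i :: 'a assume "i \<in> Basis"
    then show "(\<lambda>n. flat 1 (real (Suc n) * (x \<bullet> i - a \<bullet> i)) * flat 1 (real (Suc n) * (b \<bullet> i - x \<bullet> i))) \<longlonglongrightarrow> 1 * 1"
      using True by (intro tendsto_mult *) (auto simp: box_def)
  qed
  then show ?thesis using True by simp
qed (simp add: bump_eq_0)

lemma test_function_bump:
  fixes D :: "'a::euclidean_space set"
  assumes "cbox a b \<subseteq> D"
  shows "test_function D (bump n a b)"
proof -
  have "Ck k (bump n a b)" for k
    unfolding bump_def
  proof (intro Ck_prod Ck_mult)
    fix i :: 'a
    have "Ck k (\<lambda>x. flat 1 (x \<bullet> (real (Suc n) *\<^sub>R i) - real (Suc n) * (a \<bullet> i)))"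
      by (rule Ck_compose_affine[OF Ck_flat])
    then show "Ck k (\<lambda>x. flat 1 (real (Suc n) * (x \<bullet> i - a \<bullet> i)))"
      by (simp add: algebra_simps)
    have "Ck k (\<lambda>x. flat 1 (x \<bullet> (- real (Suc n) *\<^sub>R i) - (- real (Suc n) * (b \<bullet> i))))"
      by (rule Ck_compose_affine[OF Ck_flat])
    then show "Ck k (\<lambda>x. flat 1 (real (Suc n) * (b \<bullet> i - x \<bullet> i)))"
      by (simp add: algebra_simps)
  qed
  moreover have "closure {x. bump n a b x \<noteq> 0} \<subseteq> cbox a b"
    using bump_eq_0 box_subset_cbox by (intro closure_minimal) (auto, blast)
  ultimately show ?thesis
    unfolding test_function_def using assms compact_cbox
    by (meson closed_closure compact_Int_closed dual_order.trans inf.absorb_iff2 closed_subset compact_closure bounded_subset bounded_cbox closure_subset)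
qed

text \<open>Boxes form an intersection-stable generator of the Borel sets, so the vanishing of the
  integral extends to all Borel sets by Dynkin's argument; the densities \<open>h\<close> and 0 then
  define the same set function.\<close>

lemma AE_zero_if_box_integrals_zero:
  fixes h :: "'a::euclidean_space \<Rightarrow> real"
  assumes h: "integrable lborel h"
    and box: "\<And>a b. (LINT x|lborel. indicator (box a b) x * h x) = 0"
  shows "AE x in lborel. h x = 0"
proof -
  have [measurable]: "h \<in> borel_measurable borel" using h by auto
  have int: "integrable lborel (\<lambda>x. indicator A x * h x)" if "A \<in> sets borel" for A
    using integrable_mult_indicator[of A lborel h] h that by auto
  \<comment> \<open>The complement step of the induction needs the integral over the whole space,
    which is not itself a box; it is exhausted by boxes of half-width \<open>n\<close>.\<close>
  have UNIV: "(LINT x|lborel. h x) = 0"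
  proof -
    have "(\<lambda>n. LINT x|lborel. indicator (box (-(real n *\<^sub>R One)) (real n *\<^sub>R One)) x * h x) \<longlonglongrightarrow> (LINT x|lborel. h x)"
    proof (rule integral_dominated_convergence[where w="\<lambda>x. norm (h x)"])
      show "AE x in lborel. (\<lambda>n. indicator (box (-(real n *\<^sub>R One)) (real n *\<^sub>R One)) x * h x) \<longlonglongrightarrow> h x"
      proof (rule AE_I2)
        fix x :: 'a
        have "x \<in> (\<Union>n::nat. box (-(real n *\<^sub>R One)) (real n *\<^sub>R One))"
          using UN_box_eq_UNIV by auto
        then obtain N where N: "x \<in> box (-(real N *\<^sub>R One)) (real N *\<^sub>R One)" by auto
        have "x \<in> box (-(real n *\<^sub>R One)) (real n *\<^sub>R One)" if "n \<ge> N" for n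
          using N that by (force simp: mem_box)
        then show "(\<lambda>n. indicator (box (-(real n *\<^sub>R One)) (real n *\<^sub>R One)) x * h x) \<longlonglongrightarrow> h x"
          by (intro tendsto_eventually eventually_sequentiallyI[of N]) auto
      qed
    qed (use h in \<open>auto simp: indicator_def\<close>)
    then show ?thesis using box by (simp add: LIMSEQ_const_iff)
  qed
  have zero: "(LINT x|lborel. indicator A x * h x) = 0" if "A \<in> sets borel" for A
  proof -
    let ?G = "range (\<lambda>(a, b). box a b :: 'a set)"
    have "Int_stable ?G"
      by (auto simp: Int_stable_def box_Int_box)
    moreover have "?G \<subseteq> Pow UNIV" by auto
    moreover have "A \<in> sigma_sets UNIV ?G" using that by (simp add: borel_eq_box)
    ultimately show ?thesis
    proof (induction rule: sigma_sets_induct_disjoint)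
      case (basic A) then show ?case using box by auto
    next
      case empty then show ?case by simp
    next
      case (compl A)
      then have A: "A \<in> sets borel" by (simp add: borel_eq_box)
      have "(LINT x|lborel. indicator (UNIV - A) x * h x) = (LINT x|lborel. h x - indicator A x * h x)"
        by (intro Bochner_Integration.integral_cong) (auto simp: indicator_def)
      also have "\<dots> = 0" using h int[OF A] compl UNIV by simp
      finally show ?case .
    next
      case (union A)
      then have A: "A i \<in> sets borel" for i by (auto simp: borel_eq_box)
      have "(LINT x:(\<Union>i. A i)|lborel. h x) = (\<Sum>i. LINT x:A i|lborel. h x)"
        by (rule lebesgue_integral_countable_add)
          (use union A h int[of "\<Union>i. A i"] in \<open>auto simp: disjoint_family_on_def set_integrable_def\<close>)
      then show ?case using union by (simp add: set_lebesgue_integral_def)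
    qed
  qed
  show ?thesis
  proof (rule density_unique_real)
    show "set_lebesgue_integral lborel A h = set_lebesgue_integral lborel A (\<lambda>x. 0)" if "A \<in> sets lborel" for A
      using zero[of A] that by (simp add: set_lebesgue_integral_def)
  qed (use h in auto)
qed

text \<open>Bumps inside \<open>D\<close> converge to the indicator of any box whose closure lies in
  \<open>D\<close>. Hence the integrals over such boxes vanish, which localises the box criterion to
  each member of a countable cover of \<open>D\<close>.\<close>

lemma fundamental_lemma:
  fixes D :: "'a::euclidean_space set" and h :: "'a \<Rightarrow> real"
  assumes D: "open D" and h: "integrable (lebesgue_on D) h"
    and test: "\<And>\<phi>. test_function D \<phi> \<Longrightarrow> (LINT x|lebesgue_on D. h x * \<phi> x) = 0"
  shows "AE x in lebesgue_on D. h x = 0"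
proof -
  have Ds [measurable]: "D \<in> sets borel" using D by auto
  let ?H = "\<lambda>x. indicator D x * h x"
  have H: "integrable lebesgue ?H"
    using h by (subst (asm) integrable_restrict_space) auto
  \<comment> \<open>The box criterion is a statement about Borel functions and
    \<open>lborel\<close>, so the zero extension of \<open>h\<close> is replaced by a Borel
    version.\<close>
  obtain H' where H'm [measurable]: "H' \<in> borel_measurable borel" and H': "AE x in lborel. ?H x = H' x"
    using completion_ex_borel_measurable_real[of ?H lborel] H by auto
  have H'ae: "AE x in lebesgue. ?H x = H' x"
    using H' by (simp add: AE_completion_iff)
  have "integrable lebesgue H'"
    by (rule integrable_cong_AE_imp[OF H]) (use H'ae in \<open>auto intro: measurable_completion\<close>)
  then have intH': "integrable lborel H'" by (simp add: integrable_completion)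
  have box0: "(LINT x|lborel. indicator (box a b) x * H' x) = 0" if ab: "cbox a b \<subseteq> D" for a b
  proof -
    have [measurable]: "bump n a b \<in> borel_measurable borel" for n
      using test_function_bump[of a b UNIV n] unfolding test_function_def
      by (intro borel_measurable_continuous_onI Ck_continuous[of 0]) simp
    have "(LINT x|lborel. bump n a b x * H' x) = 0" for n
    proof -
      have "(LINT x|lborel. bump n a b x * H' x) = (LINT x|lebesgue. bump n a b x * H' x)"
        by (rule integral_completion[symmetric]) measurable
      also have "\<dots> = (LINT x|lebesgue. indicator D x * (h x * bump n a b x))"
      proof (rule integral_cong_AE)
        show "(\<lambda>x. bump n a b x * H' x) \<in> borel_measurable lebesgue"
          by (rule measurable_completion) measurable
        have "bump n a b \<in> borel_measurable lebesgue" by (rule measurable_completion) measurable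
        then have "(\<lambda>x. ?H x * bump n a b x) \<in> borel_measurable lebesgue"
          using borel_measurable_integrable[OF H] by (rule borel_measurable_times[rotated])
        then show "(\<lambda>x. indicator D x * (h x * bump n a b x)) \<in> borel_measurable lebesgue"
          by (simp add: ac_simps)
        show "AE x in lebesgue. bump n a b x * H' x = indicator D x * (h x * bump n a b x)"
          using H'ae
        proof eventually_elim
          case (elim x)
          show ?case unfolding elim[symmetric] by (simp add: ac_simps)
        qed
      qed
      also have "\<dots> = (LINT x|lebesgue_on D. h x * bump n a b x)"
        by (subst integral_restrict_space) auto
      also have "\<dots> = 0" by (rule test[OF test_function_bump[OF ab]])
      finally show ?thesis .
    qed
    moreover have "(\<lambda>n. LINT x|lborel. bump n a b x * H' x) \<longlonglongrightarrow> (LINT x|lborel. indicator (box a b) x * H' x)"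
    proof (rule integral_dominated_convergence[where w="\<lambda>x. norm (H' x)"])
      show "AE x in lborel. (\<lambda>n. bump n a b x * H' x) \<longlonglongrightarrow> indicator (box a b) x * H' x"
        by (intro AE_I2 tendsto_mult bump_tendsto tendsto_const)
      show "AE x in lborel. norm (bump n a b x * H' x) \<le> norm (H' x)" for n
        using bump_bounds[of n a b] by (auto simp: abs_mult intro!: mult_left_le_one_le)
    qed (use intH' in auto)
    ultimately show ?thesis by (simp add: LIMSEQ_const_iff)
  qed
  obtain \<D> where \<D>: "countable \<D>" "\<D> \<subseteq> Pow D"
      "\<And>X. X \<in> \<D> \<Longrightarrow> \<exists>a b. X = cbox a b" "\<Union>\<D> = D"
    by (rule open_countable_Union_open_cbox[OF D], rule that)
  have zero: "AE x in lborel. x \<in> X \<longrightarrow> H' x = 0" if X: "X \<in> \<D>" for X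
  proof -
    obtain c d where cd: "X = cbox c d" "cbox c d \<subseteq> D" using \<D>(2) \<D>(3)[OF X] X by auto
    have "AE x in lborel. indicator (box c d) x * H' x = 0"
    proof (rule AE_zero_if_box_integrals_zero)
      show "integrable lborel (\<lambda>x. indicator (box c d) x * H' x)"
        using integrable_mult_indicator[of "box c d" lborel H'] intH' by simp
      fix a b
      obtain p q where pq: "box a b \<inter> box c d = box p q" by (rule that[OF box_Int_box])
      \<comment> \<open>A nonempty open box has \<open>cbox p q\<close> as its closure, which stays
        in \<open>cbox c d\<close>. If the intersection is empty, its corners are arbitrary, but
        then the integral is trivially 0.\<close>
      have "cbox p q \<subseteq> D \<or> box p q = {}"
      proof (cases "box p q = {}")
        case False
        then have "cbox p q = closure (box p q)" by (simp add: closure_box)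
        also have "\<dots> \<subseteq> cbox c d" using pq box_subset_cbox
          by (intro closure_minimal) auto
        finally show ?thesis using cd by auto
      qed simp
      then have "(LINT x|lborel. indicator (box p q) x * H' x) = 0"
        using box0[of p q] by auto
      then show "(LINT x|lborel. indicator (box a b) x * (indicator (box c d) x * H' x)) = 0"
        unfolding pq[symmetric] indicator_inter_arith by (simp add: ac_simps)
    qed
    \<comment> \<open>The cover consists of closed boxes, while the criterion was applied on the
      open one; the faces are a null set.\<close>
    moreover have "AE x in lebesgue. x \<notin> cbox c d - box c d"
      using negligible_frontier_interval[of c d] by (intro AE_not_in) (simp add: negligible_iff_null_sets)
    then have "AE x in lborel. x \<notin> cbox c d - box c d" by (simp add: AE_completion_iff)
    ultimately show ?thesis by eventually_elim (auto simp: cd indicator_def)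
  qed
  have "AE x in lborel. \<forall>X\<in>\<D>. x \<in> X \<longrightarrow> H' x = 0"
    using zero \<D>(1) by (subst AE_ball_countable) auto
  then have "AE x in lebesgue. x \<in> D \<longrightarrow> h x = 0"
    using H' unfolding AE_completion_iff
    by eventually_elim (use \<D>(4) in \<open>auto simp: indicator_def\<close>)
  then show ?thesis
    by (simp add: AE_restrict_space_iff)
qed

section \<open>Square-integrable functions and the Cauchy-Schwarz inequality\<close>

lemma quadratic_nonneg_imp_discriminant:
  fixes A B C :: real
  assumes "\<And>t. 0 \<le> A + 2 * t * B + t\<^sup>2 * C" "0 \<le> A" "0 \<le> C"
  shows "\<bar>B\<bar> \<le> sqrt A * sqrt C"
proof -
  have "B\<^sup>2 \<le> A * C"
  proof (cases "C = 0")
    case True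
    show ?thesis
    proof (cases "B = 0")
      case False
      \<comment> \<open>For \<open>C = 0\<close> the expression is affine in \<open>t\<close>; this
        \<open>t\<close> gives it the value -1.\<close>
      have "0 \<le> A + 2 * (- (A + 1) / (2 * B)) * B" using assms(1)[of "- (A + 1) / (2 * B)"] True by simp
      also have "\<dots> = - 1" using False by (simp add: field_simps)
      finally show ?thesis by simp
    qed (use True in simp)
  next
    case False
    then have C: "C > 0" using assms by simp
    \<comment> \<open>The parabola is evaluated at its minimiser.\<close>
    have "0 \<le> A + 2 * (- B / C) * B + (- B / C)\<^sup>2 * C" by (rule assms)
    also have "\<dots> = A - B\<^sup>2 / C" using C by (simp add: field_simps power2_eq_square)
    finally show ?thesis using C by (simp add: field_simps)
  qed
  then show ?thesis
    by (metis real_sqrt_abs real_sqrt_le_iff real_sqrt_mult)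
qed

definition square_integrable :: "'a measure \<Rightarrow> ('a \<Rightarrow> 'b::euclidean_space) \<Rightarrow> bool" where
  "square_integrable M G \<longleftrightarrow> G \<in> borel_measurable M \<and> integrable M (\<lambda>x. (norm (G x))\<^sup>2)"

definition seminorm2 :: "'a measure \<Rightarrow> ('a \<Rightarrow> 'b::euclidean_space) \<Rightarrow> real" where
  "seminorm2 M G = sqrt (LINT x|M. (norm (G x))\<^sup>2)"

lemma square_integrable_inner:
  fixes G H :: "'a \<Rightarrow> 'b::euclidean_space"
  assumes "square_integrable M G" "square_integrable M H"
  shows "integrable M (\<lambda>x. G x \<bullet> H x)"
proof (rule Bochner_Integration.integrable_bound)
  show "integrable M (\<lambda>x. (norm (G x))\<^sup>2 + (norm (H x))\<^sup>2)"
    using assms by (auto simp: square_integrable_def)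
  show "(\<lambda>x. G x \<bullet> H x) \<in> borel_measurable M"
    using assms by (auto simp: square_integrable_def)
  have "\<bar>g \<bullet> h\<bar> \<le> (norm g)\<^sup>2 + (norm h)\<^sup>2" for g h :: 'b
    using Cauchy_Schwarz_ineq2[of g h] sum_squares_bound[of "norm g" "norm h"]
      mult_nonneg_nonneg[OF norm_ge_zero norm_ge_zero, of g h] by linarith
  then show "AE x in M. norm (G x \<bullet> H x) \<le> norm ((norm (G x))\<^sup>2 + (norm (H x))\<^sup>2)"
    by auto
qed

lemma norm_add_scaleR_square:
  fixes g h :: "'b::real_inner"
  shows "(norm (g + c *\<^sub>R h))\<^sup>2 = (norm g)\<^sup>2 + 2 * c * (g \<bullet> h) + c\<^sup>2 * (norm h)\<^sup>2"
  unfolding power2_norm_eq_inner by (simp add: inner_simps inner_commute power2_eq_square)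

lemma square_integrable_add_scaleR:
  fixes G H :: "'a \<Rightarrow> 'b::euclidean_space"
  assumes "square_integrable M G" "square_integrable M H"
  shows "square_integrable M (\<lambda>x. G x + c *\<^sub>R H x)"
  using assms square_integrable_inner[OF assms]
  by (auto simp: square_integrable_def norm_add_scaleR_square)

lemma seminorm2_square: "(seminorm2 M G)\<^sup>2 = (LINT x|M. (norm (G x))\<^sup>2)"
  by (simp add: seminorm2_def)

lemma seminorm2_add_scaleR_square:
  fixes G H :: "'a \<Rightarrow> 'b::euclidean_space"
  assumes "square_integrable M G" "square_integrable M H"
  shows "(seminorm2 M (\<lambda>x. G x + c *\<^sub>R H x))\<^sup>2 =
    (seminorm2 M G)\<^sup>2 + 2 * c * (LINT x|M. G x \<bullet> H x) + c\<^sup>2 * (seminorm2 M H)\<^sup>2"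
proof -
  have "(LINT x|M. (norm (G x + c *\<^sub>R H x))\<^sup>2) =
    (LINT x|M. (norm (G x))\<^sup>2) + 2 * c * (LINT x|M. G x \<bullet> H x) + c\<^sup>2 * (LINT x|M. (norm (H x))\<^sup>2)"
    using assms square_integrable_inner[OF assms]
    by (simp add: square_integrable_def norm_add_scaleR_square)
  then show ?thesis by (simp add: seminorm2_square)
qed

lemma seminorm2_nonneg [simp]: "0 \<le> seminorm2 M G"
  by (simp add: seminorm2_def)

lemma Cauchy_Schwarz_integral:
  fixes G H :: "'a \<Rightarrow> 'b::euclidean_space"
  assumes "square_integrable M G" "square_integrable M H"
  shows "\<bar>LINT x|M. G x \<bullet> H x\<bar> \<le> seminorm2 M G * seminorm2 M H"
proof -
  have "0 \<le> (seminorm2 M G)\<^sup>2 + 2 * t * (LINT x|M. G x \<bullet> H x) + t\<^sup>2 * (seminorm2 M H)\<^sup>2" for t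
    using seminorm2_add_scaleR_square[OF assms, of t, symmetric] by simp
  from quadratic_nonneg_imp_discriminant[OF this] show ?thesis by simp
qed

lemma seminorm2_triangle:
  fixes G H :: "'a \<Rightarrow> 'b::euclidean_space"
  assumes "square_integrable M G" "square_integrable M H"
  shows "seminorm2 M (\<lambda>x. G x + H x) \<le> seminorm2 M G + seminorm2 M H"
proof (rule power2_le_imp_le)
  show "(seminorm2 M (\<lambda>x. G x + H x))\<^sup>2 \<le> (seminorm2 M G + seminorm2 M H)\<^sup>2"
    using seminorm2_add_scaleR_square[OF assms, of 1] Cauchy_Schwarz_integral[OF assms]
    by (simp add: power2_sum)
qed simp

lemma square_integrable_real_iff_L2: "square_integrable (lebesgue_on S) (g :: _ \<Rightarrow> real) \<longleftrightarrow> L2 S g"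
  by (simp add: square_integrable_def L2_def)

lemma borel_measurable_vec_iff:
  fixes G :: "'a \<Rightarrow> real^'d"
  shows "G \<in> borel_measurable M \<longleftrightarrow> (\<forall>i. (\<lambda>x. G x $ i) \<in> borel_measurable M)"
  by (subst borel_measurable_euclidean_space) (auto simp: Basis_vec_def inner_axis)

lemma square_integrable_vec_iff:
  fixes G :: "'a \<Rightarrow> real^'d"
  shows "square_integrable M G \<longleftrightarrow> (\<forall>i. square_integrable M (\<lambda>x. G x $ i))"
proof
  assume G: "square_integrable M G"
  show "\<forall>i. square_integrable M (\<lambda>x. G x $ i)"
  proof
    fix i
    have m: "(\<lambda>x. G x $ i) \<in> borel_measurable M"
      using G by (simp add: square_integrable_def borel_measurable_vec_iff)
    then show "square_integrable M (\<lambda>x. G x $ i)"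
      using G component_le_norm_cart[of "G _" i]
      by (auto simp: square_integrable_def abs_le_square_iff[symmetric]
          intro!: Bochner_Integration.integrable_bound[of M "\<lambda>x. (norm (G x))\<^sup>2"])
  qed
next
  assume *: "\<forall>i. square_integrable M (\<lambda>x. G x $ i)"
  have "(norm (G x))\<^sup>2 = (\<Sum>i\<in>UNIV. (G x $ i)\<^sup>2)" for x
    by (simp add: norm_vec_def L2_set_def sum_nonneg)
  then show "square_integrable M G"
    using * by (auto simp: square_integrable_def borel_measurable_vec_iff)
qed

section \<open>Test functions\<close>

text \<open>A subset of a separable metric space is separable; here the countable set has to lie
  inside \<open>S\<close> itself. One member of \<open>S\<close> is picked for each realisable
  finite record: a modulus of continuity and approximate values on a finite net of
  \<open>K\<close>.\<close>

lemma countable_uniformly_dense_subset: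
  fixes S :: "('a::metric_space \<Rightarrow> 'b::{metric_space, second_countable_topology}) set"
  assumes K: "compact K" and S: "\<And>f. f \<in> S \<Longrightarrow> continuous_on K f"
  obtains T where "countable T" "T \<subseteq> S"
    "\<And>f e. f \<in> S \<Longrightarrow> 0 < e \<Longrightarrow> \<exists>g\<in>T. \<forall>x\<in>K. dist (f x) (g x) < e"
proof -
  obtain Q :: "'b set" where Q: "countable Q" "\<And>U. open U \<Longrightarrow> U \<noteq> {} \<Longrightarrow> \<exists>q\<in>Q. q \<in> U"
    by (rule countable_dense_setE, rule that)
  have "\<exists>P. finite P \<and> P \<subseteq> K \<and> K \<subseteq> (\<Union>p\<in>P. ball p (inverse (real (Suc m))))" for m
    using seq_compact_imp_totally_bounded[of K] K
    by (auto simp: compact_eq_seq_compact_metric simp del: of_nat_Suc)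
  then obtain P where P: "\<And>m. finite (P m)" "\<And>m. P m \<subseteq> K"
    "\<And>m. K \<subseteq> (\<Union>p\<in>P m. ball p (inverse (real (Suc m))))"
    by metis
  define L where "L = (SIGMA n:(UNIV::nat set). SIGMA m:(UNIV::nat set). (P m \<rightarrow>\<^sub>E Q))"
  \<comment> \<open>Two members with the same record \<open>(n, m, q)\<close> differ on
    \<open>K\<close> by less than four times 1/(n+1): two oscillations towards a net point and two
    approximations of \<open>q\<close> there. One representative per nonempty class is therefore
    enough.\<close>
  define A where "A l = {f \<in> S. case l of (n, m, q) \<Rightarrow>
      (\<forall>x\<in>K. \<forall>y\<in>K. dist x y < inverse (real (Suc m)) \<longrightarrow> dist (f x) (f y) < inverse (real (Suc n))) \<and>
      (\<forall>p\<in>P m. dist (f p) (q p) < inverse (real (Suc n)))}" for l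
  define T where "T = (\<lambda>l. SOME f. f \<in> A l) ` {l \<in> L. A l \<noteq> {}}"
  have rep: "(SOME f. f \<in> A l) \<in> A l" if "A l \<noteq> {}" for l
    using that by (simp add: some_in_eq)
  show thesis
  proof (rule that)
    have "countable (P m \<rightarrow>\<^sub>E Q)" for m by (rule countable_PiE[OF P(1) Q(1)])
    then have "countable L" unfolding L_def by (intro countable_SIGMA countableI_type)
    then have "countable {l \<in> L. A l \<noteq> {}}" by (rule countable_subset[rotated]) blast
    then show "countable T" unfolding T_def by (rule countable_image)
    show "T \<subseteq> S" unfolding T_def using rep by (auto simp: A_def)
    fix f and e :: real assume f: "f \<in> S" and e: "0 < e"
    \<comment> \<open>The quarter matches the four distances in the triangle inequality
      below.\<close>
    obtain n where n: "inverse (real (Suc n)) < e / 4"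
      using reals_Archimedean[of "e / 4"] e by auto
    let ?d = "inverse (real (Suc n))"
    have d: "0 < ?d" by simp
    have "uniformly_continuous_on K f" by (rule compact_uniformly_continuous[OF S[OF f] K])
    then obtain \<delta> where \<delta>: "0 < \<delta>" "\<And>x y. x \<in> K \<Longrightarrow> y \<in> K \<Longrightarrow> dist x y < \<delta> \<Longrightarrow> dist (f x) (f y) < ?d"
      unfolding uniformly_continuous_on_def using d by (metis dist_commute)
    obtain m where m: "inverse (real (Suc m)) < \<delta>"
      using reals_Archimedean[OF \<delta>(1)] by auto
    have "\<exists>q\<in>Q. dist (f p) q < ?d" for p
      using Q(2)[of "ball (f p) ?d"] d by (auto simp: ball_eq_empty)
    then obtain q where q: "\<And>p. q p \<in> Q" "\<And>p. dist (f p) (q p) < ?d" by metis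
    let ?l = "(n, m, restrict q (P m))"
    have l: "?l \<in> L" unfolding L_def using q(1) by auto
    have fA: "f \<in> A ?l" unfolding A_def using f \<delta>(2) m q(2) by auto
    then have ne: "A ?l \<noteq> {}" by auto
    let ?g = "SOME g. g \<in> A ?l"
    have gA: "?g \<in> A ?l" by (rule rep[OF ne])
    have "dist (f x) (?g x) < e" if x: "x \<in> K" for x
    proof -
      obtain p where p: "p \<in> P m" "dist p x < inverse (real (Suc m))" using P(3)[of m] x by auto
      have pK: "p \<in> K" using p P(2) by auto
      have osc: "dist (h x) (h p) < ?d \<and> dist (h p) (q p) < ?d" if "h \<in> A ?l" for h
        using that x pK p unfolding A_def by (auto simp: dist_commute)
      have "dist (f x) (?g x) \<le> dist (f x) (f p) + dist (f p) (q p) + dist (?g p) (q p) + dist (?g x) (?g p)"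
        using dist_triangle[of "f x" "?g x" "f p"] dist_triangle[of "f p" "?g x" "q p"]
          dist_triangle[of "q p" "?g x" "?g p"] by (simp add: dist_commute)
      then show ?thesis using osc[OF fA] osc[OF gA] n by linarith
    qed
    moreover have "?g \<in> T" unfolding T_def using l ne by blast
    ultimately show "\<exists>g\<in>T. \<forall>x\<in>K. dist (f x) (g x) < e" by blast
  qed
qed

section \<open>Derivatives of compactly supported functions have integral zero\<close>

lemma integral_translate:
  fixes g :: "'a::euclidean_space \<Rightarrow> real"
  assumes [measurable]: "g \<in> borel_measurable borel"
  shows "(LINT x|lborel. g (c + x)) = (LINT x|lborel. g x)"
proof -
  have "(LINT x|lborel. g x) = (LINT x|distr lborel borel ((+) c). g x)"
    by (simp add: lborel_distr_plus)
  also have "\<dots> = (LINT x|lborel. g (c + x))" by (intro integral_distr) auto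
  finally show ?thesis by simp
qed

text \<open>By translation invariance every difference quotient in direction \<open>v\<close> has
  integral 0. The mean value theorem bounds the quotients uniformly, and dominated convergence
  passes to the derivative.\<close>

lemma integral_derivative_compact_support:
  fixes g :: "'a::euclidean_space \<Rightarrow> real"
  assumes g: "\<And>x. (g has_derivative g' x) (at x)"
    and cont: "continuous_on UNIV (\<lambda>x. g' x v)"
    and K: "compact K" "\<And>x. x \<notin> K \<Longrightarrow> g x = 0"
  shows "(LINT x|lborel. g' x v) = 0"
proof -
  have contg: "continuous_on UNIV g"
    by (intro continuous_at_imp_continuous_on ballI has_derivative_continuous[OF g])
  have [measurable]: "g \<in> borel_measurable borel" "(\<lambda>x. g' x v) \<in> borel_measurable borel"
    using contg cont by (auto intro: borel_measurable_continuous_onI)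
  obtain R where R: "0 < R" "K \<subseteq> cball 0 R"
    using compact_imp_bounded[OF K(1)] by (metis bounded_pos mem_cball_0 subsetI)
  \<comment> \<open>The complement of \<open>K\<close> is open, so the derivative vanishes there
    too; compactness of \<open>K\<close> then yields a global bound for it.\<close>
  have out: "g' x v = 0" if "x \<notin> K" for x
  proof -
    have "open (- K)" using K(1) by (simp add: compact_imp_closed open_Compl)
    have "((\<lambda>x. 0) has_derivative g' x) (at x)"
      by (rule has_derivative_transform_within_open[OF g \<open>open (- K)\<close>]) (use that K(2) in auto)
    then have "g' x = (\<lambda>h. 0)" by (rule has_derivative_unique[OF has_derivative_const, symmetric])
    then show ?thesis by simp
  qed
  obtain M where M: "0 < M" "\<And>x. \<bar>g' x v\<bar> \<le> M"
  proof -
    have "compact ((\<lambda>x. g' x v) ` K)"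
      by (intro compact_continuous_image K(1) continuous_on_subset[OF cont]) auto
    then obtain M where M: "0 < M" "\<forall>y\<in>(\<lambda>x. g' x v) ` K. norm y \<le> M"
      using compact_imp_bounded bounded_pos by metis
    have "\<bar>g' x v\<bar> \<le> M" for x using M out[of x] by (cases "x \<in> K") auto
    with M(1) show thesis by (rule that)
  qed
  let ?h = "\<lambda>n. inverse (real (Suc n))"
  let ?q = "\<lambda>n x. (g (?h n *\<^sub>R v + x) - g x) / ?h n"
  \<comment> \<open>The steps are at most 1, so every \<open>x\<close> for which \<open>x\<close> or
    its translate lies in \<open>K\<close> belongs to this enlarged ball.\<close>
  let ?B = "cball 0 (R + norm v) :: 'a set"
  have int_compact: "integrable lborel g"
  proof -
    have "integrable lborel (\<lambda>x. indicator K x *\<^sub>R g x)"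
      by (rule borel_integrable_compact[OF K(1)]) (use contg continuous_on_subset in auto)
    moreover have "(\<lambda>x. indicator K x *\<^sub>R g x) = g" using K(2) by (auto simp: fun_eq_iff indicator_def)
    ultimately show ?thesis by simp
  qed
  have int_tr: "integrable lborel (\<lambda>x. g (c + x))" for c
  proof -
    have "integrable (distr lborel borel ((+) c)) g" using int_compact by (simp add: lborel_distr_plus)
    then show ?thesis by (subst (asm) integrable_distr_eq) auto
  qed
  have zero: "(LINT x|lborel. ?q n x) = 0" for n
    using int_tr[of "?h n *\<^sub>R v"] int_compact by (simp add: integral_translate)
  have bound: "\<bar>?q n x\<bar> \<le> M * indicator ?B x" for n x
  proof (cases "x \<in> ?B")
    case True
    let ?k = "\<lambda>t. g (t *\<^sub>R v + x)"
    have "(?k has_real_derivative g' (t *\<^sub>R v + x) v) (at t)" for t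
    proof -
      have "((\<lambda>t. t *\<^sub>R v + x) has_derivative (\<lambda>s. s *\<^sub>R v)) (at t)"
        by (auto intro!: derivative_eq_intros)
      from diff_chain_at[OF this g] have "(?k has_derivative (\<lambda>s. g' (t *\<^sub>R v + x) (s *\<^sub>R v))) (at t)"
        by (simp add: o_def)
      moreover have "g' (t *\<^sub>R v + x) (s *\<^sub>R v) = g' (t *\<^sub>R v + x) v * s" for s
        using linear_scale[OF has_derivative_linear[OF g]] by (simp add: mult.commute)
      ultimately show ?thesis by (simp add: has_field_derivative_def)
    qed
    then have "\<exists>z. 0 < z \<and> z < ?h n \<and> ?k (?h n) - ?k 0 = (?h n - 0) * g' (z *\<^sub>R v + x) v"
      by (intro MVT2) auto
    then obtain z where "?k (?h n) - ?k 0 = ?h n * g' (z *\<^sub>R v + x) v" by auto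
    then have "?q n x = g' (z *\<^sub>R v + x) v" by simp
    then show ?thesis using M(2) True by simp
  next
    case False
    have "norm x > R + norm v" using False by auto
    moreover have "norm (?h n *\<^sub>R v) \<le> norm v"
      by (simp add: mult_left_le_one_le inverse_le_1_iff)
    moreover have "norm x \<le> norm (?h n *\<^sub>R v + x) + norm (?h n *\<^sub>R v)"
      using norm_triangle_ineq4[of "?h n *\<^sub>R v + x" "?h n *\<^sub>R v"] by simp
    ultimately have "norm (?h n *\<^sub>R v + x) > R" "norm x > R" using norm_ge_zero[of v] by linarith+
    then have "?h n *\<^sub>R v + x \<notin> K" "x \<notin> K" using R(2) by (auto simp: subset_iff not_le[symmetric])
    then show ?thesis using K(2) False by simp
  qed
  have "(\<lambda>n. LINT x|lborel. ?q n x) \<longlonglongrightarrow> (LINT x|lborel. g' x v)"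
  proof (rule integral_dominated_convergence[where w="\<lambda>x. M * indicator ?B x"])
    show "integrable lborel (\<lambda>x. M * indicator ?B x)"
      using emeasure_bounded_finite[of ?B]
      by (intro integrable_mult_right integrable_real_indicator) (simp_all add: bounded_cball)
    show "AE x in lborel. (\<lambda>n. ?q n x) \<longlonglongrightarrow> g' x v"
    proof (rule AE_I2)
      fix x
      have "((\<lambda>t. g (x + t *\<^sub>R v)) has_real_derivative g' x v) (at 0)"
      proof -
        have "((\<lambda>t. x + t *\<^sub>R v) has_derivative (\<lambda>s. s *\<^sub>R v)) (at 0)"
          by (auto intro!: derivative_eq_intros)
        moreover have "(g has_derivative g' x) (at (x + 0 *\<^sub>R v))" using g by simp
        ultimately have "((\<lambda>t. g (x + t *\<^sub>R v)) has_derivative (\<lambda>s. g' x (s *\<^sub>R v))) (at 0)"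
          using diff_chain_at[of "\<lambda>t. x + t *\<^sub>R v" _ 0 g] by (simp add: o_def)
        moreover have "g' x (s *\<^sub>R v) = g' x v * s" for s
          using linear_scale[OF has_derivative_linear[OF g]] by (simp add: mult.commute)
        ultimately show ?thesis by (simp add: has_field_derivative_def)
      qed
      then have "((\<lambda>h. (g (x + h *\<^sub>R v) - g x) / h) \<longlongrightarrow> g' x v) (at 0)" by (simp add: DERIV_def)
      moreover have "filterlim ?h (at 0) sequentially"
        by (intro filterlim_atI LIMSEQ_inverse_real_of_nat) auto
      ultimately have "(\<lambda>n. (g (x + ?h n *\<^sub>R v) - g x) / ?h n) \<longlonglongrightarrow> g' x v"
        by (rule filterlim_compose)
      then show "(\<lambda>n. ?q n x) \<longlonglongrightarrow> g' x v" by (simp add: add.commute)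
    qed
    show "AE x in lborel. norm (?q n x) \<le> M * indicator ?B x" for n using bound by auto
  qed measurable
  then show ?thesis using zero by (simp add: LIMSEQ_const_iff)
qed

definition grad :: "(real^'d \<Rightarrow> real) \<Rightarrow> real^'d \<Rightarrow> real^'d" where
  "grad \<phi> x = (\<chi> i. frechet_derivative \<phi> (at x) (axis i 1))"

lemma
  fixes \<phi> :: "'a::euclidean_space \<Rightarrow> real"
  assumes \<phi>: "test_function D \<phi>"
  shows test_function_has_derivative: "(\<phi> has_derivative frechet_derivative \<phi> (at x)) (at x)"
    and test_function_continuous: "continuous_on UNIV \<phi>"
    and test_function_derivative_continuous: "continuous_on UNIV (\<lambda>x. frechet_derivative \<phi> (at x) v)"
    and test_function_outside: "x \<notin> D \<Longrightarrow> \<phi> x = 0"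
    and test_function_derivative_outside: "x \<notin> D \<Longrightarrow> frechet_derivative \<phi> (at x) v = 0"
proof -
  have "Ck (Suc 0) \<phi>" using \<phi> by (simp only: test_function_def)
  then obtain \<phi>' where \<phi>': "\<And>x. (\<phi> has_derivative \<phi>' x) (at x)" "\<And>v. continuous_on UNIV (\<lambda>x. \<phi>' x v)"
    by auto
  have eq: "frechet_derivative \<phi> (at x) = \<phi>' x" for x
    using frechet_derivative_at[OF \<phi>'(1)] by simp
  show "(\<phi> has_derivative frechet_derivative \<phi> (at x)) (at x)" for x using \<phi>' eq by simp
  show "continuous_on UNIV (\<lambda>x. frechet_derivative \<phi> (at x) v)" using \<phi>' eq by simp
  show "continuous_on UNIV \<phi>"
    by (intro continuous_at_imp_continuous_on ballI has_derivative_continuous[OF \<phi>'(1)])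
  let ?K = "closure {x. \<phi> x \<noteq> 0}"
  have KD: "?K \<subseteq> D" using \<phi> by (simp add: test_function_def)
  have out: "\<phi> x = 0" if "x \<notin> ?K" for x using that closure_subset[of "{x. \<phi> x \<noteq> 0}"] by auto
  then show "x \<notin> D \<Longrightarrow> \<phi> x = 0" using KD by blast
  assume "x \<notin> D"
  then have "x \<in> - ?K" using KD by blast
  have "((\<lambda>x. 0) has_derivative \<phi>' x) (at x)"
  proof (rule has_derivative_transform_within_open[OF \<phi>'(1) _ \<open>x \<in> - ?K\<close>])
    show "\<phi> y = 0" if "y \<in> - ?K" for y by (rule out) (use that in blast)
  qed (rule open_Compl[OF closed_closure])
  then have "\<phi>' x = (\<lambda>h. 0)" by (rule has_derivative_unique[OF has_derivative_const, symmetric])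
  then show "frechet_derivative \<phi> (at x) v = 0" using eq by simp
qed

lemma test_function_add_scale:
  assumes \<phi>: "test_function D \<phi>" and \<psi>: "test_function D \<psi>"
  shows "test_function D (\<lambda>x. \<phi> x + c * \<psi> x)"
proof -
  let ?K = "\<lambda>\<phi>. closure {x. \<phi> x \<noteq> (0::real)}"
  let ?h = "\<lambda>x. \<phi> x + c * \<psi> x"
  have sub: "?K ?h \<subseteq> ?K \<phi> \<union> ?K \<psi>"
  proof (rule closure_minimal)
    have "{x. ?h x \<noteq> 0} \<subseteq> {x. \<phi> x \<noteq> 0} \<union> {x. \<psi> x \<noteq> 0}" by auto
    also have "\<dots> \<subseteq> ?K \<phi> \<union> ?K \<psi>" by (intro Un_mono closure_subset)
    finally show "{x. ?h x \<noteq> 0} \<subseteq> ?K \<phi> \<union> ?K \<psi>" .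
  qed (intro closed_Un closed_closure)
  have KK: "compact (?K \<phi> \<union> ?K \<psi>)" "?K \<phi> \<union> ?K \<psi> \<subseteq> D"
    using \<phi> \<psi> by (auto simp: test_function_def)
  have "compact ((?K \<phi> \<union> ?K \<psi>) \<inter> ?K ?h)"
    by (rule compact_Int_closed[OF KK(1) closed_closure])
  then have "compact (?K ?h)" using sub by (simp add: Int_absorb1)
  moreover have "?K ?h \<subseteq> D" using sub KK(2) by (rule subset_trans)
  moreover have "Ck k ?h" for k
    using \<phi> \<psi> unfolding test_function_def by (intro Ck_add Ck_mult Ck_const) blast+
  ultimately show ?thesis unfolding test_function_def by blast
qed

lemma grad_continuous:
  fixes \<phi> :: "real^'d \<Rightarrow> real"
  assumes "test_function D \<phi>" shows "continuous_on UNIV (grad \<phi>)"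
  unfolding grad_def by (intro continuous_on_vec_lambda test_function_derivative_continuous[OF assms])

lemma grad_outside: "test_function D \<phi> \<Longrightarrow> x \<notin> D \<Longrightarrow> grad \<phi> x = 0"
  by (simp add: grad_def test_function_derivative_outside vec_eq_iff)

lemma grad_add_scale:
  assumes \<phi>: "test_function D \<phi>" and \<psi>: "test_function D \<psi>"
  shows "grad (\<lambda>x. \<phi> x + c * \<psi> x) x = grad \<phi> x + c *\<^sub>R grad \<psi> x"
proof -
  have "((\<lambda>x. \<phi> x + c * \<psi> x) has_derivative
    (\<lambda>h. frechet_derivative \<phi> (at x) h + c * frechet_derivative \<psi> (at x) h)) (at x)"
    by (intro has_derivative_add has_derivative_mult_right test_function_has_derivative[OF \<phi>]
      test_function_has_derivative[OF \<psi>])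
  from frechet_derivative_at[OF this, symmetric] show ?thesis
    by (simp add: grad_def vec_eq_iff)
qed

lemma integral_lebesgue_on_eq_lborel:
  fixes k :: "'a::euclidean_space \<Rightarrow> 'b::euclidean_space"
  assumes D: "D \<in> sets borel" and k: "k \<in> borel_measurable borel" and out: "\<And>x. x \<notin> D \<Longrightarrow> k x = 0"
  shows "(LINT x|lebesgue_on D. k x) = (LINT x|lborel. k x)"
    and "integrable (lebesgue_on D) k \<longleftrightarrow> integrable lborel k"
proof -
  have eq: "(\<lambda>x. indicator D x *\<^sub>R k x) = k" using out by (auto simp: indicator_def)
  have D': "D \<inter> space lebesgue \<in> sets lebesgue" using D by auto
  show "(LINT x|lebesgue_on D. k x) = (LINT x|lborel. k x)"
    using k by (simp add: integral_restrict_space[OF D'] eq integral_completion)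
  show "integrable (lebesgue_on D) k \<longleftrightarrow> integrable lborel k"
    using k by (simp add: integrable_restrict_space[OF D'] eq integrable_completion)
qed

lemma integrable_continuous_vanishing:
  fixes k :: "'a::euclidean_space \<Rightarrow> 'b::euclidean_space"
  assumes D: "D \<in> sets borel" "bounded D" and k: "continuous_on UNIV k" and out: "\<And>x. x \<notin> D \<Longrightarrow> k x = 0"
  shows "integrable (lebesgue_on D) k"
proof -
  have "integrable lborel (\<lambda>x. indicator (closure D) x *\<^sub>R k x)"
    by (rule borel_integrable_compact)
      (use D(2) in \<open>auto intro!: continuous_on_subset[OF k]\<close>)
  moreover have "(\<lambda>x. indicator (closure D) x *\<^sub>R k x) = k"
    using out closure_subset[of D] by (auto simp: fun_eq_iff indicator_def)
  ultimately show ?thesis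
    using D k out by (subst integral_lebesgue_on_eq_lborel(2)) (auto intro: borel_measurable_continuous_onI)
qed

lemma square_integrable_continuous_vanishing:
  fixes k :: "'a::euclidean_space \<Rightarrow> 'b::euclidean_space"
  assumes D: "D \<in> sets borel" "bounded D" and k: "continuous_on UNIV k" and out: "\<And>x. x \<notin> D \<Longrightarrow> k x = 0"
  shows "square_integrable (lebesgue_on D) k"
  unfolding square_integrable_def
proof
  show "k \<in> borel_measurable (lebesgue_on D)"
    by (intro borel_measurable_integrable integrable_continuous_vanishing[OF assms])
  show "integrable (lebesgue_on D) (\<lambda>x. (norm (k x))\<^sup>2)"
    by (intro integrable_continuous_vanishing D continuous_intros k) (use out in auto)
qed

section \<open>The Sobolev space\<close>

text \<open>The Sobolev norm becomes the plain L2 seminorm of one vector-valued function, from which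
  its triangle inequality is inherited.\<close>

definition jet :: "(real^'d) set \<Rightarrow> (real^'d \<Rightarrow> real) \<Rightarrow> real^'d \<Rightarrow> real \<times> (real^'d)" where
  "jet D u x = (u x, wgrad D u x)"

text \<open>The norm in which the elliptic forms are coercive and bounded; on \<open>H10\<close> it
  is equivalent to \<open>H1_norm\<close> by the Poincare inequality.\<close>

definition grad_norm :: "(real^'d) set \<Rightarrow> (real^'d \<Rightarrow> real) \<Rightarrow> real" where
  "grad_norm D u = seminorm2 (lebesgue_on D) (wgrad D u)"

lemma H1D:
  assumes "H1 D u"
  shows "L2 D u" "has_L2_gradient D u (wgrad D u)"
proof -
  show "L2 D u" using assms by (simp add: H1_def)
  have "\<exists>G. has_L2_gradient D u G" using assms by (simp add: H1_def)
  then show "has_L2_gradient D u (wgrad D u)" unfolding wgrad_def by (rule someI_ex)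
qed

lemma has_L2_gradient_iff:
  "has_L2_gradient D u G \<longleftrightarrow> square_integrable (lebesgue_on D) G \<and> weak_gradient D u G"
  unfolding has_L2_gradient_def square_integrable_vec_iff square_integrable_real_iff_L2 ..

lemma square_integrable_wgrad: "H1 D u \<Longrightarrow> square_integrable (lebesgue_on D) (wgrad D u)"
  using H1D(2)[of D u] by (simp add: has_L2_gradient_iff)

lemma square_integrable_jet:
  assumes "H1 D u" shows "square_integrable (lebesgue_on D) (jet D u)"
  using H1D(1)[OF assms] square_integrable_wgrad[OF assms]
  unfolding jet_def square_integrable_def L2_def
  by (auto simp: norm_Pair intro!: borel_measurable_Pair)

lemma H1_norm_eq_jet:
  assumes "H1 D u" shows "H1_norm D u = seminorm2 (lebesgue_on D) (jet D u)"
proof -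
  have "integrable (lebesgue_on D) (\<lambda>x. (u x)\<^sup>2)" "integrable (lebesgue_on D) (\<lambda>x. (norm (wgrad D u x))\<^sup>2)"
    using H1D(1)[OF assms] square_integrable_wgrad[OF assms]
    by (auto simp: L2_def square_integrable_def)
  then show ?thesis
    by (simp add: H1_norm_def seminorm2_def jet_def norm_Pair)
qed

lemma seminorm2_cong_AE:
  assumes "AE x in M. G x = H x" "square_integrable M G" "square_integrable M H"
  shows "seminorm2 M G = seminorm2 M H"
proof -
  have "(LINT x|M. (norm (G x))\<^sup>2) = (LINT x|M. (norm (H x))\<^sup>2)"
  proof (rule integral_cong_AE)
    show "AE x in M. (norm (G x))\<^sup>2 = (norm (H x))\<^sup>2" using assms(1) by eventually_elim simp
  qed (use assms in \<open>auto simp: square_integrable_def\<close>)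
  then show ?thesis by (simp add: seminorm2_def)
qed

lemma H10_imp_H1: "u \<in> H10 D \<Longrightarrow> H1 D u"
  by (simp add: H10_def)

lemma H1_norm_nonneg [simp]: "0 \<le> H1_norm D u"
  by (simp add: H1_norm_def)

lemma test_function_zero: "test_function D (\<lambda>x. 0)"
  by (simp add: test_function_def Ck_const)

lemma grad_norm_nonneg [simp]: "0 \<le> grad_norm D u"
  by (simp add: grad_norm_def)

lemma H1_norm_square:
  assumes "H1 D u"
  shows "(H1_norm D u)\<^sup>2 = (seminorm2 (lebesgue_on D) u)\<^sup>2 + (grad_norm D u)\<^sup>2"
  by (simp add: H1_norm_def grad_norm_def seminorm2_square)

lemma grad_norm_le_H1_norm: "H1 D u \<Longrightarrow> grad_norm D u \<le> H1_norm D u"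
  by (rule power2_le_imp_le) (auto simp: H1_norm_square)

lemma seminorm2_le_H1_norm: "H1 D u \<Longrightarrow> seminorm2 (lebesgue_on D) u \<le> H1_norm D u"
  by (rule power2_le_imp_le) (auto simp: H1_norm_square)

lemma H1_norm_le: "H1 D u \<Longrightarrow> H1_norm D u \<le> seminorm2 (lebesgue_on D) u + grad_norm D u"
  by (rule power2_le_imp_le) (auto simp: H1_norm_square power2_sum)

context
  fixes D :: "(real^'d) set"
  assumes D: "open D" "bounded D"
begin

lemma D_borel: "D \<in> sets borel"
  using D(1) by simp

lemma finite_measure_D: "finite_measure (lebesgue_on D)"
  using D by (intro finite_measure_lebesgue_on lmeasurable_open)

lemma L2_imp_integrable: "L2 D u \<Longrightarrow> integrable (lebesgue_on D) u"
proof -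
  assume u: "L2 D u"
  have "square_integrable (lebesgue_on D) (\<lambda>x. 1::real)"
    by (simp add: square_integrable_def finite_measure.integrable_const[OF finite_measure_D])
  from square_integrable_inner[OF this u[folded square_integrable_real_iff_L2]]
  show ?thesis by simp
qed

lemma test_function_square_integrable:
  assumes "test_function D \<phi>"
  shows "square_integrable (lebesgue_on D) \<phi>"
    and "square_integrable (lebesgue_on D) (grad \<phi>)"
    and "square_integrable (lebesgue_on D) (\<lambda>x. frechet_derivative \<phi> (at x) v)"
proof -
  show "square_integrable (lebesgue_on D) \<phi>"
    by (intro square_integrable_continuous_vanishing D_borel D test_function_continuous[OF assms]
        test_function_outside[OF assms])
  show "square_integrable (lebesgue_on D) (grad \<phi>)"
    by (intro square_integrable_continuous_vanishing D_borel D grad_continuous[OF assms] grad_outside[OF assms])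
  show "square_integrable (lebesgue_on D) (\<lambda>x. frechet_derivative \<phi> (at x) v)"
    by (intro square_integrable_continuous_vanishing D_borel D test_function_derivative_continuous[OF assms]
        test_function_derivative_outside[OF assms])
qed

lemma test_function_integral_by_parts:
  assumes \<phi>: "test_function D \<phi>" and \<psi>: "test_function D \<psi>"
  shows "(LINT x|lebesgue_on D. \<phi> x * frechet_derivative \<psi> (at x) v) =
    - (LINT x|lebesgue_on D. frechet_derivative \<phi> (at x) v * \<psi> x)"
proof -
  let ?d = "\<lambda>x. \<phi> x * frechet_derivative \<psi> (at x) v + frechet_derivative \<phi> (at x) v * \<psi> x"
  note cont = test_function_continuous[OF \<phi>] test_function_continuous[OF \<psi>]
    test_function_derivative_continuous[OF \<phi>, of v] test_function_derivative_continuous[OF \<psi>, of v]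
  have "(LINT x|lborel. ?d x) = 0"
  proof (rule integral_derivative_compact_support)
    show "((\<lambda>x. \<phi> x * \<psi> x) has_derivative
        (\<lambda>v. \<phi> x * frechet_derivative \<psi> (at x) v + frechet_derivative \<phi> (at x) v * \<psi> x)) (at x)" for x
      by (rule has_derivative_mult[OF test_function_has_derivative[OF \<phi>] test_function_has_derivative[OF \<psi>]])
    show "continuous_on UNIV ?d" by (intro continuous_intros cont)
    show "compact (closure D)" using D(2) by simp
    show "\<phi> x * \<psi> x = 0" if "x \<notin> closure D" for x
      using that test_function_outside[OF \<phi>, of x] closure_subset[of D] by auto
  qed
  moreover have "(LINT x|lebesgue_on D. ?d x) = (LINT x|lborel. ?d x)"
    by (rule integral_lebesgue_on_eq_lborel(1)[OF D_borel])
      (auto intro!: borel_measurable_continuous_onI continuous_intros cont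
        simp: test_function_outside[OF \<phi>] test_function_outside[OF \<psi>])
  moreover have "integrable (lebesgue_on D) (\<lambda>x. \<phi> x * frechet_derivative \<psi> (at x) v)"
    using square_integrable_inner[OF test_function_square_integrable(1)[OF \<phi>] test_function_square_integrable(3)[OF \<psi>, of v]]
    by simp
  moreover have "integrable (lebesgue_on D) (\<lambda>x. frechet_derivative \<phi> (at x) v * \<psi> x)"
    using square_integrable_inner[OF test_function_square_integrable(3)[OF \<phi>, of v] test_function_square_integrable(1)[OF \<psi>]]
    by simp
  ultimately show ?thesis by simp
qed

lemma test_function_has_L2_gradient:
  assumes "test_function D \<phi>" shows "has_L2_gradient D \<phi> (grad \<phi>)"
  unfolding has_L2_gradient_iff weak_gradient_def
  using test_function_integral_by_parts[OF assms] test_function_square_integrable(2)[OF assms]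
  by (simp add: grad_def)

lemma test_function_H1: "test_function D \<phi> \<Longrightarrow> H1 D \<phi>"
  using test_function_has_L2_gradient test_function_square_integrable(1)
  by (auto simp: H1_def square_integrable_real_iff_L2)

text \<open>The components of the difference annihilate all test functions. Uniqueness is what makes
  the arbitrary choice in \<open>wgrad\<close> linear up to null sets and consistent with the
  classical gradient.\<close>

lemma has_L2_gradient_unique:
  assumes G: "has_L2_gradient D u G" and H: "has_L2_gradient D u H"
  shows "AE x in lebesgue_on D. G x = H x"
proof -
  have "AE x in lebesgue_on D. G x $ i - H x $ i = 0" for i
  proof (rule fundamental_lemma[OF D(1)])
    have i: "square_integrable (lebesgue_on D) (\<lambda>x. G x $ i)" "square_integrable (lebesgue_on D) (\<lambda>x. H x $ i)"
      using G H by (auto simp: has_L2_gradient_def square_integrable_real_iff_L2)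
    then show "integrable (lebesgue_on D) (\<lambda>x. G x $ i - H x $ i)"
      by (auto simp: square_integrable_real_iff_L2 intro: L2_imp_integrable)
    fix \<phi> assume \<phi>: "test_function D \<phi>"
    have "integrable (lebesgue_on D) (\<lambda>x. G x $ i * \<phi> x)" "integrable (lebesgue_on D) (\<lambda>x. H x $ i * \<phi> x)"
      using i[THEN square_integrable_inner, OF test_function_square_integrable(1)[OF \<phi>]] by auto
    moreover have "(LINT x|lebesgue_on D. G x $ i * \<phi> x) = (LINT x|lebesgue_on D. H x $ i * \<phi> x)"
    proof -
      have "- (LINT x|lebesgue_on D. G x $ i * \<phi> x) = - (LINT x|lebesgue_on D. H x $ i * \<phi> x)"
        using G H \<phi> by (simp add: has_L2_gradient_def weak_gradient_def)
      then show ?thesis by simp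
    qed
    ultimately show "(LINT x|lebesgue_on D. (G x $ i - H x $ i) * \<phi> x) = 0"
      by (simp add: left_diff_distrib)
  qed
  then have "AE x in lebesgue_on D. \<forall>i\<in>UNIV. G x $ i - H x $ i = 0"
    by (intro AE_finite_allI) auto
  then show ?thesis by eventually_elim (simp add: vec_eq_iff)
qed

lemma wgrad_AE_eq:
  assumes "has_L2_gradient D u G"
  shows "AE x in lebesgue_on D. wgrad D u x = G x"
  unfolding wgrad_def by (rule has_L2_gradient_unique[OF someI[of "has_L2_gradient D u", OF assms] assms])

lemma has_L2_gradient_add_scale:
  assumes u: "L2 D u" "has_L2_gradient D u G" and v: "L2 D v" "has_L2_gradient D v H"
  shows "has_L2_gradient D (\<lambda>x. u x + c * v x) (\<lambda>x. G x + c *\<^sub>R H x)"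
proof -
  have G: "square_integrable (lebesgue_on D) G" and H: "square_integrable (lebesgue_on D) H"
    using u v by (auto simp: has_L2_gradient_iff)
  have "weak_gradient D (\<lambda>x. u x + c * v x) (\<lambda>x. G x + c *\<^sub>R H x)"
    unfolding weak_gradient_def
  proof (intro allI impI)
    fix \<phi> :: "real^'d \<Rightarrow> real" and i assume \<phi>: "test_function D \<phi>"
    note u2 = u(1)[folded square_integrable_real_iff_L2] v(1)[folded square_integrable_real_iff_L2]
    note gi = G[unfolded square_integrable_vec_iff, rule_format, of i] H[unfolded square_integrable_vec_iff, rule_format, of i]
    have "integrable (lebesgue_on D) (\<lambda>x. u x * frechet_derivative \<phi> (at x) (axis i 1))"
      "integrable (lebesgue_on D) (\<lambda>x. v x * frechet_derivative \<phi> (at x) (axis i 1))"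
      "integrable (lebesgue_on D) (\<lambda>x. G x $ i * \<phi> x)" "integrable (lebesgue_on D) (\<lambda>x. H x $ i * \<phi> x)"
      using u2[THEN square_integrable_inner, OF test_function_square_integrable(3)[OF \<phi>, of "axis i 1"]]
        gi[THEN square_integrable_inner, OF test_function_square_integrable(1)[OF \<phi>]] by auto
    moreover have "(LINT x|lebesgue_on D. u x * frechet_derivative \<phi> (at x) (axis i 1)) =
        - (LINT x|lebesgue_on D. G x $ i * \<phi> x)"
      "(LINT x|lebesgue_on D. v x * frechet_derivative \<phi> (at x) (axis i 1)) =
        - (LINT x|lebesgue_on D. H x $ i * \<phi> x)"
      using u v \<phi> by (auto simp: has_L2_gradient_def weak_gradient_def)
    ultimately show "(LINT x|lebesgue_on D. (u x + c * v x) * frechet_derivative \<phi> (at x) (axis i 1)) =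
        - (LINT x|lebesgue_on D. (G x + c *\<^sub>R H x) $ i * \<phi> x)"
      by (simp add: algebra_simps)
  qed
  then show ?thesis using square_integrable_add_scaleR[OF G H] by (simp add: has_L2_gradient_iff)
qed

lemma H1_add_scale:
  assumes "H1 D u" "H1 D v" shows "H1 D (\<lambda>x. u x + c * v x)"
proof -
  have "L2 D (\<lambda>x. u x + c * v x)"
    using square_integrable_add_scaleR[of "lebesgue_on D" u v c] assms[THEN H1D(1)]
    by (simp add: square_integrable_real_iff_L2)
  then show ?thesis
    using has_L2_gradient_add_scale[OF H1D[OF assms(1)] H1D[OF assms(2)], of c] by (auto simp: H1_def)
qed

lemma wgrad_add_scale:
  assumes "H1 D u" "H1 D v"
  shows "AE x in lebesgue_on D. wgrad D (\<lambda>x. u x + c * v x) x = wgrad D u x + c *\<^sub>R wgrad D v x"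
  by (intro wgrad_AE_eq has_L2_gradient_add_scale H1D assms)

lemma wgrad_test_function:
  "test_function D \<phi> \<Longrightarrow> AE x in lebesgue_on D. wgrad D \<phi> x = grad \<phi> x"
  by (intro wgrad_AE_eq test_function_has_L2_gradient)

lemma jet_add_scale:
  assumes "H1 D u" "H1 D v"
  shows "AE x in lebesgue_on D. jet D (\<lambda>x. u x + c * v x) x = jet D u x + c *\<^sub>R jet D v x"
  using wgrad_add_scale[OF assms, of c] by eventually_elim (simp add: jet_def)

lemma H1_norm_add_scale:
  assumes u: "H1 D u" and v: "H1 D v"
  shows "H1_norm D (\<lambda>x. u x + c * v x) = seminorm2 (lebesgue_on D) (\<lambda>x. jet D u x + c *\<^sub>R jet D v x)"
  unfolding H1_norm_eq_jet[OF H1_add_scale[OF u v]]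
  by (intro seminorm2_cong_AE jet_add_scale square_integrable_jet square_integrable_add_scaleR H1_add_scale u v)

lemma H1_norm_triangle:
  assumes u: "H1 D u" and v: "H1 D v"
  shows "H1_norm D (\<lambda>x. u x + c * v x) \<le> H1_norm D u + \<bar>c\<bar> * H1_norm D v"
proof -
  note j = square_integrable_jet[OF u] square_integrable_jet[OF v]
  have cj: "square_integrable (lebesgue_on D) (\<lambda>x. c *\<^sub>R jet D v x)"
    using j by (auto simp: square_integrable_def power_mult_distrib)
  have "seminorm2 (lebesgue_on D) (\<lambda>x. c *\<^sub>R jet D v x) = \<bar>c\<bar> * H1_norm D v"
    by (simp add: H1_norm_eq_jet[OF v] seminorm2_def power_mult_distrib real_sqrt_mult)
  then show ?thesis
    using seminorm2_triangle[OF j(1) cj] by (simp add: H1_norm_add_scale[OF u v] H1_norm_eq_jet[OF u])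
qed

text \<open>The chosen weak gradient of 0 is known only up to a null set, so unfolding does not
  settle this. Writing 0 as \<open>0 + (-1) * 0\<close> makes the two copies of the jet
  cancel.\<close>

lemma H1_norm_zero: "H1_norm D (\<lambda>x. 0) = 0"
proof -
  have z: "H1 D (\<lambda>x. 0)" by (intro test_function_H1 test_function_zero)
  have "H1_norm D (\<lambda>x. 0 + (-1) * 0) = seminorm2 (lebesgue_on D) (\<lambda>x. jet D (\<lambda>x. 0) x + (-1) *\<^sub>R jet D (\<lambda>x. 0) x)"
    by (rule H1_norm_add_scale[OF z z])
  then show ?thesis by (simp add: seminorm2_def)
qed

lemma test_function_H10: "test_function D \<phi> \<Longrightarrow> \<phi> \<in> H10 D"
  unfolding H10_def using test_function_H1
  by (auto intro!: exI[of _ "\<lambda>n. \<phi>"] simp: H1_norm_zero)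

lemma H10_approx:
  assumes u: "u \<in> H10 D" and e: "0 < e"
  obtains \<phi> where "test_function D \<phi>" "H1_norm D (\<lambda>x. u x - \<phi> x) < e"
proof -
  obtain \<phi> :: "nat \<Rightarrow> _" where \<phi>: "\<And>n. test_function D (\<phi> n)" "(\<lambda>n. H1_norm D (\<lambda>x. u x - \<phi> n x)) \<longlonglongrightarrow> 0"
    using u by (auto simp: H10_def)
  obtain n where "H1_norm D (\<lambda>x. u x - \<phi> n x) < e"
    using order_tendstoD(2)[OF \<phi>(2) e] by (auto simp: eventually_sequentially)
  with \<phi>(1) show thesis by (rule that)
qed

lemma H10_add_scale:
  assumes u: "u \<in> H10 D" and v: "v \<in> H10 D"
  shows "(\<lambda>x. u x + c * v x) \<in> H10 D"
proof -
  obtain \<phi> :: "nat \<Rightarrow> _" where \<phi>: "\<And>n. test_function D (\<phi> n)" "(\<lambda>n. H1_norm D (\<lambda>x. u x - \<phi> n x)) \<longlonglongrightarrow> 0"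
    using u by (auto simp: H10_def)
  obtain \<psi> :: "nat \<Rightarrow> _" where \<psi>: "\<And>n. test_function D (\<psi> n)" "(\<lambda>n. H1_norm D (\<lambda>x. v x - \<psi> n x)) \<longlonglongrightarrow> 0"
    using v by (auto simp: H10_def)
  have H1s: "H1 D u" "H1 D v" using u v by (auto simp: H10_imp_H1)
  have d: "H1 D (\<lambda>x. u x - \<phi> n x)" "H1 D (\<lambda>x. v x - \<psi> n x)" for n
    using H1_add_scale[OF H1s(1) test_function_H1[OF \<phi>(1)[of n]], of "-1"]
      H1_add_scale[OF H1s(2) test_function_H1[OF \<psi>(1)[of n]], of "-1"] by auto
  have "(\<lambda>n. H1_norm D (\<lambda>x. (u x + c * v x) - (\<phi> n x + c * \<psi> n x))) \<longlonglongrightarrow> 0"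
  proof (rule tendsto_sandwich[OF _ _ tendsto_const])
    show "(\<lambda>n. H1_norm D (\<lambda>x. u x - \<phi> n x) + \<bar>c\<bar> * H1_norm D (\<lambda>x. v x - \<psi> n x)) \<longlonglongrightarrow> 0"
      using tendsto_add[OF \<phi>(2) tendsto_mult_left[OF \<psi>(2), of "\<bar>c\<bar>"]] by simp
    have "(\<lambda>x. (u x + c * v x) - (\<phi> n x + c * \<psi> n x)) = (\<lambda>x. (u x - \<phi> n x) + c * (v x - \<psi> n x))" for n
      by (simp add: algebra_simps)
    then show "\<forall>\<^sub>F n in sequentially. H1_norm D (\<lambda>x. (u x + c * v x) - (\<phi> n x + c * \<psi> n x))
        \<le> H1_norm D (\<lambda>x. u x - \<phi> n x) + \<bar>c\<bar> * H1_norm D (\<lambda>x. v x - \<psi> n x)"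
      using H1_norm_triangle[OF d] by simp
  qed simp
  then show ?thesis
    unfolding H10_def using H1_add_scale[OF H1s, of c] test_function_add_scale[OF \<phi>(1) \<psi>(1)]
    by (intro CollectI conjI exI[of _ "\<lambda>n x. \<phi> n x + c * \<psi> n x"] allI)
qed

lemma H10_diff: "u \<in> H10 D \<Longrightarrow> v \<in> H10 D \<Longrightarrow> (\<lambda>x. u x - v x) \<in> H10 D"
  using H10_add_scale[of u v "-1"] by simp

section \<open>The Poincare inequality and a countable dense sequence of test functions\<close>

lemma grad_norm_test_function:
  assumes "test_function D \<phi>"
  shows "grad_norm D \<phi> = seminorm2 (lebesgue_on D) (grad \<phi>)"
  unfolding grad_norm_def
  by (intro seminorm2_cong_AE wgrad_test_function square_integrable_wgrad test_function_H1
      test_function_square_integrable assms)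

text \<open>Integrating the derivative of \<open>x\<^sub>i \<phi>\<^sup>2\<close> gives \<open>\<parallel>\<phi>\<parallel>\<^sup>2 = - 2 \<integral> x\<^sub>i \<phi> \<partial>\<^sub>i\<phi>\<close>.\<close>

lemma poincare_test_function:
  assumes \<phi>: "test_function D \<phi>" and R: "\<And>x. x \<in> D \<Longrightarrow> norm x \<le> R"
  shows "seminorm2 (lebesgue_on D) \<phi> \<le> 2 * R * grad_norm D \<phi>"
proof (cases "D = {}")
  \<comment> \<open>On the empty set nothing forces \<open>R\<close> to be nonnegative, but both
    norms vanish.\<close>
  case True
  then have "seminorm2 (lebesgue_on D) \<phi> = 0"
    by (simp add: seminorm2_def integral_restrict_space)
  moreover have "grad_norm D \<phi> = 0"
    using True by (simp add: grad_norm_def seminorm2_def integral_restrict_space)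
  ultimately show ?thesis by simp
next
  case False
  then have R0: "0 \<le> R" using R norm_ge_zero order_trans by blast
  \<comment> \<open>Any coordinate direction will do; this only names one.\<close>
  obtain i :: 'd where True by blast
  let ?e = "axis i 1 :: real^'d"
  let ?d = "\<lambda>x. frechet_derivative \<phi> (at x) ?e"
  let ?M = "lebesgue_on D"
  note cont = test_function_continuous[OF \<phi>] test_function_derivative_continuous[OF \<phi>, of ?e]
  note out = test_function_outside[OF \<phi>] test_function_derivative_outside[OF \<phi>]
  let ?t = "\<lambda>x. x $ i * (2 * \<phi> x * ?d x) + ?e $ i * (\<phi> x * \<phi> x)"
  have "(LINT x|lborel. ?t x) = 0"
  proof (rule integral_derivative_compact_support)
    show "((\<lambda>x. x $ i * (\<phi> x * \<phi> x)) has_derivative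
      (\<lambda>v. x $ i * (2 * \<phi> x * frechet_derivative \<phi> (at x) v) + v $ i * (\<phi> x * \<phi> x))) (at x)" for x
      by (auto intro!: derivative_eq_intros test_function_has_derivative[OF \<phi>] bounded_linear.has_derivative[OF bounded_linear_vec_nth]
        simp: algebra_simps)
    show "continuous_on UNIV ?t" by (intro continuous_intros cont)
    show "compact (closure D)" using D(2) by simp
    show "x $ i * (\<phi> x * \<phi> x) = 0" if "x \<notin> closure D" for x
      using that out closure_subset[of D] by auto
  qed
  moreover have "(LINT x|?M. ?t x) = (LINT x|lborel. ?t x)"
    by (rule integral_lebesgue_on_eq_lborel(1)[OF D_borel])
      (auto intro!: borel_measurable_continuous_onI continuous_intros cont simp: out)
  ultimately have "(LINT x|?M. ?t x) = 0" by simp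
  have sq: "square_integrable ?M (\<lambda>x. x $ i * ?d x)"
    by (intro square_integrable_continuous_vanishing D_borel D continuous_intros cont) (simp add: out)
  have i1: "integrable ?M (\<lambda>x. \<phi> x * (x $ i * ?d x))"
    using square_integrable_inner[OF test_function_square_integrable(1)[OF \<phi>] sq] by simp
  have i2: "integrable ?M (\<lambda>x. \<phi> x * \<phi> x)"
    using square_integrable_inner[OF test_function_square_integrable(1)[OF \<phi>] test_function_square_integrable(1)[OF \<phi>]] by simp
  have "(LINT x|?M. ?t x) = (LINT x|?M. 2 * (\<phi> x * (x $ i * ?d x)) + \<phi> x * \<phi> x)"
    by (simp add: axis_def algebra_simps)
  also have "\<dots> = 2 * (LINT x|?M. \<phi> x * (x $ i * ?d x)) + (LINT x|?M. \<phi> x * \<phi> x)"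
    using i1 i2 by simp
  finally have "(seminorm2 ?M \<phi>)\<^sup>2 = - 2 * (LINT x|?M. \<phi> x * (x $ i * ?d x))"
    using \<open>(LINT x|?M. ?t x) = 0\<close> unfolding seminorm2_square by (simp add: power2_eq_square)
  also have "\<dots> \<le> 2 * (seminorm2 ?M \<phi> * seminorm2 ?M (\<lambda>x. x $ i * ?d x))"
    using Cauchy_Schwarz_integral[OF test_function_square_integrable(1)[OF \<phi>] sq] by simp
  also have "seminorm2 ?M (\<lambda>x. x $ i * ?d x) \<le> R * grad_norm D \<phi>"
  proof (rule power2_le_imp_le)
    have "(seminorm2 ?M (\<lambda>x. x $ i * ?d x))\<^sup>2 \<le> (LINT x|?M. R\<^sup>2 * (norm (grad \<phi> x))\<^sup>2)"
      unfolding seminorm2_square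
    proof (rule integral_mono)
      show "integrable ?M (\<lambda>x. (norm (x $ i * ?d x))\<^sup>2)" using sq by (simp add: square_integrable_def)
      show "integrable ?M (\<lambda>x. R\<^sup>2 * (norm (grad \<phi> x))\<^sup>2)"
        using test_function_square_integrable(2)[OF \<phi>] by (simp add: square_integrable_def)
      fix x assume "x \<in> space ?M"
      then have "x \<in> D" by simp
      then have "\<bar>x $ i\<bar> \<le> R" using component_le_norm_cart[of x i] R by force
      moreover have "\<bar>?d x\<bar> \<le> norm (grad \<phi> x)"
        using component_le_norm_cart[of "grad \<phi> x" i] by (simp add: grad_def)
      ultimately have "\<bar>x $ i * ?d x\<bar> \<le> R * norm (grad \<phi> x)"
        unfolding abs_mult by (intro mult_mono R0) auto
      then show "(norm (x $ i * ?d x))\<^sup>2 \<le> R\<^sup>2 * (norm (grad \<phi> x))\<^sup>2"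
        using abs_le_square_iff[of "x $ i * ?d x" "R * norm (grad \<phi> x)"] R0
        by (simp add: power_mult_distrib)
    qed
    also have "\<dots> = (R * grad_norm D \<phi>)\<^sup>2"
      by (simp add: grad_norm_test_function[OF \<phi>] power_mult_distrib seminorm2_square)
    finally show "(seminorm2 ?M (\<lambda>x. x $ i * ?d x))\<^sup>2 \<le> (R * grad_norm D \<phi>)\<^sup>2" .
  qed (use R0 in simp)
  finally have "seminorm2 ?M \<phi> * seminorm2 ?M \<phi> \<le> seminorm2 ?M \<phi> * (2 * R * grad_norm D \<phi>)"
    by (simp add: power2_eq_square mult_left_mono)
  then show ?thesis
    using R0 by (cases "seminorm2 ?M \<phi> = 0") (auto simp: mult_le_cancel_left less_le)
qed

text \<open>The inequality passes from test functions to their closure. The additional 1 in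
  \<open>2 * R + 1\<close> accounts for the gradient part of \<open>H1_norm\<close>.\<close>

lemma poincare:
  obtains P where "0 < P" "\<And>u. u \<in> H10 D \<Longrightarrow> H1_norm D u \<le> P * grad_norm D u"
proof -
  obtain R where R: "0 < R" "\<And>x. x \<in> D \<Longrightarrow> norm x \<le> R"
    using D(2) bounded_pos by metis
  have "H1_norm D u \<le> (2 * R + 1) * grad_norm D u" if u: "u \<in> H10 D" for u
  proof (rule field_le_epsilon)
    fix e :: real assume e: "0 < e"
    \<comment> \<open>The approximation error enters once directly and \<open>2 * R + 1\<close>
      times through the gradient of \<phi>.\<close>
    define k where "k = 2 * R + 2"
    have k: "0 < k" using R by (simp add: k_def)
    obtain \<phi> where \<phi>: "test_function D \<phi>" "H1_norm D (\<lambda>x. u x - \<phi> x) < e / k"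
      using H10_approx[OF u, of "e / k"] e k by auto
    have H1s: "H1 D u" "H1 D \<phi>" using u \<phi> by (auto intro: H10_imp_H1 test_function_H1)
    let ?w = "\<lambda>x. u x - \<phi> x"
    have w: "H1 D ?w" using H1_add_scale[OF H1s, of "-1"] by simp
    have n1: "H1_norm D u \<le> H1_norm D ?w + H1_norm D \<phi>"
      using H1_norm_triangle[OF w H1s(2), of 1] by simp
    have n2: "H1_norm D \<phi> \<le> (2 * R + 1) * grad_norm D \<phi>"
      using H1_norm_le[OF H1s(2)] poincare_test_function[OF \<phi>(1) R(2)] by (simp add: algebra_simps)
    have n3: "grad_norm D \<phi> \<le> grad_norm D u + grad_norm D ?w"
    proof -
      have sq: "square_integrable (lebesgue_on D) (\<lambda>x. (-1) *\<^sub>R wgrad D ?w x)"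
        using square_integrable_wgrad[OF w] by (simp add: square_integrable_def)
      have "AE x in lebesgue_on D. wgrad D \<phi> x = wgrad D u x + (-1) *\<^sub>R wgrad D ?w x"
        using wgrad_add_scale[OF H1s(1) w, of "-1"] by simp
      then have "grad_norm D \<phi> = seminorm2 (lebesgue_on D) (\<lambda>x. wgrad D u x + (-1) *\<^sub>R wgrad D ?w x)"
        unfolding grad_norm_def
        by (intro seminorm2_cong_AE square_integrable_add_scaleR square_integrable_wgrad H1s w)
      also have "\<dots> \<le> grad_norm D u + seminorm2 (lebesgue_on D) (\<lambda>x. (-1) *\<^sub>R wgrad D ?w x)"
        unfolding grad_norm_def by (intro seminorm2_triangle square_integrable_wgrad H1s sq)
      also have "seminorm2 (lebesgue_on D) (\<lambda>x. (-1) *\<^sub>R wgrad D ?w x) = grad_norm D ?w"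
        by (simp add: grad_norm_def seminorm2_def)
      finally show ?thesis .
    qed
    have n4: "grad_norm D ?w \<le> H1_norm D ?w" by (rule grad_norm_le_H1_norm[OF w])
    have "(2 * R + 1) * grad_norm D \<phi> \<le> (2 * R + 1) * (grad_norm D u + H1_norm D ?w)"
      using n3 n4 R(1) by (intro mult_left_mono) auto
    then have "H1_norm D u \<le> (2 * R + 1) * grad_norm D u + k * H1_norm D ?w"
      using n1 n2 by (simp add: k_def algebra_simps)
    also have "k * H1_norm D ?w \<le> e" using \<phi>(2) k by (simp add: field_simps)
    finally show "H1_norm D u \<le> (2 * R + 1) * grad_norm D u + e" by simp
  qed
  then show thesis using that[of "2 * R + 1"] R(1) by simp
qed

text \<open>On a bounded set, uniform closeness of two test functions together with their gradients
  controls the Sobolev distance. So separability is applied to the continuous maps that pair a test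
  function with its gradient, and density in \<open>H10\<close> follows from its definition as a
  closure.\<close>

lemma test_functions_countable_dense:
  obtains \<phi> :: "nat \<Rightarrow> real^'d \<Rightarrow> real" where "\<And>n. test_function D (\<phi> n)"
    "\<And>u e. u \<in> H10 D \<Longrightarrow> 0 < e \<Longrightarrow> \<exists>n. H1_norm D (\<lambda>x. u x - \<phi> n x) < e"
proof -
  let ?W = "\<lambda>\<phi> x. (\<phi> x, grad \<phi> x)"
  let ?S = "?W ` {\<phi>. test_function D \<phi>}"
  have "compact (closure D)" using D(2) by simp
  then obtain T where T: "countable T" "T \<subseteq> ?S"
    "\<And>f e. f \<in> ?S \<Longrightarrow> 0 < e \<Longrightarrow> \<exists>g\<in>T. \<forall>x\<in>closure D. dist (f x) (g x) < e"
  proof (rule countable_uniformly_dense_subset)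
    show "continuous_on (closure D) f" if fS: "f \<in> ?S" for f
    proof -
      obtain \<phi> where \<phi>: "test_function D \<phi>" "f = ?W \<phi>" using fS by auto
      show ?thesis
        unfolding \<phi>(2) using test_function_continuous[OF \<phi>(1)] grad_continuous[OF \<phi>(1)]
        by (intro continuous_on_Pair) (auto intro: continuous_on_subset[OF _ subset_UNIV])
    qed
  qed (rule that)
  have "\<exists>g. g \<in> T" using T(3)[of "?W (\<lambda>x. 0)" 1] test_function_zero[of D] by auto
  then have "T \<noteq> {}" by auto
  define \<phi> where "\<phi> n x = fst (from_nat_into T n x)" for n x
  have \<phi>: "test_function D (\<phi> n) \<and> ?W (\<phi> n) = from_nat_into T n" for n
  proof -
    have "from_nat_into T n \<in> ?S" using from_nat_into[OF \<open>T \<noteq> {}\<close>, of n] T(2) by auto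
    then obtain \<psi> where "test_function D \<psi>" "from_nat_into T n = ?W \<psi>" by auto
    moreover from this have "\<phi> n = \<psi>" by (simp add: \<phi>_def fun_eq_iff)
    ultimately show ?thesis by simp
  qed
  show thesis
  proof (rule that)
    show "test_function D (\<phi> n)" for n using \<phi> by simp
    fix u and e :: real assume u: "u \<in> H10 D" and e: "0 < e"
    obtain \<psi> where \<psi>: "test_function D \<psi>" "H1_norm D (\<lambda>x. u x - \<psi> x) < e / 2"
      using H10_approx[OF u, of "e / 2"] e by auto
    let ?m = "measure (lebesgue_on D) D"
    \<comment> \<open>Chosen so that \<open>(?m + 1) * d\<^sup>2\<close> is the square of
      \<open>e / 2\<close>. The added 1 keeps the denominator positive and makes the final estimate
      strict.\<close>
    define d where "d = e / (2 * sqrt (?m + 1))"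
    have d: "0 < d" using e by (simp add: d_def add_nonneg_pos)
    obtain g where g: "g \<in> T" "\<And>x. x \<in> closure D \<Longrightarrow> dist (?W \<psi> x) (g x) < d"
      using T(3)[of "?W \<psi>" d] \<psi>(1) d by auto
    obtain n where "from_nat_into T n = g" using from_nat_into_surj[OF T(1) g(1)] by auto
    then have gn: "g = ?W (\<phi> n)" using \<phi> by simp
    let ?w = "\<lambda>x. \<psi> x - \<phi> n x"
    have w: "test_function D ?w" using test_function_add_scale[OF \<psi>(1), of "\<phi> n" "-1"] \<phi> by simp
    have Ww: "norm (?W ?w x) < d" if "x \<in> D" for x
    proof -
      have "?W ?w x = ?W \<psi> x - ?W (\<phi> n) x"
        using grad_add_scale[OF \<psi>(1), of "\<phi> n" "-1" x] \<phi> by simp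
      then show ?thesis using g(2)[of x] that closure_subset[of D] gn by (auto simp: dist_norm)
    qed
    have "(H1_norm D ?w)\<^sup>2 = (LINT x|lebesgue_on D. (norm (?W ?w x))\<^sup>2)"
      using test_function_square_integrable[OF w]
      by (simp add: H1_norm_square[OF test_function_H1[OF w]] grad_norm_test_function[OF w]
          seminorm2_square norm_Pair square_integrable_def)
    also have "\<dots> \<le> (LINT x|lebesgue_on D. d\<^sup>2)"
    proof (rule integral_mono)
      show "integrable (lebesgue_on D) (\<lambda>x. (norm (?W ?w x))\<^sup>2)"
        using test_function_square_integrable[OF w] by (simp add: norm_Pair square_integrable_def)
      show "integrable (lebesgue_on D) (\<lambda>x. d\<^sup>2)"
        by (rule finite_measure.integrable_const[OF finite_measure_D])
      fix x assume "x \<in> space (lebesgue_on D)"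
      then show "(norm (?W ?w x))\<^sup>2 \<le> d\<^sup>2" using Ww[of x] d by (intro power_mono) auto
    qed
    also have "\<dots> = ?m * d\<^sup>2" by simp
    also have "\<dots> < (?m + 1) * d\<^sup>2" using d by simp
    also have "\<dots> = (e / 2)\<^sup>2" 
    proof -
      have "k * (e / (2 * sqrt k))\<^sup>2 = (e / 2)\<^sup>2" if "0 < k" for k
        using that by (simp add: power_divide power_mult_distrib)
      from this[of "?m + 1"] show ?thesis by (simp add: d_def add_nonneg_pos)
    qed
    finally have "H1_norm D ?w < e / 2" by (rule power2_less_imp_less) (use e in simp)
    moreover have "H1_norm D (\<lambda>x. u x - \<phi> n x) \<le> H1_norm D (\<lambda>x. u x - \<psi> x) + H1_norm D ?w"
      using H1_norm_triangle[OF H10_imp_H1[OF H10_diff[OF u test_function_H10[OF \<psi>(1)]]] test_function_H1[OF w], of 1]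
      by simp
    ultimately show "\<exists>n. H1_norm D (\<lambda>x. u x - \<phi> n x) < e" using \<psi>(2) by (intro exI[of _ n]) linarith
  qed
qed

end

section \<open>Coercive forms and their perturbation\<close>

definition linear_on :: "('a \<Rightarrow> real) set \<Rightarrow> (('a \<Rightarrow> real) \<Rightarrow> real) \<Rightarrow> bool" where
  "linear_on H l \<longleftrightarrow> (\<forall>u\<in>H. \<forall>v\<in>H. \<forall>c. l (\<lambda>x. u x + c * v x) = l u + c * l v)"

definition symmetric_bilinear_on ::
  "('a \<Rightarrow> real) set \<Rightarrow> (('a \<Rightarrow> real) \<Rightarrow> ('a \<Rightarrow> real) \<Rightarrow> real) \<Rightarrow> bool" where
  "symmetric_bilinear_on H B \<longleftrightarrow>
     (\<forall>w\<in>H. linear_on H (\<lambda>u. B u w)) \<and> (\<forall>u\<in>H. \<forall>v\<in>H. B u v = B v u)"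

lemma linear_onD: "linear_on H l \<Longrightarrow> u \<in> H \<Longrightarrow> v \<in> H \<Longrightarrow> l (\<lambda>x. u x + c * v x) = l u + c * l v"
  by (simp add: linear_on_def)

lemma linear_on_diff: "linear_on H l \<Longrightarrow> u \<in> H \<Longrightarrow> v \<in> H \<Longrightarrow> l (\<lambda>x. u x - v x) = l u - l v"
  using linear_onD[of H l u v "-1"] by simp

text \<open>All estimates of \<open>nm\<close> will come from a coercive form, so the axioms stop at
  closure under linear combinations and nonnegativity.\<close>

locale function_space =
  fixes H :: "('a \<Rightarrow> real) set" and nm :: "('a \<Rightarrow> real) \<Rightarrow> real"
  assumes add_scale: "\<And>u v c. u \<in> H \<Longrightarrow> v \<in> H \<Longrightarrow> (\<lambda>x. u x + c * v x) \<in> H"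
    and nm_nonneg: "\<And>u. 0 \<le> nm u"
    and zero: "(\<lambda>x. 0) \<in> H"

locale coercive_form = function_space +
  fixes B :: "('a \<Rightarrow> real) \<Rightarrow> ('a \<Rightarrow> real) \<Rightarrow> real" and \<alpha> \<beta> :: real
  assumes form: "symmetric_bilinear_on H B"
    and \<alpha>: "0 < \<alpha>" and \<beta>: "0 < \<beta>"
    and coercive: "\<And>u. u \<in> H \<Longrightarrow> \<alpha> * (nm u)\<^sup>2 \<le> B u u"
    and bounded: "\<And>u v. u \<in> H \<Longrightarrow> v \<in> H \<Longrightarrow> \<bar>B u v\<bar> \<le> \<beta> * nm u * nm v"
begin

lemma diff_mem: "u \<in> H \<Longrightarrow> v \<in> H \<Longrightarrow> (\<lambda>x. u x - v x) \<in> H"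
  using add_scale[of u v "-1"] by simp

lemma form_sym: "u \<in> H \<Longrightarrow> v \<in> H \<Longrightarrow> B u v = B v u"
  using form by (simp add: symmetric_bilinear_on_def)

lemma form_linear: "w \<in> H \<Longrightarrow> linear_on H (\<lambda>u. B u w)"
  using form by (simp add: symmetric_bilinear_on_def)

lemma form_expand:
  assumes "u \<in> H" "v \<in> H"
  shows "B (\<lambda>x. u x + c * v x) (\<lambda>x. u x + c * v x) = B u u + 2 * c * B u v + c\<^sup>2 * B v v"
proof -
  let ?w = "\<lambda>x. u x + c * v x"
  have w: "?w \<in> H" by (intro add_scale assms)
  have "B ?w ?w = B u ?w + c * B v ?w" by (rule linear_onD[OF form_linear[OF w] assms])
  also have "B u ?w = B u u + c * B u v"
    using linear_onD[OF form_linear[OF assms(1)] assms, of c] assms w by (simp add: form_sym)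
  also have "B v ?w = B u v + c * B v v"
    using linear_onD[OF form_linear[OF assms(2)] assms, of c] assms w by (simp add: form_sym)
  finally show ?thesis by (simp add: algebra_simps power2_eq_square)
qed

lemma form_nonneg: "u \<in> H \<Longrightarrow> 0 \<le> B u u"
  using coercive[of u] \<alpha> by (smt (verit) mult_nonneg_nonneg zero_le_power2)

text \<open>An approximate Riesz representative is an almost minimiser of \<open>B w w / 2 - F w\<close>; this makes
  completeness of the space unnecessary.\<close>

lemma approximate_riesz:
  assumes F: "linear_on H F" and K: "0 \<le> K" "\<And>v. v \<in> H \<Longrightarrow> \<bar>F v\<bar> \<le> K * nm v" and \<delta>: "0 < \<delta>"
  obtains w where "w \<in> H" "\<And>v. v \<in> H \<Longrightarrow> \<bar>F v - B w v\<bar> \<le> \<delta> * nm v" "\<alpha> * nm w \<le> K + \<delta>"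
proof -
  define J where "J w = B w w / 2 - F w" for w
  \<comment> \<open>Minimality up to \<eta> bounds the squared residual at \<open>v\<close> by
    \<open>2 * \<eta> * B v v\<close>, hence by \<open>2 * \<eta> * \<beta>\<close> times the
    squared norm; this \<eta> turns the latter factor into \<open>\<delta>\<^sup>2\<close>.\<close>
  define \<eta> where "\<eta> = \<delta>\<^sup>2 / (2 * \<beta>)"
  have \<eta>: "0 < \<eta>" using \<delta> \<beta> by (simp add: \<eta>_def)
  \<comment> \<open>Coercivity dominates the linear term after completing the square, so the
    functional is bounded below.\<close>
  have lower: "- (K\<^sup>2 / (2 * \<alpha>)) \<le> J w" if w: "w \<in> H" for w
  proof -
    have "0 \<le> (\<alpha> * nm w - K)\<^sup>2 / (2 * \<alpha>)" using \<alpha> by simp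
    also have "\<dots> = \<alpha> * (nm w)\<^sup>2 / 2 - K * nm w + K\<^sup>2 / (2 * \<alpha>)"
      using \<alpha> by (simp add: field_simps power2_eq_square)
    finally show ?thesis using coercive[OF w] K(2)[OF w] by (simp add: J_def)
  qed
  have bdd: "bdd_below (J ` H)" using lower by (intro bdd_belowI[of _ "- (K\<^sup>2 / (2 * \<alpha>))"]) auto
  have "\<exists>y\<in>J ` H. y < Inf (J ` H) + \<eta>"
    using zero \<eta> bdd by (subst cInf_less_iff[symmetric]) auto
  then obtain w where w: "w \<in> H" "J w < Inf (J ` H) + \<eta>" by auto
  have min: "J w \<le> J v + \<eta>" if "v \<in> H" for v
    using cInf_lower[OF _ bdd, of "J v"] that w(2) by auto
  have rep: "\<bar>F v - B w v\<bar> \<le> \<delta> * nm v" if v: "v \<in> H" for v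
  proof -
    \<comment> \<open>Comparing \<open>w\<close> with \<open>w + t v\<close> for every real
      \<open>t\<close> leaves a nonnegative quadratic polynomial, whose discriminant bounds the
      residual.\<close>
    have "0 \<le> 2 * \<eta> + 2 * t * (B w v - F v) + t\<^sup>2 * B v v" for t
      using min[OF add_scale[OF w(1) v, of t]] form_expand[OF w(1) v, of t] linear_onD[OF F w(1) v, of t]
      by (simp add: J_def field_simps)
    then have "\<bar>B w v - F v\<bar> \<le> sqrt (2 * \<eta>) * sqrt (B v v)"
      using \<eta> form_nonneg[OF v] by (intro quadratic_nonneg_imp_discriminant) auto
    also have "\<dots> = sqrt (2 * \<eta> * B v v)" by (simp add: real_sqrt_mult)
    also have "\<dots> \<le> sqrt ((\<delta> * nm v)\<^sup>2)"
    proof (rule real_sqrt_le_mono)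
      have "2 * \<eta> * B v v \<le> 2 * \<eta> * (\<beta> * nm v * nm v)"
        using bounded[OF v v] \<eta> by (intro mult_left_mono) auto
      also have "\<dots> = (\<delta> * nm v)\<^sup>2" using \<beta> by (simp add: \<eta>_def power2_eq_square)
      finally show "2 * \<eta> * B v v \<le> (\<delta> * nm v)\<^sup>2" .
    qed
    also have "\<dots> = \<delta> * nm v" using \<delta> nm_nonneg[of v] by simp
    finally show ?thesis by (simp add: abs_minus_commute)
  qed
  have "\<alpha> * nm w * nm w \<le> (K + \<delta>) * nm w"
    using coercive[OF w(1)] rep[OF w(1)] K(2)[OF w(1)] by (simp add: power2_eq_square algebra_simps)
  then have "\<alpha> * nm w \<le> K + \<delta>"
    using nm_nonneg[of w] K(1) \<delta> by (cases "nm w = 0") (auto simp: mult_le_cancel_right)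
  with w(1) rep show thesis by (rule that)
qed

lemma solution_bound:
  assumes u: "u \<in> H" and l: "\<bar>l u\<bar> \<le> L * nm u" "0 \<le> L" and sol: "B u u = l u"
  shows "\<alpha> * nm u \<le> L"
proof -
  have "\<alpha> * nm u * nm u \<le> L * nm u"
    using coercive[OF u] l(1) sol by (simp add: power2_eq_square)
  then show ?thesis
    using nm_nonneg[of u] l(2) by (cases "nm u = 0") (auto simp: mult_le_cancel_right)
qed

text \<open>The energy of \<open>v\<close> exceeds that of the solution by half of \<open>B\<close>
  at the difference, so coercivity turns energy gaps into distances. The index is selected by
  comparing members of the sequence among themselves, without reference to \<open>u\<close>; this is
  what makes the selection measurable later.\<close>

lemma energy_selection_tendsto:
  fixes vn :: "nat \<Rightarrow> 'a \<Rightarrow> real"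
  assumes l: "linear_on H l" and u: "u \<in> H" and sol: "\<And>v. v \<in> H \<Longrightarrow> B u v = l v"
    and F: "linear_on H F" and K: "\<And>v. v \<in> H \<Longrightarrow> \<bar>F v\<bar> \<le> K * nm v"
    and vn: "\<And>n. vn n \<in> H" "\<And>e. 0 < e \<Longrightarrow> \<exists>n. nm (\<lambda>x. u x - vn n x) < e"
    and J: "\<And>j. J j = B (vn j) (vn j) / 2 - l (vn j)"
  shows "(\<lambda>n. F (vn (LEAST j. \<forall>i. J j \<le> J i + inverse (real (Suc n))))) \<longlonglongrightarrow> F u"
proof -
  define d where "d j = (\<lambda>x. u x - vn j x)" for j
  have dH: "d j \<in> H" for j unfolding d_def by (intro diff_mem u vn)
  define J0 where "J0 = B u u / 2 - l u"
  have Jd: "J j = J0 + B (d j) (d j) / 2" for j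
    using form_expand[OF u vn(1)[of j], of "-1"] sol[OF u] sol[OF vn(1)[of j]]
    by (simp add: J J0_def d_def field_simps)
  have approx: "\<exists>i. J i \<le> J0 + \<eta>" if \<eta>: "0 < \<eta>" for \<eta>
  proof -
    obtain i where i: "nm (d i) < sqrt (\<eta> / \<beta>)" using vn(2)[of "sqrt (\<eta> / \<beta>)"] \<eta> \<beta> by (auto simp: d_def)
    have "B (d i) (d i) \<le> \<beta> * (nm (d i))\<^sup>2" using bounded[OF dH dH, of i i] by (simp add: power2_eq_square)
    also have "\<dots> \<le> \<beta> * (sqrt (\<eta> / \<beta>))\<^sup>2"
      using i nm_nonneg \<beta> by (intro mult_left_mono power_mono) auto
    also have "\<dots> = \<eta>" using \<eta> \<beta> by simp
    finally show ?thesis using Jd[of i] \<eta> by (intro exI[of _ i]) simp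
  qed
  define jn where "jn n = (LEAST j. \<forall>i. J j \<le> J i + inverse (real (Suc n)))" for n
  \<comment> \<open>The infimum \<open>J0\<close> need not be attained along the sequence, but it is
    approached by density; hence an index within the tolerance exists and \<open>LEAST\<close> is
    meaningful.\<close>
  have jn: "J (jn n) \<le> J i + inverse (real (Suc n))" for n i
  proof -
    obtain j where "J j \<le> J0 + inverse (real (Suc n))" using approx[of "inverse (real (Suc n))"] by auto
    moreover have "J0 \<le> J i" for i using Jd[of i] form_nonneg[OF dH[of i]] by simp
    ultimately have "\<forall>i. J j \<le> J i + inverse (real (Suc n))" by (smt (verit))
    then have "\<forall>i. J (jn n) \<le> J i + inverse (real (Suc n))"
      unfolding jn_def by (rule LeastI[of "\<lambda>j. \<forall>i. J j \<le> J i + inverse (real (Suc n))" j])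
    then show ?thesis by blast
  qed
  have bound: "nm (d (jn n)) \<le> sqrt (2 / \<alpha> * inverse (real (Suc n)))" for n
  proof (rule real_le_rsqrt)
    have "J (jn n) \<le> J0 + inverse (real (Suc n))"
    proof (rule field_le_epsilon)
      fix e :: real assume "0 < e"
      then show "J (jn n) \<le> J0 + inverse (real (Suc n)) + e" using approx[of e] jn[of n] by (smt (verit))
    qed
    then have "B (d (jn n)) (d (jn n)) / 2 \<le> inverse (real (Suc n))" using Jd[of "jn n"] by simp
    then have "\<alpha> * (nm (d (jn n)))\<^sup>2 \<le> 2 * inverse (real (Suc n))" using coercive[OF dH[of "jn n"]] by linarith
    then have "(nm (d (jn n)))\<^sup>2 \<le> 2 * inverse (real (Suc n)) / \<alpha>"
      using \<alpha> by (simp add: pos_le_divide_eq mult.commute del: of_nat_Suc)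
    then show "(nm (d (jn n)))\<^sup>2 \<le> 2 / \<alpha> * inverse (real (Suc n))" by simp
  qed
  have "(\<lambda>n. F u - F (vn (jn n))) \<longlonglongrightarrow> 0"
  proof (rule Lim_null_comparison)
    have "(\<lambda>n. \<bar>K\<bar> * sqrt (2 / \<alpha> * inverse (real (Suc n)))) \<longlonglongrightarrow> \<bar>K\<bar> * sqrt (2 / \<alpha> * 0)"
      by (intro tendsto_intros LIMSEQ_inverse_real_of_nat)
    then show "(\<lambda>n. \<bar>K\<bar> * sqrt (2 / \<alpha> * inverse (real (Suc n)))) \<longlonglongrightarrow> 0" by simp
    have "norm (F u - F (vn (jn n))) \<le> \<bar>K\<bar> * sqrt (2 / \<alpha> * inverse (real (Suc n)))" for n
    proof -
      have "\<bar>F u - F (vn (jn n))\<bar> = \<bar>F (d (jn n))\<bar>" unfolding d_def by (simp add: linear_on_diff[OF F u vn(1)])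
      also have "\<dots> \<le> K * nm (d (jn n))" by (rule K[OF dH])
      also have "\<dots> \<le> \<bar>K\<bar> * sqrt (2 / \<alpha> * inverse (real (Suc n)))"
        by (intro mult_mono bound nm_nonneg) auto
      finally show ?thesis by simp
    qed
    then show "\<forall>\<^sub>F n in sequentially. norm (F u - F (vn (jn n))) \<le> \<bar>K\<bar> * sqrt (2 / \<alpha> * inverse (real (Suc n)))"
      by simp
  qed
  from tendsto_diff[OF tendsto_const[of "F u"] this] show ?thesis unfolding jn_def by simp
qed

end

lemma symmetric_bilinear_on_add_scale:
  assumes "symmetric_bilinear_on H B" "symmetric_bilinear_on H C"
  shows "symmetric_bilinear_on H (\<lambda>u v. B u v + c * C u v)"
  using assms unfolding symmetric_bilinear_on_def linear_on_def by (simp add: algebra_simps)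

context coercive_form
begin

text \<open>The smallness of \<open>\<epsilon> * \<beta>\<close> lets the perturbation consume at
  most half of the coercivity, and \<epsilon> at most 1 lets it at most double the continuity
  constant.\<close>

lemma perturbed_coercive_form:
  assumes C: "symmetric_bilinear_on H C" "\<And>u v. u \<in> H \<Longrightarrow> v \<in> H \<Longrightarrow> \<bar>C u v\<bar> \<le> \<beta> * nm u * nm v"
    and \<epsilon>: "0 < \<epsilon>" "\<epsilon> \<le> 1" "\<epsilon> * \<beta> \<le> \<alpha> / 2"
  shows "coercive_form H nm (\<lambda>u v. B u v + \<epsilon> * C u v) (\<alpha> / 2) (2 * \<beta>)"
proof unfold_locales
  show "symmetric_bilinear_on H (\<lambda>u v. B u v + \<epsilon> * C u v)"
    by (rule symmetric_bilinear_on_add_scale[OF form C(1)])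
  show "0 < \<alpha> / 2" "0 < 2 * \<beta>" using \<alpha> \<beta> by auto
  have small: "\<bar>\<epsilon> * C u v\<bar> \<le> \<epsilon> * \<beta> * (nm u * nm v)" if "u \<in> H" "v \<in> H" for u v
    using mult_left_mono[OF C(2)[OF that], of \<epsilon>] \<epsilon>(1) by (simp add: abs_mult mult.assoc)
  show "\<alpha> / 2 * (nm u)\<^sup>2 \<le> B u u + \<epsilon> * C u u" if u: "u \<in> H" for u
  proof -
    have "\<epsilon> * \<beta> * (nm u * nm u) \<le> \<alpha> / 2 * (nm u * nm u)" by (intro mult_right_mono \<epsilon>) simp
    then show ?thesis using coercive[OF u] small[OF u u] by (simp add: power2_eq_square)
  qed
  show "\<bar>B u v + \<epsilon> * C u v\<bar> \<le> 2 * \<beta> * nm u * nm v" if "u \<in> H" "v \<in> H" for u v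
  proof -
    have "\<epsilon> * \<beta> * (nm u * nm v) \<le> 1 * \<beta> * (nm u * nm v)"
      using \<epsilon> \<beta> nm_nonneg by (intro mult_right_mono) auto
    then show ?thesis using bounded[OF that] small[OF that] by (simp add: mult.assoc)
  qed
qed

text \<open>Testing the difference of the two equations with the approximate Riesz representative \<open>w\<close> of
  \<open>F\<close> yields the first-order term \<open>- \<epsilon> * C u0 w\<close>; since \<open>w\<close> is chosen before \<open>C\<close>, this term is linear
  in \<open>C\<close>.\<close>

lemma first_order_expansion:
  assumes l: "linear_on H l" and L: "0 \<le> L" "\<And>v. v \<in> H \<Longrightarrow> \<bar>l v\<bar> \<le> L * nm v"
    and F: "linear_on H F" and K: "0 \<le> K" "\<And>v. v \<in> H \<Longrightarrow> \<bar>F v\<bar> \<le> K * nm v"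
    and u0: "u0 \<in> H" "\<And>v. v \<in> H \<Longrightarrow> B u0 v = l v"
    and \<epsilon>: "0 < \<epsilon>" "\<epsilon> \<le> 1" "\<epsilon> * \<beta> \<le> \<alpha> / 2"
  obtains w where "w \<in> H"
    "\<And>C u. symmetric_bilinear_on H C \<Longrightarrow> (\<And>u v. u \<in> H \<Longrightarrow> v \<in> H \<Longrightarrow> \<bar>C u v\<bar> \<le> \<beta> * nm u * nm v) \<Longrightarrow>
      u \<in> H \<Longrightarrow> (\<And>v. v \<in> H \<Longrightarrow> B u v + \<epsilon> * C u v = l v) \<Longrightarrow>
      \<bar>F u - F u0 + \<epsilon> * C u0 w\<bar> \<le> 2 * \<beta> * L / \<alpha>\<^sup>2 * (1 + \<beta> * (K + 1) / \<alpha>) * \<epsilon>\<^sup>2 \<and>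
      \<bar>F u - F u0\<bar> \<le> 2 * \<beta> * L / \<alpha>\<^sup>2 * K * \<epsilon>"
proof -
  \<comment> \<open>The tolerance \<epsilon> suffices because the residual is evaluated at
    \<open>u - u0\<close>, which is bounded by a multiple of \<epsilon>; the resulting error is of
    second order.\<close>
  obtain w where w: "w \<in> H" "\<And>v. v \<in> H \<Longrightarrow> \<bar>F v - B w v\<bar> \<le> \<epsilon> * nm v" "\<alpha> * nm w \<le> K + \<epsilon>"
    using approximate_riesz[OF F K \<epsilon>(1)] by blast
  show thesis
  proof (rule that[OF w(1)])
    fix C u
    assume C: "symmetric_bilinear_on H C" "\<And>u v. u \<in> H \<Longrightarrow> v \<in> H \<Longrightarrow> \<bar>C u v\<bar> \<le> \<beta> * nm u * nm v"
      and u: "u \<in> H" "\<And>v. v \<in> H \<Longrightarrow> B u v + \<epsilon> * C u v = l v"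
    interpret P: coercive_form H nm "\<lambda>u v. B u v + \<epsilon> * C u v" "\<alpha> / 2" "2 * \<beta>"
      by (rule perturbed_coercive_form[OF C \<epsilon>])
    have nu: "nm u \<le> 2 * L / \<alpha>"
      using P.solution_bound[of u l L, OF u(1) L(2)[OF u(1)] L(1) u(2)[OF u(1)]] \<alpha> by (simp add: field_simps)
    define e where "e = (\<lambda>x. u x - u0 x)"
    have e: "e \<in> H" unfolding e_def by (intro diff_mem u u0)
    \<comment> \<open>Subtracting the two equations cancels the load. Tested with \<open>e\<close>
      itself this bounds \<open>e\<close> by a multiple of \<epsilon>.\<close>
    have Be: "B e v = - \<epsilon> * C u v" if v: "v \<in> H" for v
      unfolding e_def using linear_on_diff[OF form_linear[OF v] u(1) u0(1)] u(2)[OF v] u0(2)[OF v] by simp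
    have "\<alpha> * nm e \<le> \<epsilon> * \<beta> * nm u"
    proof (rule solution_bound[OF e])
      have "\<epsilon> * \<bar>C u e\<bar> \<le> \<epsilon> * (\<beta> * nm u * nm e)" by (rule mult_left_mono[OF C(2)[OF u(1) e]]) (use \<epsilon> in simp)
      then show "\<bar>- \<epsilon> * C u e\<bar> \<le> \<epsilon> * \<beta> * nm u * nm e" using \<epsilon>(1) by (simp add: abs_mult mult.assoc)
      show "0 \<le> \<epsilon> * \<beta> * nm u" using \<epsilon> \<beta> nm_nonneg by simp
    qed (rule Be[OF e])
    also have "\<dots> \<le> \<epsilon> * \<beta> * (2 * L / \<alpha>)" using nu \<epsilon> \<beta> by (intro mult_left_mono) auto
    finally have ne: "nm e \<le> 2 * \<beta> * L / \<alpha>\<^sup>2 * \<epsilon>" using \<alpha> by (simp add: field_simps power2_eq_square)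
    have "\<alpha> * nm w \<le> K + 1" using w(3) \<epsilon>(2) by simp
    then have nw: "nm w \<le> (K + 1) / \<alpha>" using \<alpha> by (simp add: field_simps)
    have Cl: "linear_on H (\<lambda>u. C u w)" using C(1) w(1) by (simp add: symmetric_bilinear_on_def)
    \<comment> \<open>Insert \<open>B w e\<close> into \<open>F e\<close>: by symmetry it equals
      \<open>B e w\<close>, that is \<open>- \<epsilon> * C u w\<close>. Splitting \<open>u\<close>
      into \<open>e + u0\<close> isolates the first-order term.\<close>
    have "F u - F u0 + \<epsilon> * C u0 w = (F e - B w e) - \<epsilon> * C e w"
    proof -
      have Cu: "C u w = C e w + C u0 w" and Fu: "F u = F e + F u0"
        using linear_on_diff[OF Cl u(1) u0(1)] linear_on_diff[OF F u(1) u0(1)] unfolding e_def by auto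
      show ?thesis using Be[OF w(1)] form_sym[OF w(1) e] by (simp add: Cu Fu algebra_simps)
    qed
    then have "\<bar>F u - F u0 + \<epsilon> * C u0 w\<bar> \<le> \<bar>F e - B w e\<bar> + \<epsilon> * \<bar>C e w\<bar>"
      using \<epsilon>(1) abs_triangle_ineq4[of "F e - B w e" "\<epsilon> * C e w"] by (simp add: abs_mult)
    also have "\<dots> \<le> \<epsilon> * nm e + \<epsilon> * (\<beta> * nm e * nm w)"
      using \<epsilon>(1) by (intro add_mono w(2)[OF e] mult_left_mono C(2) e w(1)) auto
    also have "\<dots> \<le> \<epsilon> * nm e + \<epsilon> * (\<beta> * nm e * ((K + 1) / \<alpha>))"
      using \<epsilon>(1) \<beta> nm_nonneg by (intro add_left_mono mult_left_mono nw) auto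
    also have "\<dots> = \<epsilon> * (1 + \<beta> * (K + 1) / \<alpha>) * nm e" by (simp add: algebra_simps)
    also have "\<dots> \<le> \<epsilon> * (1 + \<beta> * (K + 1) / \<alpha>) * (2 * \<beta> * L / \<alpha>\<^sup>2 * \<epsilon>)"
      using \<epsilon>(1) \<alpha> \<beta> K(1) by (intro mult_left_mono ne mult_nonneg_nonneg add_nonneg_nonneg divide_nonneg_nonneg) auto
    also have "\<dots> = 2 * \<beta> * L / \<alpha>\<^sup>2 * (1 + \<beta> * (K + 1) / \<alpha>) * \<epsilon>\<^sup>2" by (simp add: power2_eq_square)
    finally have main: "\<bar>F u - F u0 + \<epsilon> * C u0 w\<bar> \<le> 2 * \<beta> * L / \<alpha>\<^sup>2 * (1 + \<beta> * (K + 1) / \<alpha>) * \<epsilon>\<^sup>2" .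
    have "\<bar>F u - F u0\<bar> \<le> K * nm e"
      using K(2)[OF e] linear_on_diff[OF F u(1) u0(1)] by (simp add: e_def)
    also have "\<dots> \<le> 2 * \<beta> * L / \<alpha>\<^sup>2 * K * \<epsilon>" using mult_left_mono[OF ne K(1)] by (simp add: ac_simps)
    finally show "\<bar>F u - F u0 + \<epsilon> * C u0 w\<bar> \<le> 2 * \<beta> * L / \<alpha>\<^sup>2 * (1 + \<beta> * (K + 1) / \<alpha>) * \<epsilon>\<^sup>2 \<and>
      \<bar>F u - F u0\<bar> \<le> 2 * \<beta> * L / \<alpha>\<^sup>2 * K * \<epsilon>"
      using main by blast
  qed
qed

end

section \<open>Laws of the parameters\<close>

text \<open>Lebesgue measure on vectors is the image of the product measure indexed by
  \<open>Basis\<close>, so the product formula for independent coordinates transfers after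
  reindexing.\<close>

lemma
  fixes f :: "'n::finite \<Rightarrow> real \<Rightarrow> real"
  assumes f: "\<And>k. integrable lborel (f k)"
  shows integrable_prod_vec: "integrable lborel (\<lambda>p::real^'n. \<Prod>k\<in>UNIV. f k (p $ k))"
    and integral_prod_vec: "(LINT p|lborel. (\<Prod>k\<in>UNIV. f k ((p::real^'n) $ k))) = (\<Prod>k\<in>UNIV. LINT t|lborel. f k t)"
proof -
  interpret product_sigma_finite "\<lambda>b::real^'n. lborel :: real measure" by standard
  have inj: "inj (\<lambda>k::'n. axis k (1::real))" by (auto simp: inj_on_def axis_eq_axis)
  have Basis: "(Basis :: (real^'n) set) = range (\<lambda>k. axis k 1)" by (auto simp: Basis_vec_def)
  \<comment> \<open>Recovers the coordinate from its basis vector, to move between products over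
    \<open>Basis\<close> and over the index type.\<close>
  define ix where "ix = the_inv (\<lambda>k::'n. axis k (1::real))"
  have ix: "ix (axis k 1) = k" for k unfolding ix_def by (rule the_inv_f_f[OF inj])
  have nth: "(\<Sum>b\<in>Basis. x b *\<^sub>R b) $ k = x (axis k 1)" for x :: "real^'n \<Rightarrow> real" and k
  proof -
    have "(\<Sum>b\<in>Basis. x b *\<^sub>R b) $ k = (\<Sum>b\<in>Basis. x b *\<^sub>R b) \<bullet> axis k 1" by (simp add: inner_axis)
    also have "\<dots> = x (axis k 1)" by (rule inner_sum_left_Basis) (auto simp: Basis)
    finally show ?thesis .
  qed
  let ?F = "\<lambda>p::real^'n. \<Prod>k\<in>UNIV. f k (p $ k)"
  let ?T = "\<lambda>x::real^'n \<Rightarrow> real. \<Sum>b\<in>Basis. x b *\<^sub>R b"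
  let ?P = "\<Pi>\<^sub>M b\<in>(Basis :: (real^'n) set). (lborel :: real measure)"
  have T: "?T \<in> ?P \<rightarrow>\<^sub>M borel" by measurable
  have F: "?F \<in> borel_measurable borel"
    using f[THEN borel_measurable_integrable] by measurable
  have FT: "?F (?T x) = (\<Prod>b\<in>Basis. f (ix b) (x b))" for x
  proof -
    have "?F (?T x) = (\<Prod>k\<in>UNIV. f k (x (axis k 1)))" by (simp only: nth)
    also have "\<dots> = (\<Prod>b\<in>Basis. f (ix b) (x b))"
      by (subst Basis, subst prod.reindex[OF inj]) (simp add: ix)
    finally show ?thesis .
  qed
  have "integrable ?P (\<lambda>x. \<Prod>b\<in>Basis. f (ix b) (x b))"
    by (rule product_integrable_prod) (auto intro: f)
  then show "integrable lborel ?F"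
    by (subst lborel_eq, subst integrable_distr_eq[OF T F]) (simp only: FT)
  have "(LINT p|lborel. ?F p) = (LINT x|?P. (\<Prod>b\<in>Basis. f (ix b) (x b)))"
    by (subst lborel_eq, subst integral_distr[OF T F]) (simp only: FT)
  also have "\<dots> = (\<Prod>b\<in>(Basis :: (real^'n) set). LINT t|lborel. f (ix b) t)"
    by (rule product_integral_prod) (auto intro: f)
  also have "\<dots> = (\<Prod>k\<in>UNIV. LINT t|lborel. f k t)"
    unfolding Basis by (subst prod.reindex[OF inj]) (simp add: ix)
  finally show "(LINT p|lborel. ?F p) = (\<Prod>k\<in>UNIV. LINT t|lborel. f k t)" .
qed

lemma sets_param_law [measurable_cong, simp]: "sets (param_law \<rho>) = sets borel"
  and space_param_law [simp]: "space (param_law \<rho>) = UNIV"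
  by (auto simp: param_law_def)

lemma Gam_borel [measurable]: "Gam \<in> sets borel"
  by (simp add: Gam_def)

text \<open>The sign of the densities is prescribed on \<open>Gam\<close> only, so
  \<open>prod_density\<close> may be negative off the cube. The cut version is nonnegative
  everywhere and still a product of one-dimensional factors.\<close>

definition cut_density :: "('n::finite \<Rightarrow> real \<Rightarrow> real) \<Rightarrow> real^'n \<Rightarrow> real" where
  "cut_density \<rho> p = indicator cube p * prod_density \<rho> p"

lemma cut_density_eq_prod: "cut_density \<rho> p = (\<Prod>k\<in>UNIV. indicator Gam (p $ k) * \<rho> k (p $ k))"
proof -
  have "indicator cube p = (\<Prod>k\<in>UNIV. indicator Gam (p $ k) :: real)"
  proof (cases "p \<in> cube")
    case False
    then obtain k where "p $ k \<notin> Gam" by (auto simp: cube_def)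
    then have "(\<Prod>k\<in>UNIV. indicator Gam (p $ k) :: real) = 0" by (intro prod_zero) (auto intro!: exI[of _ k])
    then show ?thesis using False by simp
  qed (simp add: cube_def)
  then show ?thesis by (simp add: cut_density_def prod_density_def prod.distrib)
qed

context
  fixes \<rho> :: "'n::finite \<Rightarrow> real \<Rightarrow> real"
  assumes \<rho>: "iid_centered_densities \<rho>"
begin

lemma density_measurable: "\<rho> k \<in> borel_measurable borel"
  using \<rho> by (simp add: iid_centered_densities_def)

declare density_measurable [measurable]

lemma cut_density_nonneg: "0 \<le> cut_density \<rho> p"
  unfolding cut_density_eq_prod using \<rho>
  by (intro prod_nonneg) (auto simp: iid_centered_densities_def indicator_def)

lemma cut_density_measurable: "cut_density \<rho> \<in> borel_measurable borel"
  unfolding cut_density_eq_prod[abs_def] by measurable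

declare cut_density_measurable [measurable]

lemma param_law_eq: "param_law \<rho> = density lborel (\<lambda>p. ennreal (cut_density \<rho> p))"
  unfolding param_law_def cut_density_def
  by (intro arg_cong[where f="density lborel"] ext) (auto simp: indicator_def)

text \<open>A non-integrable function has integral 0 by convention, so the value 1 already forces
  integrability.\<close>

lemma density_integrable: "integrable lborel (\<lambda>t. indicator Gam t * \<rho> k t)"
proof -
  have "(LINT t|lborel. indicator Gam t * \<rho> k t) = 1"
    using \<rho> by (simp add: iid_centered_densities_def set_lebesgue_integral_def)
  then show ?thesis using not_integrable_integral_eq by fastforce
qed

lemma density_integral: "(LINT t|lborel. indicator Gam t * \<rho> k t) = 1"
  using \<rho> by (simp add: iid_centered_densities_def set_lebesgue_integral_def)

lemma first_moment_integrable: "integrable lborel (\<lambda>t. t * (indicator Gam t * \<rho> k t))"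
  by (rule Bochner_Integration.integrable_bound[OF density_integrable[of k]])
    (auto simp: Gam_def indicator_def abs_mult intro!: mult_left_le_one_le)

lemma first_moment: "(LINT t|lborel. t * (indicator Gam t * \<rho> k t)) = 0"
proof -
  have "(LINT t|lborel. t * (indicator Gam t * \<rho> k t)) = (LINT t:Gam|lborel. t * \<rho> k t)"
    unfolding set_lebesgue_integral_def by (intro Bochner_Integration.integral_cong) auto
  then show ?thesis using \<rho> by (simp add: iid_centered_densities_def)
qed

lemma cut_density_integrable: "integrable lborel (cut_density \<rho>)"
  and cut_density_integral: "(LINT p|lborel. cut_density \<rho> p) = 1"
  using integrable_prod_vec[OF density_integrable] integral_prod_vec[OF density_integrable]
  by (auto simp: cut_density_eq_prod[abs_def] density_integral)

lemma prob_space_param_law: "prob_space (param_law \<rho>)"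
proof
  have "emeasure (param_law \<rho>) (space (param_law \<rho>)) = (\<integral>\<^sup>+p. ennreal (cut_density \<rho> p) \<partial>lborel)"
    by (simp add: param_law_eq emeasure_density)
  also have "\<dots> = ennreal (LINT p|lborel. cut_density \<rho> p)"
    by (rule nn_integral_eq_integral[OF cut_density_integrable]) (simp add: cut_density_nonneg)
  finally show "emeasure (param_law \<rho>) (space (param_law \<rho>)) = 1" by (simp add: cut_density_integral)
qed

lemma AE_param_law_iff:
  "(AE p in param_law \<rho>. P p) \<longleftrightarrow> (AE p in lborel. 0 < cut_density \<rho> p \<longrightarrow> P p)"
  unfolding param_law_eq by (subst AE_density) auto

lemma AE_param_law_cube: "AE p in param_law \<rho>. p \<in> cube"
  unfolding AE_param_law_iff by (rule AE_I2) (auto simp: cut_density_def indicator_def split: if_splits)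

lemma integral_param_law:
  fixes g :: "real^'n \<Rightarrow> real"
  assumes "g \<in> borel_measurable borel"
  shows "(LINT p|param_law \<rho>. g p) = (LINT p|lborel. cut_density \<rho> p * g p)"
  unfolding param_law_eq using assms
  by (subst integral_density) (auto simp: cut_density_nonneg)

text \<open>The coordinate times the density is again a product, with the first moment as its factor
  \<open>j\<close>; that factor has integral 0.\<close>

lemma param_law_centered:
  shows "integrable (param_law \<rho>) (\<lambda>p. p $ j)" and "(LINT p|param_law \<rho>. p $ j) = 0"
proof -
  let ?f = "\<lambda>k t. if k = j then t * (indicator Gam t * \<rho> k t) else indicator Gam t * \<rho> k t"
  have int: "integrable lborel (?f k)" for k
    using density_integrable[of k] first_moment_integrable[of k] by (cases "k = j") auto
  have eq: "cut_density \<rho> p * p $ j = (\<Prod>k\<in>UNIV. ?f k (p $ k))" for p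
  proof -
    have "(\<Prod>k\<in>UNIV. ?f k (p $ k)) = (\<Prod>k\<in>UNIV. (if k = j then p $ k else 1) * (indicator Gam (p $ k) * \<rho> k (p $ k)))"
      by (intro prod.cong) auto
    also have "\<dots> = p $ j * cut_density \<rho> p"
      unfolding prod.distrib cut_density_eq_prod by (simp add: prod.delta)
    finally show ?thesis by simp
  qed
  have "(\<Prod>k\<in>UNIV. LINT t|lborel. ?f k t) = 0"
    by (rule prod_zero) (auto intro!: exI[of _ j] simp: first_moment)
  then have "(LINT p|lborel. cut_density \<rho> p * p $ j) = 0"
    unfolding eq integral_prod_vec[OF int] .
  then show "(LINT p|param_law \<rho>. p $ j) = 0" by (subst integral_param_law) auto
  have "integrable lborel (\<lambda>p. cut_density \<rho> p * p $ j)"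
    unfolding eq by (rule integrable_prod_vec[OF int])
  then show "integrable (param_law \<rho>) (\<lambda>p. p $ j)"
    unfolding param_law_eq by (subst integrable_density) (auto simp: cut_density_nonneg)
qed

end

declare density_measurable [measurable del] cut_density_measurable [measurable del]

text \<open>By completeness of Lebesgue measure, \<open>f\<close> inherits measurability from its
  Borel version \<open>g\<close>. This is the way in which integrands known only almost everywhere
  are handled.\<close>

lemma integral_lebesgue_eq_of_AE:
  fixes f g :: "'a::euclidean_space \<Rightarrow> real"
  assumes g: "g \<in> borel_measurable borel" and ae: "AE x in lborel. f x = g x"
  shows "(LINT x|lebesgue. f x) = (LINT x|lborel. g x)"
proof -
  have g': "g \<in> borel_measurable lebesgue" using g by (auto intro: measurable_completion)
  have ae': "AE x in lebesgue. f x = g x" using ae by (rule AE_completion)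
  have "f \<in> borel_measurable lebesgue"
    by (rule borel_measurable_AE[OF g']) (use ae' in \<open>auto elim: eventually_mono\<close>)
  then have "(LINT x|lebesgue. f x) = (LINT x|lebesgue. g x)"
    using g' ae' by (intro integral_cong_AE)
  then show ?thesis using g by (simp add: integral_completion)
qed

lemma AE_pair_snd:
  assumes "prob_space M1" "prob_space M2" and Q: "AE z in M2. Q z"
  shows "AE p in M1 \<Otimes>\<^sub>M M2. Q (snd p)"
proof -
  interpret M1: prob_space M1 by fact
  interpret M2: prob_space M2 by fact
  obtain N where N: "{z \<in> space M2. \<not> Q z} \<subseteq> N" "emeasure M2 N = 0" "N \<in> sets M2"
    using Q by (rule AE_E)
  have "space M1 \<times> N \<in> null_sets (M1 \<Otimes>\<^sub>M M2)"
    using N(2,3) by (auto simp: null_sets_def M2.emeasure_pair_measure_Times)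
  then show ?thesis by (rule AE_I') (use N(1) in \<open>auto simp: space_pair_measure\<close>)
qed

text \<open>The property \<open>P\<close> need not be measurable, so the order of the variables is
  exchanged for a measurable null set that contains its exceptional set.\<close>

lemma AE_pair_swapped:
  assumes "sigma_finite_measure M1" "sigma_finite_measure M2" "AE p in M1 \<Otimes>\<^sub>M M2. P p"
  shows "AE y in M2. AE x in M1. P (x, y)"
proof -
  interpret pair_sigma_finite M1 M2 using assms(1,2) by (rule pair_sigma_finite.intro)
  interpret Q: pair_sigma_finite M2 M1 ..
  obtain N where N: "{p \<in> space (M1 \<Otimes>\<^sub>M M2). \<not> P p} \<subseteq> N" "emeasure (M1 \<Otimes>\<^sub>M M2) N = 0" "N \<in> sets (M1 \<Otimes>\<^sub>M M2)"
    using assms(3) by (rule AE_E)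
  have "AE p in M1 \<Otimes>\<^sub>M M2. p \<notin> N" using N by (intro AE_not_in) (auto simp: null_sets_def)
  then have "AE x in M1. AE y in M2. (x, y) \<notin> N" by (rule AE_pair)
  then have "AE y in M2. AE x in M1. (x, y) \<notin> N"
    by (subst AE_commute[symmetric]) (use N(3) in auto)
  then show ?thesis
  proof (rule AE_mp[OF _ AE_I2[OF impI]])
    fix y assume y: "y \<in> space M2" and ae: "AE x in M1. (x, y) \<notin> N"
    show "AE x in M1. P (x, y)"
      using ae AE_space by eventually_elim (use y N(1) in \<open>auto simp: space_pair_measure\<close>)
  qed
qed

context
  fixes \<rho>X :: "'n::finite \<Rightarrow> real \<Rightarrow> real" and \<rho>Y :: "'m::finite \<Rightarrow> real \<Rightarrow> real"
  assumes \<rho>X: "iid_centered_densities \<rho>X" and \<rho>Y: "iid_centered_densities \<rho>Y"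
begin

text \<open>The integrand \<open>g\<close> comes from choices of solutions, so it is traded for a
  jointly Borel function before any form of Fubini is applied. Sections of a null set are null for
  almost every \<open>y\<close>, which handles the inner integral first and then the outer
  one.\<close>

lemma expect_eq_integral:
  fixes G :: "(real^'n) \<times> (real^'m) \<Rightarrow> real"
  assumes G [measurable]: "G \<in> borel_measurable (borel \<Otimes>\<^sub>M borel)"
    and ae: "AE (y, z) in param_law \<rho>X \<Otimes>\<^sub>M param_law \<rho>Y. g y z = G (y, z)"
  shows "expect \<rho>X \<rho>Y g = (LINT y|param_law \<rho>X. LINT z|param_law \<rho>Y. G (y, z))"
proof -
  let ?PX = "param_law \<rho>X" and ?PY = "param_law \<rho>Y"
  interpret X: prob_space ?PX by (rule prob_space_param_law[OF \<rho>X])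
  interpret Y: prob_space ?PY by (rule prob_space_param_law[OF \<rho>Y])
  interpret XY: pair_sigma_finite ?PX ?PY ..
  note [measurable] = cut_density_measurable[OF \<rho>X] cut_density_measurable[OF \<rho>Y]
  let ?I = "\<lambda>y. LINT z|?PY. G (y, z)"
  have I [measurable]: "?I \<in> borel_measurable borel" by measurable
  have inner: "(LINT z:cube|lebesgue. g y z * prod_density \<rho>X y * prod_density \<rho>Y z) = prod_density \<rho>X y * ?I y"
    if y: "AE z in ?PY. g y z = G (y, z)" for y
  proof -
    have "(LINT z:cube|lebesgue. g y z * prod_density \<rho>X y * prod_density \<rho>Y z) =
      (LINT z|lborel. prod_density \<rho>X y * (cut_density \<rho>Y z * G (y, z)))"
      unfolding set_lebesgue_integral_def
    proof (rule integral_lebesgue_eq_of_AE)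
      have "AE z in lborel. 0 < cut_density \<rho>Y z \<longrightarrow> g y z = G (y, z)"
        using y unfolding AE_param_law_iff[OF \<rho>Y] .
      then show "AE z in lborel. indicator cube z *\<^sub>R (g y z * prod_density \<rho>X y * prod_density \<rho>Y z) =
          prod_density \<rho>X y * (cut_density \<rho>Y z * G (y, z))"
      proof eventually_elim
        case (elim z)
        show ?case
        proof (cases "cut_density \<rho>Y z = 0")
          case False
          then have "g y z = G (y, z)" using elim cut_density_nonneg[OF \<rho>Y, of z] by auto
          then show ?thesis by (simp add: cut_density_def)
        next
          \<comment> \<open>Agreement of \<open>g\<close> and \<open>G\<close> is known only where
            the density is positive; elsewhere both integrands vanish.\<close>
          case True
          then have "indicator cube z * prod_density \<rho>Y z = 0" by (simp add: cut_density_def)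
          then show ?thesis using True by auto
        qed
      qed
    qed measurable
    also have "\<dots> = prod_density \<rho>X y * ?I y" by (simp add: integral_param_law[OF \<rho>Y])
    finally show ?thesis .
  qed
  have "expect \<rho>X \<rho>Y g = (LINT y|lborel. cut_density \<rho>X y * ?I y)"
    unfolding expect_def set_lebesgue_integral_def[of lebesgue cube "\<lambda>y. set_lebesgue_integral lebesgue cube (\<lambda>z. g y z * prod_density \<rho>X y * prod_density \<rho>Y z)"]
  proof (rule integral_lebesgue_eq_of_AE)
    have "AE y in ?PX. AE z in ?PY. g y z = G (y, z)" using XY.AE_pair[OF ae] by simp
    then have "AE y in lborel. 0 < cut_density \<rho>X y \<longrightarrow> (AE z in ?PY. g y z = G (y, z))"
      unfolding AE_param_law_iff[OF \<rho>X] .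
    then show "AE y in lborel. indicator cube y *\<^sub>R (LINT z:cube|lebesgue. g y z * prod_density \<rho>X y * prod_density \<rho>Y z) =
        cut_density \<rho>X y * ?I y"
    proof eventually_elim
      case (elim y)
      show ?case
      proof (cases "cut_density \<rho>X y = 0")
        case False
        then have "AE z in ?PY. g y z = G (y, z)" using elim cut_density_nonneg[OF \<rho>X, of y] by auto
        then show ?thesis by (simp add: inner cut_density_def)
      next
        case True
        then have "y \<notin> cube \<or> prod_density \<rho>X y = 0" by (auto simp: cut_density_def)
        then show ?thesis using True by (auto simp: set_lebesgue_integral_def)
      qed
    qed
  qed measurable
  then show ?thesis by (simp add: integral_param_law[OF \<rho>X])
qed

text \<open>The first-order term \<open>\<Sum>k. c k * y $ k\<close> is integrated out over \<open>y\<close> first, which requires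
  no measurability of \<open>c\<close> in \<open>z\<close>.\<close>

lemma expect_varc_perturbation:
  fixes G :: "(real^'n) \<times> (real^'m) \<Rightarrow> real" and G0 :: "real^'m \<Rightarrow> real"
  assumes G [measurable]: "G \<in> borel_measurable (borel \<Otimes>\<^sub>M borel)" and G0 [measurable]: "G0 \<in> borel_measurable borel"
    and gG: "AE (y, z) in param_law \<rho>X \<Otimes>\<^sub>M param_law \<rho>Y. g y z = G (y, z)"
    and g0G0: "AE z in param_law \<rho>Y. g0 z = G0 z"
    and M: "AE z in param_law \<rho>Y. \<bar>g0 z\<bar> \<le> M"
    and K1: "AE (y, z) in param_law \<rho>X \<Otimes>\<^sub>M param_law \<rho>Y. \<bar>g y z - g0 z\<bar> \<le> K1 * \<epsilon>"
    and K2: "AE z in param_law \<rho>Y. \<exists>c. AE y in param_law \<rho>X. \<bar>g y z - g0 z + (\<Sum>k\<in>UNIV. c k * y $ k)\<bar> \<le> K2 * \<epsilon>\<^sup>2"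
    and pos: "0 \<le> M" "0 \<le> K1" "0 \<le> K2" "0 < \<epsilon>" "\<epsilon> \<le> 1"
  shows "\<bar>expect \<rho>X \<rho>Y g - expect \<rho>X \<rho>Y (\<lambda>y z. g0 z)\<bar> \<le> K2 * \<epsilon>\<^sup>2"
    and "\<bar>varc \<rho>X \<rho>Y g - varc \<rho>X \<rho>Y (\<lambda>y z. g0 z)\<bar> \<le> (2 * M * K2 + K1\<^sup>2 + K2 * (2 * M + K1)) * \<epsilon>\<^sup>2"
proof -
  let ?PX = "param_law \<rho>X" and ?PY = "param_law \<rho>Y"
  let ?P = "?PX \<Otimes>\<^sub>M ?PY"
  interpret X: prob_space ?PX by (rule prob_space_param_law[OF \<rho>X])
  interpret Y: prob_space ?PY by (rule prob_space_param_law[OF \<rho>Y])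
  interpret XY: pair_prob_space ?PX ?PY ..
  have fst_integral: "(LINT y|?PX. LINT z|?PY. f (y, z)) = (LINT p|?P. f p)"
    and snd_integral: "(LINT z|?PY. LINT y|?PX. f (y, z)) = (LINT p|?P. f p)"
    if "integrable ?P f" for f :: "_ \<Rightarrow> real"
    using XY.integral_fst'[OF that] XY.integral_snd[of "\<lambda>y z. f (y, z)"] that by auto
  note AE_snd = AE_pair_snd[OF X.prob_space_axioms Y.prob_space_axioms]
  have gG': "AE p in ?P. g (fst p) (snd p) = G p" using gG by (simp add: case_prod_beta)
  have G0ae: "AE p in ?P. g0 (snd p) = G0 (snd p)" by (rule AE_snd[OF g0G0])
  have bG0: "AE p in ?P. \<bar>G0 (snd p)\<bar> \<le> M"
    using AE_snd[OF M] G0ae by eventually_elim simp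
  have bD: "AE p in ?P. \<bar>G p - G0 (snd p)\<bar> \<le> K1 * \<epsilon>"
    using K1 gG' G0ae by eventually_elim (auto simp: case_prod_beta)
  have K1\<epsilon>: "K1 * \<epsilon> \<le> K1" using pos by (simp add: mult_left_le)
  have bG: "AE p in ?P. \<bar>G p\<bar> \<le> M + K1"
    using bD bG0 by eventually_elim (use K1\<epsilon> in linarith)
  have int: "integrable ?P f" if "f \<in> borel_measurable ?P" "AE p in ?P. \<bar>f p\<bar> \<le> b" for f :: "_ \<Rightarrow> real" and b
    using that by (intro XY.integrable_const_bound[of _ b]) auto
  have intG: "integrable ?P G" by (rule int[OF _ bG]) measurable
  have intG0: "integrable ?P (\<lambda>p. G0 (snd p))" by (rule int[OF _ bG0]) measurable
  have sqb: "\<bar>x\<^sup>2\<bar> \<le> b\<^sup>2" if "\<bar>x\<bar> \<le> b" for x b :: real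
    using power_mono[OF that, of 2] by simp
  have "AE p in ?P. \<bar>(G p)\<^sup>2\<bar> \<le> (M + K1)\<^sup>2"
    using bG by eventually_elim (rule sqb)
  then have intGG: "integrable ?P (\<lambda>p. (G p)\<^sup>2)" by (rule int[rotated]) measurable
  have "AE p in ?P. \<bar>(G0 (snd p))\<^sup>2\<bar> \<le> M\<^sup>2"
    using bG0 by eventually_elim (rule sqb)
  then have intGG0: "integrable ?P (\<lambda>p. (G0 (snd p))\<^sup>2)" by (rule int[rotated]) measurable
  define m m0 where "m = (LINT p|?P. G p)" and "m0 = (LINT p|?P. G0 (snd p))"
  have Eg: "expect \<rho>X \<rho>Y g = m"
    unfolding m_def fst_integral[OF intG, symmetric] by (rule expect_eq_integral[OF G gG])
  have Eg0: "expect \<rho>X \<rho>Y (\<lambda>y z. g0 z) = m0"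
    unfolding m0_def fst_integral[OF intG0, symmetric]
    by (rule expect_eq_integral) (use G0ae in \<open>auto simp: case_prod_beta\<close>)
  \<comment> \<open>Second moment minus squared mean: the two parts are compared separately
    below.\<close>
  have Vg: "varc \<rho>X \<rho>Y g = (LINT p|?P. (G p)\<^sup>2) - m\<^sup>2"
  proof -
    have i: "integrable ?P (\<lambda>p. (G p - m)\<^sup>2)"
      unfolding power2_diff using intG intGG by auto
    have "varc \<rho>X \<rho>Y g = (LINT p|?P. (G p - m)\<^sup>2)"
      unfolding varc_def Eg fst_integral[OF i, symmetric]
      by (rule expect_eq_integral) (use gG in \<open>auto elim!: eventually_mono\<close>)
    also have "\<dots> = (LINT p|?P. (G p)\<^sup>2) - m\<^sup>2"
      unfolding power2_diff using intG intGG
      by (simp add: m_def[symmetric] XY.prob_space power2_eq_square)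
    finally show ?thesis .
  qed
  have Vg0: "varc \<rho>X \<rho>Y (\<lambda>y z. g0 z) = (LINT p|?P. (G0 (snd p))\<^sup>2) - m0\<^sup>2"
  proof -
    have i: "integrable ?P (\<lambda>p. (G0 (snd p) - m0)\<^sup>2)"
      unfolding power2_diff using intG0 intGG0 by auto
    have "varc \<rho>X \<rho>Y (\<lambda>y z. g0 z) = (LINT p|?P. (G0 (snd p) - m0)\<^sup>2)"
      unfolding varc_def Eg0 fst_integral[OF i, symmetric]
      by (rule expect_eq_integral) (use G0ae in \<open>auto elim!: eventually_mono\<close>)
    also have "\<dots> = (LINT p|?P. (G0 (snd p))\<^sup>2) - m0\<^sup>2"
      unfolding power2_diff using intG0 intGG0
      by (simp add: m0_def[symmetric] XY.prob_space power2_eq_square)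
    finally show ?thesis .
  qed
  \<comment> \<open>Non-integrable \<open>f\<close> is covered as well, since its integral is then
    0; this is why \<open>b\<close> must be nonnegative.\<close>
  have bound: "\<bar>LINT x|N. f x\<bar> \<le> b" if "prob_space N" "AE x in N. \<bar>f x\<bar> \<le> b" "0 \<le> b" for N and f :: "_ \<Rightarrow> real" and b
  proof (cases "integrable N f")
    case True
    interpret prob_space N by fact
    have "\<bar>LINT x|N. f x\<bar> \<le> (LINT x|N. \<bar>f x\<bar>)" by (rule integral_abs_bound)
    also have "\<dots> \<le> (LINT x|N. b)" by (rule integral_mono_AE) (use True that(2) in auto)
    finally show ?thesis by (simp add: prob_space)
  qed (simp add: not_integrable_integral_eq that(3))
  have slice: "AE z in ?PY. AE y in ?PX. Q (y, z)" if "AE p in ?P. Q p" for Q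
    by (rule AE_pair_swapped[OF _ _ that]) unfold_locales
  \<comment> \<open>Pointwise in \<open>y\<close> the difference is only of order \<epsilon>; the
    second-order bound holds for its \<open>y\<close>-mean, for each fixed \<open>z\<close>.\<close>
  have inner: "AE z in ?PY. \<bar>G0 z\<bar> \<le> M \<and> (AE y in ?PX. \<bar>G (y, z) - G0 z\<bar> \<le> K1 * \<epsilon>) \<and>
      \<bar>LINT y|?PX. G (y, z) - G0 z\<bar> \<le> K2 * \<epsilon>\<^sup>2"
    using slice[OF bD] slice[OF gG'] g0G0 M K2
  proof eventually_elim
    case (elim z)
    obtain c where c: "AE y in ?PX. \<bar>g y z - g0 z + (\<Sum>k\<in>UNIV. c k * y $ k)\<bar> \<le> K2 * \<epsilon>\<^sup>2" using elim(5) by blast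
    have iD: "integrable ?PX (\<lambda>y. G (y, z) - G0 z)"
      by (rule X.integrable_const_bound[of _ "K1 * \<epsilon>"]) (use elim(1) in auto)
    have iS: "integrable ?PX (\<lambda>y. \<Sum>k\<in>UNIV. c k * y $ k)"
      by (intro Bochner_Integration.integrable_sum integrable_mult_right param_law_centered(1)[OF \<rho>X])
    have S0: "(LINT y|?PX. (\<Sum>k\<in>UNIV. c k * y $ k)) = 0"
      by (subst Bochner_Integration.integral_sum) (auto simp: param_law_centered[OF \<rho>X])
    have "\<bar>LINT y|?PX. (G (y, z) - G0 z) + (\<Sum>k\<in>UNIV. c k * y $ k)\<bar> \<le> K2 * \<epsilon>\<^sup>2"
    proof (rule bound[OF X.prob_space_axioms])
      show "AE y in ?PX. \<bar>(G (y, z) - G0 z) + (\<Sum>k\<in>UNIV. c k * y $ k)\<bar> \<le> K2 * \<epsilon>\<^sup>2"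
        using c elim(2) by eventually_elim (use elim(3) in simp)
    qed (use pos in simp)
    then have "\<bar>LINT y|?PX. G (y, z) - G0 z\<bar> \<le> K2 * \<epsilon>\<^sup>2"
      using Bochner_Integration.integral_add[OF iD iS] S0 by simp
    then show ?case using elim by auto
  qed
  \<comment> \<open>Here \<open>y\<close> becomes the inner variable, opposite to the order in
    \<open>expect\<close>.\<close>
  have "m - m0 = (LINT p|?P. G p - G0 (snd p))" unfolding m_def m0_def using intG intG0 by simp
  also have "\<dots> = (LINT z|?PY. LINT y|?PX. G (y, z) - G0 z)"
    by (subst snd_integral[symmetric]) (use intG intG0 in auto)
  also have "\<bar>\<dots>\<bar> \<le> K2 * \<epsilon>\<^sup>2"
    by (rule bound[OF Y.prob_space_axioms]) (use inner pos in \<open>auto elim: eventually_mono\<close>)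
  finally have mm0: "\<bar>m - m0\<bar> \<le> K2 * \<epsilon>\<^sup>2" .
  then show "\<bar>expect \<rho>X \<rho>Y g - expect \<rho>X \<rho>Y (\<lambda>y z. g0 z)\<bar> \<le> K2 * \<epsilon>\<^sup>2" by (simp add: Eg Eg0)
  have "(LINT p|?P. (G p)\<^sup>2) - (LINT p|?P. (G0 (snd p))\<^sup>2) = (LINT p|?P. (G p)\<^sup>2 - (G0 (snd p))\<^sup>2)"
    using intGG intGG0 by simp
  also have "\<dots> = (LINT z|?PY. LINT y|?PX. (G (y, z))\<^sup>2 - (G0 z)\<^sup>2)"
    by (subst snd_integral[symmetric]) (use intGG intGG0 in auto)
  also have "\<bar>\<dots>\<bar> \<le> (2 * M * K2 + K1\<^sup>2) * \<epsilon>\<^sup>2"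
  proof (rule bound[OF Y.prob_space_axioms])
    show "AE z in ?PY. \<bar>LINT y|?PX. (G (y, z))\<^sup>2 - (G0 z)\<^sup>2\<bar> \<le> (2 * M * K2 + K1\<^sup>2) * \<epsilon>\<^sup>2"
      using inner
    proof eventually_elim
      case (elim z)
      let ?d = "\<lambda>y. G (y, z) - G0 z"
      have b2: "AE y in ?PX. \<bar>(?d y)\<^sup>2\<bar> \<le> K1\<^sup>2 * \<epsilon>\<^sup>2"
        using elim[THEN conjunct2, THEN conjunct1]
      proof eventually_elim
        case (elim y)
        from sqb[OF this] show ?case by (simp add: power_mult_distrib)
      qed
      have iD: "integrable ?PX ?d"
        by (rule X.integrable_const_bound[of _ "K1 * \<epsilon>"]) (use elim in auto)
      have iD2: "integrable ?PX (\<lambda>y. (?d y)\<^sup>2)"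
        by (rule X.integrable_const_bound[of _ "K1\<^sup>2 * \<epsilon>\<^sup>2"]) (use b2 in auto)
      have "(LINT y|?PX. (G (y, z))\<^sup>2 - (G0 z)\<^sup>2) = (LINT y|?PX. 2 * G0 z * ?d y + (?d y)\<^sup>2)"
        by (simp add: algebra_simps power2_eq_square)
      also have "\<dots> = 2 * G0 z * (LINT y|?PX. ?d y) + (LINT y|?PX. (?d y)\<^sup>2)"
        using iD iD2 by simp
      finally have "\<bar>LINT y|?PX. (G (y, z))\<^sup>2 - (G0 z)\<^sup>2\<bar> \<le>
          2 * (\<bar>G0 z\<bar> * \<bar>LINT y|?PX. ?d y\<bar>) + \<bar>LINT y|?PX. (?d y)\<^sup>2\<bar>"
        by (simp add: abs_mult mult.assoc order_trans[OF abs_triangle_ineq])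
      also have "\<dots> \<le> 2 * (M * (K2 * \<epsilon>\<^sup>2)) + K1\<^sup>2 * \<epsilon>\<^sup>2"
        using elim pos bound[OF X.prob_space_axioms b2]
        by (intro add_mono mult_left_mono mult_mono) auto
      finally show ?case by (simp add: algebra_simps)
    qed
  qed (use pos in simp)
  finally have sq: "\<bar>(LINT p|?P. (G p)\<^sup>2) - (LINT p|?P. (G0 (snd p))\<^sup>2)\<bar> \<le> (2 * M * K2 + K1\<^sup>2) * \<epsilon>\<^sup>2" .
  \<comment> \<open>The squared means differ by the product of \<open>m - m0\<close> and
    \<open>m + m0\<close>, which contributes \<open>K2 * (2 * M + K1)\<close> to the variance
    constant. Its other terms, \<open>2 * M * K2\<close> and \<open>K1\<^sup>2\<close>, came from
    the cross term and the square in the second moments.\<close>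
  have "\<bar>m\<bar> \<le> M + K1" unfolding m_def by (rule bound[OF XY.prob_space_axioms bG]) (use pos in simp)
  moreover have "\<bar>m0\<bar> \<le> M" unfolding m0_def by (rule bound[OF XY.prob_space_axioms bG0]) (use pos in simp)
  ultimately have "\<bar>m + m0\<bar> \<le> 2 * M + K1" by linarith
  then have "\<bar>m - m0\<bar> * \<bar>m + m0\<bar> \<le> K2 * \<epsilon>\<^sup>2 * (2 * M + K1)"
    using mm0 pos by (intro mult_mono) auto
  then have "\<bar>m\<^sup>2 - m0\<^sup>2\<bar> \<le> K2 * \<epsilon>\<^sup>2 * (2 * M + K1)"
    by (simp add: abs_mult[symmetric] power2_eq_square algebra_simps)
  then show "\<bar>varc \<rho>X \<rho>Y g - varc \<rho>X \<rho>Y (\<lambda>y z. g0 z)\<bar> \<le> (2 * M * K2 + K1\<^sup>2 + K2 * (2 * M + K1)) * \<epsilon>\<^sup>2"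
    using sq unfolding Vg Vg0 by (simp add: algebra_simps)
qed

end

section \<open>Diffeomorphic images of a domain\<close>

lemma abs_det_le:
  fixes A :: "real^'n^'n"
  assumes "\<And>i j. \<bar>A $ i $ j\<bar> \<le> B"
  shows "\<bar>det A\<bar> \<le> fact CARD('n) * B ^ CARD('n)"
proof -
  have "\<bar>det A\<bar> \<le> (\<Sum>p | p permutes (UNIV :: 'n set). \<bar>of_int (sign p) * (\<Prod>i\<in>UNIV. A $ i $ p i)\<bar>)"
    unfolding det_def by (rule sum_abs)
  also have "\<dots> \<le> (\<Sum>p | p permutes (UNIV :: 'n set). B ^ CARD('n))"
  proof (rule sum_mono)
    fix p :: "'n \<Rightarrow> 'n"
    have "\<bar>of_int (sign p) * (\<Prod>i\<in>UNIV. A $ i $ p i)\<bar> = (\<Prod>i\<in>UNIV. \<bar>A $ i $ p i\<bar>)"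
      by (simp add: abs_mult sign_def abs_prod)
    also have "\<dots> \<le> (\<Prod>i\<in>(UNIV :: 'n set). B)" by (rule prod_mono) (use assms in auto)
    finally show "\<bar>of_int (sign p) * (\<Prod>i\<in>UNIV. A $ i $ p i)\<bar> \<le> B ^ CARD('n)" by simp
  qed
  also have "\<dots> = fact CARD('n) * B ^ CARD('n)" by (simp add: card_permutations[OF refl])
  finally show ?thesis .
qed

text \<open>Its components are quotients of polynomials in the entries, so measurable dependence on
  the matrix is immediate, which it is not for the choice behind \<open>matrix_inv\<close>.\<close>

definition cramer_solve :: "real^'n^'n \<Rightarrow> real^'n \<Rightarrow> real^'n" where
  "cramer_solve A b = (\<chi> k. det (\<chi> i j. if j = k then b $ i else A $ i $ j) / det A)"

lemma cramer_solve_iff: "det A \<noteq> 0 \<Longrightarrow> cramer_solve A b = x \<longleftrightarrow> A *v x = b"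
  using cramer[of A x b] by (auto simp: cramer_solve_def)

lemma mult_cramer_solve: "det A \<noteq> 0 \<Longrightarrow> A *v cramer_solve A b = b"
  using cramer_solve_iff[of A b] by blast

lemma cramer_solve_add_scaleR:
  assumes "det A \<noteq> 0"
  shows "cramer_solve A (x + c *\<^sub>R y) = cramer_solve A x + c *\<^sub>R cramer_solve A y"
  by (simp add: cramer_solve_iff[OF assms] matrix_vector_right_distrib matrix_vector_mult_scaleR mult_cramer_solve[OF assms])

lemma borel_measurable_det:
  fixes A :: "'a \<Rightarrow> real^'n^'n"
  assumes [measurable]: "\<And>i j. (\<lambda>x. A x $ i $ j) \<in> borel_measurable M"
  shows "(\<lambda>x. det (A x)) \<in> borel_measurable M"
  unfolding det_def by measurable

lemma borel_measurable_cramer_solve: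
  fixes A :: "'a \<Rightarrow> real^'n^'n"
  assumes A: "\<And>i j. (\<lambda>x. A x $ i $ j) \<in> borel_measurable M" and b: "b \<in> borel_measurable M"
  shows "(\<lambda>x. cramer_solve (A x) (b x)) \<in> borel_measurable M"
  unfolding borel_measurable_vec_iff cramer_solve_def vec_lambda_beta
proof (intro allI borel_measurable_divide borel_measurable_det A)
  fix k i j
  show "(\<lambda>x. (\<chi> i j. if j = k then b x $ i else A x $ i $ j) $ i $ j) \<in> borel_measurable M"
    using A[of i j] b by (cases "j = k") (auto simp: borel_measurable_vec_iff)
qed

lemma matrix_inv_works:
  assumes "invertible A"
  shows "A ** matrix_inv A = mat 1" "matrix_inv A ** A = mat 1"
  using someI_ex[OF assms[unfolded invertible_def]] by (auto simp: matrix_inv_def)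

lemma inner_transpose_mult:
  fixes A :: "real^'n^'m"
  shows "x \<bullet> (transpose A *v y) = (A *v x) \<bullet> y"
  unfolding transpose_matrix_vector by (metis dot_lmul_matrix inner_commute)

text \<open>Factors the pulled-back coefficient into a symmetric pairing; symmetry, coercivity and
  boundedness of the forms all rest on it.\<close>

lemma matrix_inv_transpose_mult_inner:
  fixes J :: "real^'n^'n"
  assumes d: "det J \<noteq> 0"
  shows "(matrix_inv (transpose J ** J) *v x) \<bullet> y = cramer_solve (transpose J) x \<bullet> cramer_solve (transpose J) y"
proof -
  have d': "det (transpose J) \<noteq> 0" using d by (simp add: det_transpose)
  let ?S = "cramer_solve (transpose J)" and ?A = "transpose J ** J"
  have "invertible ?A" using d d' by (simp add: invertible_det_nz det_mul)
  define r where "r = matrix_inv ?A *v x"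
  have "?A *v r = x" unfolding r_def matrix_vector_mul_assoc
    using matrix_inv_works(1)[OF \<open>invertible ?A\<close>] by (simp only: matrix_vector_mul_lid)
  then have "transpose J *v (J *v r) = x" by (simp only: matrix_vector_mul_assoc)
  then have Jr: "J *v r = ?S x" using cramer_solve_iff[OF d', of x "J *v r"] by simp
  have "r \<bullet> y = r \<bullet> (transpose J *v ?S y)" by (simp only: mult_cramer_solve[OF d'])
  also have "\<dots> = (J *v r) \<bullet> ?S y" by (rule inner_transpose_mult)
  finally show ?thesis unfolding Jr unfolding r_def .
qed

text \<open>A real supremum controls its members only over a set bounded above; compactness of the
  closure provides this for both suprema in \<open>C1_norm\<close>.\<close>

lemma C1_closure_derivative_bounded:
  fixes D :: "(real^'d) set"
  assumes v: "C1_closure D v" and D: "bounded D"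
  shows "bdd_above ((\<lambda>x. onorm (frechet_derivative v (at x))) ` D)"
    and "bdd_above ((\<lambda>x. norm (v x)) ` closure D)"
proof -
  obtain J where J: "continuous_on (closure D) J"
    "\<And>x. x \<in> D \<Longrightarrow> (v has_derivative (\<lambda>h. (J x :: real^'d^'d) *v h)) (at x)"
    and v': "continuous_on (closure D) v"
    using v by (auto simp: C1_closure_def)
  have c: "compact (closure D)" using D by simp
  let ?s = "\<lambda>x. \<Sum>i\<in>UNIV. \<Sum>j\<in>UNIV. \<bar>J x $ i $ j\<bar>"
  have "compact (?s ` closure D)"
    by (intro compact_continuous_image c continuous_intros J)
  then have b: "bdd_above (?s ` closure D)" by (intro bounded_imp_bdd_above compact_imp_bounded)
  then obtain B where B: "\<And>x. x \<in> closure D \<Longrightarrow> ?s x \<le> B" by (auto simp: bdd_above_def)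
  have "onorm (frechet_derivative v (at x)) \<le> B" if "x \<in> D" for x
  proof -
    have "frechet_derivative v (at x) = (*v) (J x)" using frechet_derivative_at[OF J(2)[OF that]] by simp
    then have "onorm (frechet_derivative v (at x)) \<le> ?s x" by (simp add: onorm_le_matrix_component_sum)
    also have "\<dots> \<le> B" using that closure_subset by (intro B) auto
    finally show ?thesis .
  qed
  then show "bdd_above ((\<lambda>x. onorm (frechet_derivative v (at x))) ` D)" by (auto simp: bdd_above_def)
  have "compact ((\<lambda>x. norm (v x)) ` closure D)" by (intro compact_continuous_image c continuous_intros v')
  then show "bdd_above ((\<lambda>x. norm (v x)) ` closure D)" by (intro bounded_imp_bdd_above compact_imp_bounded)
qed

lemma onorm_derivative_le_C1_norm:
  assumes v: "C1_closure D v" and D: "bounded D" and x: "x \<in> D"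
  shows "onorm (frechet_derivative v (at x)) \<le> C1_norm D v"
proof -
  note b = C1_closure_derivative_bounded[OF v D]
  have "x \<in> closure D" using x closure_subset by auto
  then have "0 \<le> (SUP x\<in>closure D. norm (v x))"
    using cSUP_upper2[OF b(2), of x 0] by simp
  moreover have "onorm (frechet_derivative v (at x)) \<le> (SUP x\<in>D. onorm (frechet_derivative v (at x)))"
    by (rule cSUP_upper[OF x b(1)])
  ultimately show ?thesis by (simp add: C1_norm_def)
qed

lemma C1_closure_has_derivative:
  assumes "C1_closure D v" "x \<in> D"
  shows "(v has_derivative frechet_derivative v (at x)) (at x)"
  using assms unfolding C1_closure_def by (metis frechet_derivative_at)

lemma C1_closure_jacobian:
  assumes v: "C1_closure D v"
  shows "\<And>x. x \<in> D \<Longrightarrow> (v has_derivative (\<lambda>h. jacobian v (at x) *v h)) (at x)"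
    and "continuous_on D (\<lambda>x. jacobian v (at x))"
proof -
  obtain J where J: "continuous_on (closure D) J"
    "\<And>x. x \<in> D \<Longrightarrow> (v has_derivative (\<lambda>h. J x *v h)) (at x)"
    using v by (auto simp: C1_closure_def)
  have eq: "jacobian v (at x) = J x" if "x \<in> D" for x
    unfolding jacobian_def frechet_derivative_at[OF J(2)[OF that], symmetric] by simp
  show "(v has_derivative (\<lambda>h. jacobian v (at x) *v h)) (at x)" if "x \<in> D" for x
    using J(2)[OF that] eq[OF that] by simp
  have "continuous_on D J" using J(1) closure_subset by (rule continuous_on_subset)
  then show "continuous_on D (\<lambda>x. jacobian v (at x))" by (rule continuous_on_eq) (simp add: eq)
qed

text \<open>One realisation of the random domain. All estimates below depend on the map only through
  \<open>C\<close> and the dimension, hence are uniform over realisations.\<close>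

locale diffeo_domain =
  fixes D :: "(real^'d) set" and v :: "real^'d \<Rightarrow> real^'d" and C :: real
  assumes open_D: "open D" and bounded_D: "bounded D"
    and diffeo: "C1_diffeo D v"
    and det_pos: "\<And>x. x \<in> D \<Longrightarrow> 0 < det (jacobian v (at x))"
    and norm_v: "C1_norm D v \<le> C"
    and norm_inv: "C1_norm (v ` D) (the_inv_into (closure D) v) \<le> C"
    and C_pos: "0 < C"
begin

abbreviation J :: "real^'d \<Rightarrow> real^'d^'d" where "J x \<equiv> jacobian v (at x)"
abbreviation W :: "real^'d \<Rightarrow> real^'d" where "W \<equiv> the_inv_into (closure D) v"

lemma v_C1: "C1_closure D v" and W_C1: "C1_closure (v ` D) W" and v_inj: "inj_on v (closure D)"
  using diffeo by (auto simp: C1_diffeo_def)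

lemma v_continuous: "continuous_on (closure D) v"
  using v_C1 by (simp add: C1_closure_def)

lemma W_v: "x \<in> D \<Longrightarrow> W (v x) = x"
  using the_inv_into_f_f[OF v_inj] closure_subset by blast

lemma open_image: "open (v ` D)"
  using closure_subset[of D]
  by (intro invariance_of_domain open_D) (auto intro: continuous_on_subset[OF v_continuous] inj_on_subset[OF v_inj])

lemma bounded_image: "bounded (v ` D)"
proof -
  have "compact (v ` closure D)" using bounded_D by (intro compact_continuous_image v_continuous) simp
  then show ?thesis by (rule bounded_subset[OF compact_imp_bounded]) (use closure_subset[of D] in auto)
qed

lemma v_derivative: "x \<in> D \<Longrightarrow> (v has_derivative (\<lambda>h. J x *v h)) (at x)"
  by (rule C1_closure_jacobian(1)[OF v_C1])

lemma W_derivative: "y \<in> v ` D \<Longrightarrow> (W has_derivative frechet_derivative W (at y)) (at y)"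
  by (rule C1_closure_has_derivative[OF W_C1])

lemma onorm_W: "y \<in> v ` D \<Longrightarrow> onorm (frechet_derivative W (at y)) \<le> C"
  using onorm_derivative_le_C1_norm[OF W_C1 bounded_image] norm_inv by force

lemma jacobian_upper: "x \<in> D \<Longrightarrow> norm (J x *v h) \<le> C * norm h"
proof -
  assume x: "x \<in> D"
  have eq: "frechet_derivative v (at x) = (\<lambda>h. J x *v h)" using frechet_derivative_at[OF v_derivative[OF x]] by simp
  have "norm (J x *v h) \<le> onorm (\<lambda>h. J x *v h) * norm h"
    by (intro onorm matrix_vector_mul_bounded_linear)
  also have "\<dots> \<le> C * norm h"
    using onorm_derivative_le_C1_norm[OF v_C1 bounded_D x] norm_v unfolding eq by (intro mult_right_mono) auto
  finally show ?thesis .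
qed

text \<open>Differentiating \<open>W (v x) = x\<close> exhibits the derivative of \<open>W\<close>
  as a left inverse of the Jacobian, and its operator norm is at most \<open>C\<close>.\<close>

lemma jacobian_lower: "x \<in> D \<Longrightarrow> norm h \<le> C * norm (J x *v h)"
proof -
  assume x: "x \<in> D"
  let ?K = "frechet_derivative W (at (v x))"
  have K: "(W has_derivative ?K) (at (v x))" using x by (intro W_derivative) auto
  have "((\<lambda>x. W (v x)) has_derivative (\<lambda>h. ?K (J x *v h))) (at x)"
    using diff_chain_at[OF v_derivative[OF x] K] by (simp add: o_def)
  moreover have "((\<lambda>x. W (v x)) has_derivative (\<lambda>h. h)) (at x)"
    by (rule has_derivative_transform_within_open[OF has_derivative_ident open_D x]) (simp add: W_v)
  ultimately have "(\<lambda>h. ?K (J x *v h)) = (\<lambda>h. h)" by (rule has_derivative_unique)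
  then have "norm h = norm (?K (J x *v h))" by metis
  also have "\<dots> \<le> onorm ?K * norm (J x *v h)"
    by (intro onorm has_derivative_bounded_linear[OF K])
  also have "\<dots> \<le> C * norm (J x *v h)" using x by (intro mult_right_mono onorm_W) auto
  finally show ?thesis .
qed

lemma det_upper: "x \<in> D \<Longrightarrow> det (J x) \<le> fact CARD('d) * C ^ CARD('d)"
proof -
  assume x: "x \<in> D"
  have "\<bar>J x $ i $ j\<bar> \<le> C" for i j
  proof -
    have "\<bar>J x $ i $ j\<bar> = \<bar>(J x *v axis j 1) $ i\<bar>" by (simp add: matrix_vector_mul_component inner_axis)
    also have "\<dots> \<le> norm (J x *v axis j 1)" by (rule component_le_norm_cart)
    also have "\<dots> \<le> C" using jacobian_upper[OF x, of "axis j 1"] by simp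
    finally show ?thesis .
  qed
  from abs_det_le[OF this] show ?thesis by simp
qed

text \<open>The entries of the inverse Jacobian are bounded by \<open>C\<close>, so its determinant
  has the same upper bound as that of the Jacobian, and the two determinants are reciprocal.\<close>

lemma det_lower: "x \<in> D \<Longrightarrow> 1 / (fact CARD('d) * C ^ CARD('d)) \<le> det (J x)"
proof -
  assume x: "x \<in> D"
  have inv: "invertible (J x)" using det_pos[OF x] by (simp add: invertible_det_nz)
  let ?K = "matrix_inv (J x)"
  have JK: "J x ** ?K = mat 1" using inv by (rule matrix_inv_works(1))
  have "\<bar>?K $ i $ j\<bar> \<le> C" for i j
  proof -
    have "\<bar>?K $ i $ j\<bar> = \<bar>(?K *v axis j 1) $ i\<bar>" by (simp add: matrix_vector_mul_component inner_axis)
    also have "\<dots> \<le> norm (?K *v axis j 1)" by (rule component_le_norm_cart)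
    also have "\<dots> \<le> C * norm (J x *v (?K *v axis j 1))" by (rule jacobian_lower[OF x])
    also have "\<dots> = C" by (simp add: matrix_vector_mul_assoc JK)
    finally show ?thesis .
  qed
  from abs_det_le[OF this] have K: "\<bar>det ?K\<bar> \<le> fact CARD('d) * C ^ CARD('d)" .
  have "det (J x) * det ?K = 1" using JK by (metis det_I det_mul)
  then have "1 = det (J x) * \<bar>det ?K\<bar>" using det_pos[OF x] by (metis abs_mult abs_of_pos abs_one)
  also have "\<dots> \<le> det (J x) * (fact CARD('d) * C ^ CARD('d))"
    using det_pos[OF x] by (intro mult_left_mono K) auto
  finally show ?thesis using C_pos by (simp add: field_simps)
qed

text \<open>The transposed inverse of the Jacobian, which by the chain rule turns a gradient on the
  reference domain into the gradient on the image.\<close>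

abbreviation S :: "real^'d \<Rightarrow> real^'d \<Rightarrow> real^'d" where "S x \<equiv> cramer_solve (transpose (J x))"

lemma det_transpose_nz: "x \<in> D \<Longrightarrow> det (transpose (J x)) \<noteq> 0"
  using det_pos[of x] by (simp add: det_transpose)

text \<open>Transposition preserves the operator norm, so the bound for the inverse Jacobian carries
  over; the proof is this duality, with \<open>q\<close> the preimage of \<open>p\<close> under the
  Jacobian.\<close>

lemma S_upper: "x \<in> D \<Longrightarrow> norm (S x h) \<le> C * norm h"
proof -
  assume x: "x \<in> D"
  define p where "p = S x h"
  have p: "transpose (J x) *v p = h" unfolding p_def by (rule mult_cramer_solve[OF det_transpose_nz[OF x]])
  define q where "q = cramer_solve (J x) p"
  have q: "J x *v q = p" unfolding q_def using det_pos[OF x] by (intro mult_cramer_solve) simp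
  have "(norm p)\<^sup>2 = p \<bullet> (J x *v q)" by (simp add: q power2_norm_eq_inner)
  also have "\<dots> = h \<bullet> q" using inner_transpose_mult[of q "J x" p] unfolding p by (simp add: inner_commute)
  also have "\<dots> \<le> norm h * norm q" by (rule norm_cauchy_schwarz)
  also have "\<dots> \<le> norm h * (C * norm p)" using jacobian_lower[OF x, of q] by (intro mult_left_mono) (auto simp: q)
  finally have "norm p * norm p \<le> norm p * (C * norm h)" by (simp add: power2_eq_square ac_simps)
  then show ?thesis unfolding p_def[symmetric]
    using C_pos by (cases "norm p = 0") (auto simp: mult_le_cancel_left)
qed

lemma S_lower: "x \<in> D \<Longrightarrow> norm h \<le> C * norm (S x h)"
proof -
  assume x: "x \<in> D"
  define p where "p = S x h"
  have p: "transpose (J x) *v p = h" unfolding p_def by (rule mult_cramer_solve[OF det_transpose_nz[OF x]])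
  have "(norm h)\<^sup>2 = h \<bullet> (transpose (J x) *v p)" by (simp only: p power2_norm_eq_inner)
  also have "\<dots> = (J x *v h) \<bullet> p" by (rule inner_transpose_mult)
  also have "\<dots> \<le> norm (J x *v h) * norm p" by (rule norm_cauchy_schwarz)
  also have "\<dots> \<le> C * norm h * norm p" using jacobian_upper[OF x, of h] by (intro mult_right_mono) auto
  finally have "norm h * norm h \<le> norm h * (C * norm p)" by (simp add: power2_eq_square ac_simps)
  then show ?thesis unfolding p_def[symmetric]
    using C_pos by (cases "norm h = 0") (auto simp: mult_le_cancel_left)
qed

lemma pullback_coeff_inner:
  "x \<in> D \<Longrightarrow> (pullback_coeff v a x *v g) \<bullet> h = a (v x) * det (J x) * (S x g \<bullet> S x h)"
  using det_pos[of x]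
  by (simp add: pullback_coeff_def Let_def scaleR_matrix_vector_assoc[symmetric] matrix_inv_transpose_mult_inner)

lemma J_measurable: "(\<lambda>x. J x $ i $ j) \<in> borel_measurable (lebesgue_on D)"
proof -
  have "continuous_on D (\<lambda>x. J x $ i $ j)" by (intro continuous_intros C1_closure_jacobian(2)[OF v_C1])
  then show ?thesis using open_D by (intro continuous_imp_measurable_on_sets_lebesgue) auto
qed

lemma S_measurable:
  assumes "g \<in> borel_measurable (lebesgue_on D)"
  shows "(\<lambda>x. S x (g x)) \<in> borel_measurable (lebesgue_on D)"
  by (rule borel_measurable_cramer_solve) (auto simp: transpose_def J_measurable assms)

text \<open>Change of variables with the crude constant \<open>C ^ d\<close>, from a Vitali covering of the image by
  balls; the change-of-variables theorem of the library is only available for well-ordered index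
  types.\<close>

definition push :: "(real^'d) measure" where "push = distr (restrict_space lborel D) borel v"

lemma v_measurable: "v \<in> restrict_space lborel D \<rightarrow>\<^sub>M borel"
proof -
  have "v \<in> borel_measurable (restrict_space borel D)"
    using continuous_on_subset[OF v_continuous closure_subset] by (rule borel_measurable_continuous_on_restrict)
  then show ?thesis by (simp add: measurable_def sets_restrict_space space_restrict_space)
qed

lemma emeasure_push: "A \<in> sets borel \<Longrightarrow> emeasure push A = emeasure lborel (v -` A \<inter> D)"
  unfolding push_def
  by (subst emeasure_distr[OF v_measurable])
    (auto simp: space_restrict_space open_D borel_open emeasure_restrict_space)

lemma sets_push [simp, measurable_cong]: "sets push = sets borel"
  by (simp add: push_def)

lemma vimage_eq_W_image: "A \<subseteq> v ` D \<Longrightarrow> v -` A \<inter> D = W ` A"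
  using W_v by (auto simp: image_iff) (metis W_v imageE subsetD)+

lemma vimage_borel: "A \<in> sets borel \<Longrightarrow> v -` A \<inter> D \<in> sets borel"
  using measurable_sets[OF v_measurable, of A] open_D
  by (auto simp: space_restrict_space sets_restrict_space_iff borel_open)

text \<open>The preimage is the image under the differentiable inverse, and differentiable maps in
  equal dimensions preserve null sets.\<close>

lemma negligible_vimage:
  assumes "negligible A" "A \<subseteq> v ` D" shows "negligible (v -` A \<inter> D)"
proof -
  have "W differentiable_on A"
    unfolding differentiable_on_def using W_derivative assms(2)
    by (metis differentiable_at_withinI differentiableI subsetD)
  then have "negligible (W ` A)"
    using assms(1) by (intro negligible_differentiable_image_negligible) auto
  then show ?thesis by (simp add: vimage_eq_W_image[OF assms(2)])
qed

text \<open>A ball is convex, so the bound on the derivative of \<open>W\<close> makes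
  \<open>W\<close> Lipschitz with constant \<open>C\<close> on it; the preimage fits into a ball of
  radius \<open>C * r\<close>.\<close>

lemma push_ball:
  assumes b: "ball x r \<subseteq> v ` D" and r: "0 < r"
  shows "emeasure push (ball x r) \<le> ennreal (C ^ CARD('d)) * emeasure lborel (ball x r)"
proof -
  have "W ` ball x r \<subseteq> cball (W x) (C * r)"
  proof
    fix w assume "w \<in> W ` ball x r"
    then obtain y where y: "y \<in> ball x r" "w = W y" by auto
    have "norm (W y - W x) \<le> C * norm (y - x)"
    proof (rule differentiable_bound[of "ball x r" W "\<lambda>y. frechet_derivative W (at y)"])
      show "(W has_derivative frechet_derivative W (at z)) (at z within ball x r)" if "z \<in> ball x r" for z
        using W_derivative that b by (blast intro: has_derivative_at_withinI)
      show "onorm (frechet_derivative W (at z)) \<le> C" if "z \<in> ball x r" for z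
        using onorm_W that b by blast
    qed (use y r in auto)
    also have "\<dots> \<le> C * r" using y C_pos by (intro mult_left_mono) (auto simp: dist_norm norm_minus_commute)
    finally show "w \<in> cball (W x) (C * r)" using y by (simp add: dist_norm norm_minus_commute)
  qed
  then have "emeasure push (ball x r) \<le> emeasure lborel (cball (W x) (C * r))"
    by (simp add: emeasure_push vimage_eq_W_image[OF b] emeasure_mono)
  also have "\<dots> = ennreal (C ^ CARD('d)) * emeasure lborel (ball x r)"
    using C_pos r by (simp add: emeasure_cball emeasure_ball ennreal_mult[symmetric] power_mult_distrib ac_simps)
  finally show ?thesis .
qed

lemma push_open:
  assumes U: "open U" "U \<subseteq> v ` D"
  shows "emeasure push U \<le> ennreal (C ^ CARD('d)) * emeasure lborel U"
proof -
  let ?K = "{(x, r). 0 < r \<and> ball x r \<subseteq> U}"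
  let ?b = "\<lambda>i. ball (fst i) (snd i) :: (real^'d) set"
  have ex: "\<exists>i. i \<in> ?K \<and> x \<in> ?b i \<and> snd i < d" if xd: "x \<in> U" "0 < d" for x d
  proof -
    obtain e where e: "0 < e" "ball x e \<subseteq> U" using openE[OF U(1) xd(1)] .
    let ?r = "min e (d / 2)"
    have "ball x ?r \<subseteq> ball x e" by (rule subset_ball) simp
    then show ?thesis using e xd by (intro exI[of _ "(x, ?r)"]) auto
  qed
  obtain I where I: "countable I" "I \<subseteq> ?K" "pairwise (\<lambda>i j. disjnt (?b i) (?b j)) I"
    "negligible (U - (\<Union>i\<in>I. ?b i))"
    by (rule Vitali_covering_theorem_balls[of U ?K fst snd]) (erule (1) ex, rule that)
  let ?B = "\<Union>i\<in>I. ?b i"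
  have sub: "?B \<subseteq> U" using I(2) by fastforce
  have disj: "disjoint_family_on ?b I"
    using I(3) by (auto simp: disjoint_family_on_def pairwise_def disjnt_def)
  have B: "?B \<in> sets borel" by (intro borel_open open_UN) auto
  have N: "U - ?B \<in> sets borel" using B U(1) by auto
  \<comment> \<open>The Vitali covering misses only a null set of \<open>U\<close>, and its preimage
    is null as well.\<close>
  have "negligible (v -` (U - ?B) \<inter> D)" by (rule negligible_vimage[OF I(4)]) (use U(2) in auto)
  then have N0: "emeasure push (U - ?B) = 0"
    using vimage_borel[OF N] by (simp add: emeasure_push[OF N] negligible_iff_null_sets null_sets_def)
  have "emeasure push U = emeasure push (?B \<union> (U - ?B))" using sub by (intro arg_cong[where f="emeasure push"]) auto
  also have "\<dots> \<le> emeasure push ?B + emeasure push (U - ?B)"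
    by (rule emeasure_subadditive) (use B N in auto)
  also have "\<dots> = (\<integral>\<^sup>+i. emeasure push (?b i) \<partial>count_space I)"
    unfolding N0 by (simp add: emeasure_UN_countable[OF _ I(1) disj])
  also have "\<dots> \<le> (\<integral>\<^sup>+i. ennreal (C ^ CARD('d)) * emeasure lborel (?b i) \<partial>count_space I)"
    using I(2) U(2) by (intro nn_integral_mono push_ball) (auto, fastforce+)
  also have "\<dots> = ennreal (C ^ CARD('d)) * emeasure lborel ?B"
    by (simp add: nn_integral_cmult emeasure_UN_countable[OF _ I(1) disj])
  also have "\<dots> \<le> ennreal (C ^ CARD('d)) * emeasure lborel U"
    using sub U(1) by (intro mult_left_mono emeasure_mono) auto
  finally show ?thesis .
qed

text \<open>Outer regularity reduces Borel sets to open ones. Intersecting the open set with the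
  image brings it within reach of \<open>push_open\<close> without changing its preimage.\<close>

lemma push_le:
  assumes A: "A \<in> sets borel"
  shows "emeasure push A \<le> ennreal (C ^ CARD('d)) * emeasure lborel A"
proof -
  let ?E = "v ` D"
  have E: "?E \<in> sets borel" using open_image by simp
  have bound: "emeasure push A \<le> ennreal (C ^ CARD('d)) * (emeasure lborel A + ennreal e)" if e: "0 < e" for e
  proof -
    obtain U where U: "open U" "A \<subseteq> U" "emeasure lborel (U - A) \<le> e"
      using outer_regular_lborel_le[OF A e] by blast
    have "v -` A \<inter> D \<subseteq> v -` (U \<inter> ?E) \<inter> D" using U(2) by auto
    moreover have "v -` (U \<inter> ?E) \<inter> D \<in> sets borel" using U(1) E by (intro vimage_borel) auto
    ultimately have "emeasure push A \<le> emeasure push (U \<inter> ?E)"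
      using U(1) E by (simp add: emeasure_push A emeasure_mono)
    also have "\<dots> \<le> ennreal (C ^ CARD('d)) * emeasure lborel (U \<inter> ?E)"
      by (rule push_open) (use U(1) open_image in auto)
    also have "\<dots> \<le> ennreal (C ^ CARD('d)) * (emeasure lborel A + emeasure lborel (U - A))"
    proof (rule mult_left_mono)
      have "emeasure lborel (U \<inter> ?E) \<le> emeasure lborel (A \<union> (U - A))"
        using U A by (intro emeasure_mono) auto
      also have "\<dots> \<le> emeasure lborel A + emeasure lborel (U - A)"
        using U A by (intro emeasure_subadditive) auto
      finally show "emeasure lborel (U \<inter> ?E) \<le> emeasure lborel A + emeasure lborel (U - A)" .
    qed simp
    also have "\<dots> \<le> ennreal (C ^ CARD('d)) * (emeasure lborel A + ennreal e)"
      using U(3) by (intro mult_left_mono add_left_mono) auto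
    finally show ?thesis .
  qed
  show ?thesis
  proof (rule ennreal_le_epsilon)
    fix e :: real assume e: "0 < e"
    have "emeasure push A \<le> ennreal (C ^ CARD('d)) * (emeasure lborel A + ennreal (e / C ^ CARD('d)))"
      by (rule bound) (use e C_pos in simp)
    also have "\<dots> = ennreal (C ^ CARD('d)) * emeasure lborel A + ennreal e"
      using C_pos e by (simp add: distrib_left ennreal_mult[symmetric])
    finally show "emeasure push A \<le> ennreal (C ^ CARD('d)) * emeasure lborel A + ennreal e" .
  qed
qed

lemma nn_integral_push_le:
  fixes g :: "real^'d \<Rightarrow> ennreal"
  assumes [measurable]: "g \<in> borel_measurable borel"
  shows "(\<integral>\<^sup>+x. g (v x) \<partial>restrict_space lborel D) \<le> ennreal (C ^ CARD('d)) * (\<integral>\<^sup>+y. g y \<partial>lborel)"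
proof -
  have "push \<le> scale_measure (ennreal (C ^ CARD('d))) lborel"
    using push_le by (subst le_measure) auto
  then have "nn_integral push g \<le> nn_integral (scale_measure (ennreal (C ^ CARD('d))) lborel) g"
    by (intro nn_integral_mono_measure) auto
  then show ?thesis
    unfolding push_def by (simp add: nn_integral_distr v_measurable nn_integral_scale_measure)
qed

end

lemma borel_measurable_lebesgue_on_AE:
  fixes f g :: "'a::euclidean_space \<Rightarrow> real"
  assumes D: "D \<in> sets lebesgue" and f: "f \<in> borel_measurable (lebesgue_on D)" and ae: "AE x in lebesgue_on D. f x = g x"
  shows "g \<in> borel_measurable (lebesgue_on D)"
proof -
  have "(\<lambda>x. indicator D x *\<^sub>R f x) \<in> borel_measurable lebesgue"
    using f D by (subst (asm) borel_measurable_restrict_space_iff) auto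
  moreover have "AE x in lebesgue. indicator D x *\<^sub>R f x = indicator D x *\<^sub>R g x"
    using ae D by (simp add: AE_restrict_space_iff) (auto elim!: eventually_mono simp: indicator_def)
  ultimately have "(\<lambda>x. indicator D x *\<^sub>R g x) \<in> borel_measurable lebesgue"
    by (rule borel_measurable_AE)
  then show ?thesis using D by (subst borel_measurable_restrict_space_iff) auto
qed

section \<open>Forms and loads pulled back to the reference domain\<close>

context diffeo_domain
begin

lemma D_lebesgue: "D \<in> sets lebesgue"
  using open_D by simp

text \<open>Makes the composition with \<open>v\<close> of data known only up to null sets well
  defined almost everywhere, and transports their essential bounds.\<close>

lemma AE_pullback:
  assumes "AE y in lebesgue_on (v ` D). P y"
  shows "AE x in lebesgue_on D. P (v x)"
proof -
  have "AE y in lebesgue. y \<in> v ` D \<longrightarrow> P y"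
    using assms open_image by (simp add: AE_restrict_space_iff)
  then obtain N where N: "N \<in> null_sets lebesgue" "{y. \<not> (y \<in> v ` D \<longrightarrow> P y)} \<subseteq> N"
    by (auto simp: eventually_ae_filter)
  let ?A = "{y. \<not> (y \<in> v ` D \<longrightarrow> P y)}"
  have "negligible ?A" using N by (meson negligible_iff_null_sets negligible_subset)
  then have "negligible (v -` ?A \<inter> D)" by (rule negligible_vimage) auto
  then have "AE x in lebesgue. x \<notin> v -` ?A \<inter> D" by (intro AE_not_in) (simp add: negligible_iff_null_sets)
  then have "AE x in lebesgue. x \<in> D \<longrightarrow> P (v x)" by (auto elim!: eventually_mono)
  then show ?thesis using D_lebesgue by (simp add: AE_restrict_space_iff)
qed

lemma comp_v_measurable:
  assumes g: "g \<in> borel_measurable borel"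
  shows "(\<lambda>x. g (v x)) \<in> borel_measurable (lebesgue_on D)"
proof -
  have "continuous_on D v" using v_continuous closure_subset by (rule continuous_on_subset)
  then have "v \<in> borel_measurable (lebesgue_on D)"
    using D_lebesgue by (rule continuous_imp_measurable_on_sets_lebesgue)
  from measurable_compose[OF this g] show ?thesis .
qed

lemma det_J_measurable: "(\<lambda>x. det (J x)) \<in> borel_measurable (lebesgue_on D)"
  by (intro borel_measurable_det J_measurable)

lemma square_integrable_S:
  assumes G: "square_integrable (lebesgue_on D) G"
  shows "square_integrable (lebesgue_on D) (\<lambda>x. S x (G x))"
    and "seminorm2 (lebesgue_on D) G \<le> C * seminorm2 (lebesgue_on D) (\<lambda>x. S x (G x))"
    and "seminorm2 (lebesgue_on D) (\<lambda>x. S x (G x)) \<le> C * seminorm2 (lebesgue_on D) G"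
proof -
  have m: "(\<lambda>x. S x (G x)) \<in> borel_measurable (lebesgue_on D)"
    using G by (intro S_measurable) (simp add: square_integrable_def)
  have le: "(norm (S x (G x)))\<^sup>2 \<le> C\<^sup>2 * (norm (G x))\<^sup>2" "(norm (G x))\<^sup>2 \<le> C\<^sup>2 * (norm (S x (G x)))\<^sup>2" if "x \<in> D" for x
    using power_mono[OF S_upper[OF that, of "G x"], of 2] power_mono[OF S_lower[OF that, of "G x"], of 2]
    by (auto simp: power_mult_distrib)
  have i: "integrable (lebesgue_on D) (\<lambda>x. C\<^sup>2 * (norm (G x))\<^sup>2)"
    using G by (simp add: square_integrable_def)
  have "integrable (lebesgue_on D) (\<lambda>x. (norm (S x (G x)))\<^sup>2)"
    by (rule Bochner_Integration.integrable_bound[OF i]) (use m le in \<open>auto intro!: AE_I2\<close>)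
  then show sq: "square_integrable (lebesgue_on D) (\<lambda>x. S x (G x))"
    using m by (simp add: square_integrable_def)
  show "seminorm2 (lebesgue_on D) G \<le> C * seminorm2 (lebesgue_on D) (\<lambda>x. S x (G x))"
  proof (rule power2_le_imp_le)
    have "(seminorm2 (lebesgue_on D) G)\<^sup>2 \<le> (LINT x|lebesgue_on D. C\<^sup>2 * (norm (S x (G x)))\<^sup>2)"
      unfolding seminorm2_square using G sq le(2) by (intro integral_mono) (auto simp: square_integrable_def)
    then show "(seminorm2 (lebesgue_on D) G)\<^sup>2 \<le> (C * seminorm2 (lebesgue_on D) (\<lambda>x. S x (G x)))\<^sup>2"
      by (simp add: seminorm2_square power_mult_distrib)
  qed (use C_pos in simp)
  show "seminorm2 (lebesgue_on D) (\<lambda>x. S x (G x)) \<le> C * seminorm2 (lebesgue_on D) G"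
  proof (rule power2_le_imp_le)
    have "(seminorm2 (lebesgue_on D) (\<lambda>x. S x (G x)))\<^sup>2 \<le> (LINT x|lebesgue_on D. C\<^sup>2 * (norm (G x))\<^sup>2)"
      unfolding seminorm2_square using G sq le(1) by (intro integral_mono) (auto simp: square_integrable_def)
    then show "(seminorm2 (lebesgue_on D) (\<lambda>x. S x (G x)))\<^sup>2 \<le> (C * seminorm2 (lebesgue_on D) G)\<^sup>2"
      by (simp add: seminorm2_square power_mult_distrib)
  qed (use C_pos in simp)
qed

text \<open>With the weight \<open>a (v x) * det (J x)\<close> this is the bilinear form of
  \<open>pullback_coeff v a\<close>. Keeping the weight as the only variable ingredient makes the
  form visibly linear in it.\<close>

definition wform :: "(real^'d \<Rightarrow> real) \<Rightarrow> (real^'d \<Rightarrow> real) \<Rightarrow> (real^'d \<Rightarrow> real) \<Rightarrow> real" where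
  "wform m u w = (LINT x|lebesgue_on D. m x * (S x (wgrad D u x) \<bullet> S x (wgrad D w x)))"

lemma square_integrable_weight:
  assumes G: "square_integrable M G" and m: "m \<in> borel_measurable M" and b: "AE x in M. \<bar>m x\<bar> \<le> B"
  shows "square_integrable M (\<lambda>x. m x *\<^sub>R G x)" and "0 \<le> B \<Longrightarrow> seminorm2 M (\<lambda>x. m x *\<^sub>R G x) \<le> B * seminorm2 M G"
proof -
  have mm: "(\<lambda>x. m x *\<^sub>R G x) \<in> borel_measurable M"
    using G m by (auto simp: square_integrable_def)
  have i: "integrable M (\<lambda>x. B\<^sup>2 * (norm (G x))\<^sup>2)" using G by (simp add: square_integrable_def)
  have le: "AE x in M. (norm (m x *\<^sub>R G x))\<^sup>2 \<le> B\<^sup>2 * (norm (G x))\<^sup>2"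
    using b
  proof eventually_elim
    case (elim x)
    have "(\<bar>m x\<bar>)\<^sup>2 \<le> B\<^sup>2" using elim by (intro power_mono) auto
    then show ?case by (simp add: power_mult_distrib mult_right_mono)
  qed
  have "integrable M (\<lambda>x. (norm (m x *\<^sub>R G x))\<^sup>2)"
  proof (rule Bochner_Integration.integrable_bound[OF i])
    show "(\<lambda>x. (norm (m x *\<^sub>R G x))\<^sup>2) \<in> borel_measurable M" by (intro borel_measurable_power measurable_compose[OF mm borel_measurable_norm])
    show "AE x in M. norm ((norm (m x *\<^sub>R G x))\<^sup>2) \<le> norm (B\<^sup>2 * (norm (G x))\<^sup>2)"
      using le by eventually_elim simp
  qed
  then show sq: "square_integrable M (\<lambda>x. m x *\<^sub>R G x)" using mm by (simp add: square_integrable_def)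
  assume "0 \<le> B"
  show "seminorm2 M (\<lambda>x. m x *\<^sub>R G x) \<le> B * seminorm2 M G"
  proof (rule power2_le_imp_le)
    have "(seminorm2 M (\<lambda>x. m x *\<^sub>R G x))\<^sup>2 \<le> (LINT x|M. B\<^sup>2 * (norm (G x))\<^sup>2)"
      unfolding seminorm2_square using sq i le by (intro integral_mono_AE) (auto simp: square_integrable_def)
    then show "(seminorm2 M (\<lambda>x. m x *\<^sub>R G x))\<^sup>2 \<le> (B * seminorm2 M G)\<^sup>2"
      by (simp add: seminorm2_square power_mult_distrib)
  qed (use \<open>0 \<le> B\<close> in simp)
qed

definition admissible_weight :: "(real^'d \<Rightarrow> real) \<Rightarrow> bool" where
  "admissible_weight m \<longleftrightarrow> m \<in> borel_measurable (lebesgue_on D) \<and> (\<exists>B. AE x in lebesgue_on D. \<bar>m x\<bar> \<le> B)"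

lemma wform_integrable:
  assumes m: "admissible_weight m" and u: "H1 D u" and w: "H1 D w"
  shows "integrable (lebesgue_on D) (\<lambda>x. m x * (S x (wgrad D u x) \<bullet> S x (wgrad D w x)))"
proof -
  obtain B where B: "m \<in> borel_measurable (lebesgue_on D)" "AE x in lebesgue_on D. \<bar>m x\<bar> \<le> B"
    using m by (auto simp: admissible_weight_def)
  have "square_integrable (lebesgue_on D) (\<lambda>x. m x *\<^sub>R S x (wgrad D u x))"
    by (intro square_integrable_weight(1)[OF _ B] square_integrable_S square_integrable_wgrad u)
  from square_integrable_inner[OF this square_integrable_S(1)[OF square_integrable_wgrad[OF w]]]
  show ?thesis by simp
qed

lemma wform_bound:
  assumes m: "m \<in> borel_measurable (lebesgue_on D)" "AE x in lebesgue_on D. \<bar>m x\<bar> \<le> B" and B: "0 \<le> B"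
    and u: "H1 D u" and w: "H1 D w"
  shows "\<bar>wform m u w\<bar> \<le> B * C\<^sup>2 * grad_norm D u * grad_norm D w"
proof -
  let ?M = "lebesgue_on D"
  note gu = square_integrable_wgrad[OF u] and gw = square_integrable_wgrad[OF w]
  note Su = square_integrable_S[OF gu] and Sw = square_integrable_S[OF gw]
  note mSu = square_integrable_weight[OF Su(1) m]
  have "\<bar>wform m u w\<bar> \<le> seminorm2 ?M (\<lambda>x. m x *\<^sub>R S x (wgrad D u x)) * seminorm2 ?M (\<lambda>x. S x (wgrad D w x))"
    using Cauchy_Schwarz_integral[OF mSu(1) Sw(1)] by (simp add: wform_def)
  also have "\<dots> \<le> (B * (C * grad_norm D u)) * (C * grad_norm D w)"
    using mSu(2)[OF B] Su(3) Sw(3) B C_pos unfolding grad_norm_def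
    by (intro mult_mono order_trans[OF mSu(2)[OF B]] mult_left_mono) auto
  finally show ?thesis by (simp add: power2_eq_square ac_simps)
qed

lemma wform_coercive:
  assumes m: "admissible_weight m" "AE x in lebesgue_on D. b \<le> m x" and b: "0 \<le> b" and u: "H1 D u"
  shows "b / C\<^sup>2 * (grad_norm D u)\<^sup>2 \<le> wform m u u"
proof -
  let ?M = "lebesgue_on D"
  note Su = square_integrable_S[OF square_integrable_wgrad[OF u]]
  have "(grad_norm D u)\<^sup>2 \<le> C\<^sup>2 * (seminorm2 ?M (\<lambda>x. S x (wgrad D u x)))\<^sup>2"
    using power_mono[OF Su(2), of 2] by (simp add: grad_norm_def power_mult_distrib)
  then have "b / C\<^sup>2 * (grad_norm D u)\<^sup>2 \<le> b * (seminorm2 ?M (\<lambda>x. S x (wgrad D u x)))\<^sup>2"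
    using b C_pos by (simp add: field_simps mult_left_mono)
  also have "\<dots> = (LINT x|?M. b * (norm (S x (wgrad D u x)))\<^sup>2)" by (simp add: seminorm2_square)
  also have "\<dots> \<le> wform m u u"
    unfolding wform_def
  proof (rule integral_mono_AE)
    show "integrable ?M (\<lambda>x. b * (norm (S x (wgrad D u x)))\<^sup>2)" using Su(1) by (simp add: square_integrable_def)
    show "integrable ?M (\<lambda>x. m x * (S x (wgrad D u x) \<bullet> S x (wgrad D u x)))" by (rule wform_integrable[OF m(1) u u])
    show "AE x in ?M. b * (norm (S x (wgrad D u x)))\<^sup>2 \<le> m x * (S x (wgrad D u x) \<bullet> S x (wgrad D u x))"
      using m(2) by eventually_elim (simp add: power2_norm_eq_inner mult_right_mono)
  qed
  finally show ?thesis .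
qed

lemma wform_symmetric_bilinear:
  assumes m: "admissible_weight m"
  shows "symmetric_bilinear_on (H10 D) (wform m)"
  unfolding symmetric_bilinear_on_def linear_on_def
proof (intro conjI ballI allI)
  fix u w z :: "real^'d \<Rightarrow> real" and c :: real
  assume u: "u \<in> H10 D" and w: "w \<in> H10 D"
  note DD = open_D bounded_D
  show "wform m u w = wform m w u" by (simp add: wform_def inner_commute)
  assume z: "z \<in> H10 D"
  have H: "H1 D u" "H1 D w" "H1 D z" using u w z by (auto intro: H10_imp_H1)
  let ?M = "lebesgue_on D"
  let ?i = "\<lambda>u. \<lambda>x. m x * (S x (wgrad D u x) \<bullet> S x (wgrad D z x))"
  have "wform m (\<lambda>x. u x + c * w x) z = (LINT x|?M. ?i u x + c * ?i w x)"
    unfolding wform_def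
  proof (rule integral_cong_AE)
    show "?i (\<lambda>x. u x + c * w x) \<in> borel_measurable ?M"
      by (intro borel_measurable_integrable wform_integrable m H1_add_scale[OF DD] H)
    show "(\<lambda>x. ?i u x + c * ?i w x) \<in> borel_measurable ?M"
      by (intro borel_measurable_integrable Bochner_Integration.integrable_add integrable_mult_right wform_integrable m H)
    \<comment> \<open>Linearity of \<open>S x\<close> needs an invertible Jacobian, which is known
      only inside \<open>D\<close>.\<close>
    have "AE x in ?M. x \<in> D" using D_lebesgue by (simp add: AE_restrict_space_iff)
    then show "AE x in ?M. ?i (\<lambda>x. u x + c * w x) x = ?i u x + c * ?i w x"
      using wgrad_add_scale[OF DD H(1,2), of c]
    proof eventually_elim
      case (elim x)
      show ?case
        unfolding elim(2) cramer_solve_add_scaleR[OF det_transpose_nz[OF elim(1)]] by (simp add: inner_simps algebra_simps)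
    qed
  qed
  also have "\<dots> = wform m u z + c * wform m w z"
    using wform_integrable[OF m H(1,3)] wform_integrable[OF m H(2,3)] by (simp add: wform_def)
  finally show "wform m (\<lambda>x. u x + c * w x) z = wform m u z + c * wform m w z" .
qed

text \<open>Transfers the finite expansion of \<open>a_r\<close> to the form, so that the
  first-order term becomes a linear combination of the parameters in \<open>y\<close>.\<close>

lemma wform_weight_sum:
  assumes m: "\<And>k. k \<in> I \<Longrightarrow> admissible_weight (m k)" and u: "H1 D u" and w: "H1 D w"
  shows "wform (\<lambda>x. \<Sum>k\<in>I. c k * m k x) u w = (\<Sum>k\<in>I. c k * wform (m k) u w)"
proof -
  have "wform (\<lambda>x. \<Sum>k\<in>I. c k * m k x) u w =
      (LINT x|lebesgue_on D. (\<Sum>k\<in>I. c k * (m k x * (S x (wgrad D u x) \<bullet> S x (wgrad D w x)))))"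
    by (simp add: wform_def sum_distrib_right mult.assoc)
  also have "\<dots> = (\<Sum>k\<in>I. c k * wform (m k) u w)"
    unfolding wform_def using wform_integrable[OF m u w]
    by (subst Bochner_Integration.integral_sum) auto
  finally show ?thesis .
qed

lemma admissible_weight_pullback:
  assumes a: "(\<lambda>x. a (v x)) \<in> borel_measurable (lebesgue_on D)" "AE x in lebesgue_on D. \<bar>a (v x)\<bar> \<le> b" and b: "0 \<le> b"
  shows "admissible_weight (\<lambda>x. a (v x) * det (J x))"
    and "AE x in lebesgue_on D. \<bar>a (v x) * det (J x)\<bar> \<le> b * (fact CARD('d) * C ^ CARD('d))"
proof -
  have "AE x in lebesgue_on D. x \<in> D" using D_lebesgue by (simp add: AE_restrict_space_iff)
  then show *: "AE x in lebesgue_on D. \<bar>a (v x) * det (J x)\<bar> \<le> b * (fact CARD('d) * C ^ CARD('d))"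
    using a(2)
  proof eventually_elim
    case (elim x)
    then show ?case
      using det_upper[OF elim(1)] det_pos[OF elim(1)] b unfolding abs_mult by (intro mult_mono) auto
  qed
  show "admissible_weight (\<lambda>x. a (v x) * det (J x))"
    unfolding admissible_weight_def using * by (intro conjI exI borel_measurable_times a(1) det_J_measurable)
qed

lemma pullback_coeff_form:
  assumes a: "admissible_weight (\<lambda>x. a (v x) * det (J x))" and b: "admissible_weight (\<lambda>x. b (v x) * det (J x))"
    and u: "H1 D u" and w: "H1 D w"
  shows "(LINT x|lebesgue_on D. ((pullback_coeff v a x + c *\<^sub>R pullback_coeff v b x) *v wgrad D u x) \<bullet> wgrad D w x) =
    wform (\<lambda>x. a (v x) * det (J x)) u w + c * wform (\<lambda>x. b (v x) * det (J x)) u w"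
proof -
  have "(LINT x|lebesgue_on D. ((pullback_coeff v a x + c *\<^sub>R pullback_coeff v b x) *v wgrad D u x) \<bullet> wgrad D w x) =
    (LINT x|lebesgue_on D. a (v x) * det (J x) * (S x (wgrad D u x) \<bullet> S x (wgrad D w x)) +
      c * (b (v x) * det (J x) * (S x (wgrad D u x) \<bullet> S x (wgrad D w x))))"
  proof (rule Bochner_Integration.integral_cong[OF refl])
    fix x assume "x \<in> space (lebesgue_on D)"
    then have x: "x \<in> D" by simp
    show "((pullback_coeff v a x + c *\<^sub>R pullback_coeff v b x) *v wgrad D u x) \<bullet> wgrad D w x =
      a (v x) * det (J x) * (S x (wgrad D u x) \<bullet> S x (wgrad D w x)) +
      c * (b (v x) * det (J x) * (S x (wgrad D u x) \<bullet> S x (wgrad D w x)))"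
      by (simp only: matrix_vector_mult_add_rdistrib scaleR_matrix_vector_assoc[symmetric] inner_add_left inner_scaleR_left
          pullback_coeff_inner[OF x])
  qed
  also have "\<dots> = wform (\<lambda>x. a (v x) * det (J x)) u w + c * wform (\<lambda>x. b (v x) * det (J x)) u w"
    using wform_integrable[OF a u w] wform_integrable[OF b u w] by (simp add: wform_def)
  finally show ?thesis .
qed

text \<open>The change-of-variables estimate bounds the squared L2 norm of the composition by
  \<open>C ^ CARD('d)\<close> times that of \<open>g\<close>; multiplication by the determinant
  costs its pointwise bound. The Borel version \<open>g\<close> is used because composition
  preserves Borel, not Lebesgue, measurability in general.\<close>

lemma pullback_load_square_integrable:
  assumes g: "g \<in> borel_measurable borel" "integrable lborel (\<lambda>y. (g y)\<^sup>2)"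
    and ae: "AE x in lebesgue_on D. f (v x) = g (v x)"
  shows "square_integrable (lebesgue_on D) (pullback_load v f)"
    and "seminorm2 (lebesgue_on D) (pullback_load v f) \<le>
      fact CARD('d) * C ^ CARD('d) * sqrt (C ^ CARD('d) * (LINT y|lborel. (g y)\<^sup>2))"
proof -
  let ?M = "lebesgue_on D"
  have gv: "(\<lambda>x. g (v x)) \<in> borel_measurable ?M" by (rule comp_v_measurable[OF g(1)])
  have nn: "(\<integral>\<^sup>+x. ennreal ((g (v x))\<^sup>2) \<partial>?M) \<le> ennreal (C ^ CARD('d) * (LINT y|lborel. (g y)\<^sup>2))"
  proof -
    have m: "(\<lambda>x. g (v x)) \<in> borel_measurable (restrict_space lborel D)"
      by (rule measurable_compose[OF v_measurable g(1)])
    then have m': "(\<lambda>x. ennreal ((g (v x))\<^sup>2) * indicator D x) \<in> borel_measurable lborel"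
      using open_D by (subst borel_measurable_restrict_space_iff_ennreal[symmetric]) auto
    have "(\<integral>\<^sup>+x. ennreal ((g (v x))\<^sup>2) \<partial>?M) = (\<integral>\<^sup>+x. ennreal ((g (v x))\<^sup>2) * indicator D x \<partial>lebesgue)"
      using D_lebesgue by (simp add: nn_integral_restrict_space)
    also have "\<dots> = (\<integral>\<^sup>+x. ennreal ((g (v x))\<^sup>2) * indicator D x \<partial>lborel)"
      by (rule nn_integral_completion)
    also have "\<dots> = (\<integral>\<^sup>+x. ennreal ((g (v x))\<^sup>2) \<partial>restrict_space lborel D)"
      using open_D by (simp add: nn_integral_restrict_space borel_open)
    also have "\<dots> \<le> ennreal (C ^ CARD('d)) * (\<integral>\<^sup>+y. ennreal ((g y)\<^sup>2) \<partial>lborel)"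
      using g(1) by (intro nn_integral_push_le) measurable
    also have "\<dots> = ennreal (C ^ CARD('d) * (LINT y|lborel. (g y)\<^sup>2))"
      using g(2) C_pos by (simp add: nn_integral_eq_integral ennreal_mult[symmetric])
    finally show ?thesis .
  qed
  have sq: "square_integrable ?M (\<lambda>x. g (v x))"
    unfolding square_integrable_def using gv nn
    by (auto intro!: integrableI_bounded order_le_less_trans[OF nn])
  have "ennreal (LINT x|?M. (g (v x))\<^sup>2) \<le> ennreal (C ^ CARD('d) * (LINT y|lborel. (g y)\<^sup>2))"
    using sq nn by (subst nn_integral_eq_integral[symmetric]) (auto simp: square_integrable_def)
  then have "(LINT x|?M. (g (v x))\<^sup>2) \<le> C ^ CARD('d) * (LINT y|lborel. (g y)\<^sup>2)"
    using C_pos by (subst (asm) ennreal_le_iff) auto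
  then have s1: "seminorm2 ?M (\<lambda>x. g (v x)) \<le> sqrt (C ^ CARD('d) * (LINT y|lborel. (g y)\<^sup>2))"
    by (simp add: seminorm2_def)
  have x: "AE x in ?M. x \<in> D" using D_lebesgue by (simp add: AE_restrict_space_iff)
  have dU: "AE x in ?M. \<bar>det (J x)\<bar> \<le> fact CARD('d) * C ^ CARD('d)"
    using x by eventually_elim (use det_upper det_pos in \<open>force simp: abs_of_pos\<close>)
  note w = square_integrable_weight[OF sq det_J_measurable dU]
  have ae': "AE x in ?M. det (J x) *\<^sub>R g (v x) = pullback_load v f x"
    using ae by eventually_elim (simp add: pullback_load_def)
  have pm: "pullback_load v f \<in> borel_measurable ?M"
    by (rule borel_measurable_lebesgue_on_AE[OF D_lebesgue _ ae']) (use w(1) in \<open>simp add: square_integrable_def\<close>)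
  have "integrable ?M (\<lambda>x. (norm (pullback_load v f x))\<^sup>2)"
    by (rule integrable_cong_AE_imp[of _ "\<lambda>x. (norm (det (J x) *\<^sub>R g (v x)))\<^sup>2"])
      (use w(1) pm ae' in \<open>auto simp: square_integrable_def elim!: eventually_mono\<close>)
  then show sp: "square_integrable ?M (pullback_load v f)" using pm by (simp add: square_integrable_def)
  have "seminorm2 ?M (pullback_load v f) = seminorm2 ?M (\<lambda>x. det (J x) *\<^sub>R g (v x))"
    by (rule seminorm2_cong_AE[OF _ sp w(1)]) (use ae' in \<open>auto elim!: eventually_mono\<close>)
  also have "\<dots> \<le> fact CARD('d) * C ^ CARD('d) * seminorm2 ?M (\<lambda>x. g (v x))" by (rule w(2)) (use C_pos in simp)
  also have "\<dots> \<le> fact CARD('d) * C ^ CARD('d) * sqrt (C ^ CARD('d) * (LINT y|lborel. (g y)\<^sup>2))"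
    using C_pos by (intro mult_left_mono s1) auto
  finally show "seminorm2 ?M (pullback_load v f) \<le>
      fact CARD('d) * C ^ CARD('d) * sqrt (C ^ CARD('d) * (LINT y|lborel. (g y)\<^sup>2))" .
qed

end

section \<open>Measurable dependence on the parameters\<close>

text \<open>Near each point the function is a pointwise limit of polynomials. Countably many such
  neighbourhoods cover \<open>U\<close> by Lindelof's theorem, and Borel pieces over a countable
  cover glue together.\<close>

lemma real_analytic_on_borel_measurable:
  fixes g :: "real^'d \<Rightarrow> real"
  assumes U: "open U" and g: "real_analytic_on U g"
  shows "(\<lambda>x. if x \<in> U then g x else 0) \<in> borel_measurable borel"
proof -
  let ?g = "\<lambda>x. if x \<in> U then g x else 0"
  have "\<exists>P. open P \<and> p \<in> P \<and> P \<subseteq> U \<and> ?g \<in> borel_measurable (restrict_space borel P)" if p: "p \<in> U" for p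
  proof -
    obtain c r where r: "r > 0" and sum: "\<And>x. (\<forall>i. \<bar>x $ i - p $ i\<bar> < r) \<Longrightarrow>
        ((\<lambda>\<alpha>::'d \<Rightarrow> nat. c \<alpha> * (\<Prod>i\<in>UNIV. (x $ i - p $ i) ^ \<alpha> i)) has_sum g x) UNIV"
      using g p unfolding real_analytic_on_def by blast
    \<comment> \<open>Multi-indices are coded as natural numbers, with 0 at numbers that are no
      code, to turn the unordered sum into a series.\<close>
    define T where "T n x = (if n \<in> range (to_nat :: ('d \<Rightarrow> nat) \<Rightarrow> nat)
        then c (from_nat n) * (\<Prod>i\<in>UNIV. (x $ i - p $ i) ^ (from_nat n :: 'd \<Rightarrow> nat) i) else 0)" for n and x :: "real^'d"
    let ?P = "U \<inter> box (p - r *\<^sub>R 1) (p + r *\<^sub>R 1)"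
    have g_eq: "?g x = (\<Sum>n. T n x)" if "x \<in> ?P" for x
    proof -
      have "\<forall>i. \<bar>x $ i - p $ i\<bar> < r" using that by (auto simp: mem_box_cart abs_less_iff algebra_simps)
      then have "((\<lambda>n. T n x) \<circ> (to_nat :: ('d \<Rightarrow> nat) \<Rightarrow> nat) has_sum g x) UNIV"
        using sum[of x] by (simp add: T_def o_def)
      then have "((\<lambda>n. T n x) has_sum g x) (range (to_nat :: ('d \<Rightarrow> nat) \<Rightarrow> nat))"
        by (subst has_sum_reindex) auto
      moreover have "((\<lambda>n. T n x) has_sum g x) (range (to_nat :: ('d \<Rightarrow> nat) \<Rightarrow> nat)) \<longleftrightarrow>
          ((\<lambda>n. T n x) has_sum g x) UNIV"
        by (rule has_sum_cong_neutral) (auto simp: T_def)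
      ultimately have "((\<lambda>n. T n x) has_sum g x) UNIV" by simp
      then have "(\<lambda>n. T n x) sums g x" by (rule has_sum_imp_sums)
      then show ?thesis using that by (simp add: sums_iff)
    qed
    have "(\<lambda>x. T n x) \<in> borel_measurable borel" for n unfolding T_def by measurable
    then have "(\<lambda>x. \<Sum>n. T n x) \<in> borel_measurable (restrict_space borel ?P)"
      by (intro measurable_restrict_space1 borel_measurable_suminf)
    then have "?g \<in> borel_measurable (restrict_space borel ?P)"
      by (rule measurable_cong[THEN iffD1, rotated]) (use g_eq in \<open>auto simp: space_restrict_space\<close>)
    moreover have "p \<in> ?P" using p r by (auto simp: mem_box_cart)
    ultimately show ?thesis using U by (intro exI[of _ ?P]) auto
  qed
  then have "\<forall>p\<in>U. \<exists>P. open P \<and> p \<in> P \<and> P \<subseteq> U \<and> ?g \<in> borel_measurable (restrict_space borel P)" by blast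
  from bchoice[OF this] obtain P where P:
    "\<And>p. p \<in> U \<Longrightarrow> open (P p) \<and> p \<in> P p \<and> P p \<subseteq> U \<and> ?g \<in> borel_measurable (restrict_space borel (P p))"
    by auto
  obtain F where F: "F \<subseteq> P ` U" "countable F" "\<Union>F = \<Union>(P ` U)"
    by (rule Lindelof[of "P ` U"]) (use P in auto)
  have UF: "\<Union>F = U" using F(3) P by blast
  show ?thesis
  proof (rule measurable_piecewise_restrict[of "insert (- U) F"])
    show "countable (insert (- U) F)" using F(2) by simp
    show "X \<inter> space borel \<in> sets borel" if "X \<in> insert (- U) F" for X using that F(1) P U by auto
    show "space borel \<subseteq> \<Union>(insert (- U) F)" using UF by auto
    fix X assume "X \<in> insert (- U) F"
    then show "?g \<in> borel_measurable (restrict_space borel X)"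
    proof
      assume X: "X = - U"
      show ?thesis
        by (rule measurable_cong[THEN iffD1, of _ "\<lambda>x. 0"]) (auto simp: X space_restrict_space)
    qed (use F(1) P in auto)
  qed
qed

lemma borel_representative:
  fixes g :: "'a::euclidean_space \<Rightarrow> real"
  assumes H: "H \<in> sets borel" and g: "g \<in> borel_measurable (lebesgue_on H)"
  obtains g' where "g' \<in> borel_measurable borel" "AE x in lebesgue_on H. g x = g' x" "\<And>x. x \<notin> H \<Longrightarrow> g' x = 0"
proof -
  have H': "H \<in> sets lebesgue" using H by simp
  have "(\<lambda>x. indicator H x *\<^sub>R g x) \<in> borel_measurable lebesgue"
    using g H' by (subst (asm) borel_measurable_restrict_space_iff) auto
  then obtain h where h: "h \<in> borel_measurable borel" "AE x in lborel. indicator H x *\<^sub>R g x = h x"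
    using completion_ex_borel_measurable_real[of "\<lambda>x. indicator H x *\<^sub>R g x" lborel] by auto
  show thesis
  proof (rule that[of "\<lambda>x. indicator H x * h x"])
    show "(\<lambda>x. indicator H x * h x) \<in> borel_measurable borel" using h(1) H by measurable
    have "AE x in lebesgue. indicator H x *\<^sub>R g x = h x" using h(2) by (rule AE_completion)
    then show "AE x in lebesgue_on H. g x = indicator H x * h x"
      using H' by (simp add: AE_restrict_space_iff) (auto elim!: eventually_mono simp: indicator_def)
  qed simp
qed

lemma L2_borel_representative:
  fixes g :: "'a::euclidean_space \<Rightarrow> real"
  assumes H: "H \<in> sets borel" and g: "L2 H g"
  obtains g' where "g' \<in> borel_measurable borel" "AE x in lebesgue_on H. g x = g' x" "integrable lborel (\<lambda>x. (g' x)\<^sup>2)"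
proof -
  obtain g' where g': "g' \<in> borel_measurable borel" "AE x in lebesgue_on H. g x = g' x" "\<And>x. x \<notin> H \<Longrightarrow> g' x = 0"
  proof (rule borel_representative[OF H])
    show "g \<in> borel_measurable (lebesgue_on H)" using g by (simp add: L2_def)
  qed (rule that)
  have "integrable (lebesgue_on H) (\<lambda>x. (g' x)\<^sup>2)"
  proof (rule integrable_cong_AE_imp[of _ "\<lambda>x. (g x)\<^sup>2"])
    show "integrable (lebesgue_on H) (\<lambda>x. (g x)\<^sup>2)" using g by (simp add: L2_def)
    show "(\<lambda>x. (g' x)\<^sup>2) \<in> borel_measurable (lebesgue_on H)"
      using g'(1) by (intro measurable_restrict_space1 measurable_completion) measurable
    show "AE x in lebesgue_on H. (g x)\<^sup>2 = (g' x)\<^sup>2" using g'(2) by eventually_elim simp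
  qed
  then have "integrable lborel (\<lambda>x. (g' x)\<^sup>2)"
    using g'(1,3) by (subst (asm) integral_lebesgue_on_eq_lborel(2)[OF H]) auto
  with g'(1,2) show thesis by (rule that)
qed

lemma Linf_AE_bound:
  assumes "Linf_norm S g \<le> ereal b"
  shows "AE x in lebesgue_on S. \<bar>g x\<bar> \<le> b"
  using esssup_AE[of "\<lambda>x. ereal \<bar>g x\<bar>" "lebesgue_on S"]
proof eventually_elim
  case (elim x)
  then have "ereal \<bar>g x\<bar> \<le> ereal b" using assms unfolding Linf_norm_def by (rule order_trans)
  then show ?case by simp
qed

lemma Linf_bound_obtain:
  assumes "Linf S g"
  obtains b where "0 \<le> b" "AE x in lebesgue_on S. \<bar>g x\<bar> \<le> b"
proof -
  have "Linf_norm S g < \<infinity>" using assms by (simp add: Linf_def)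
  then obtain b :: real where "Linf_norm S g \<le> ereal b"
    by (cases "Linf_norm S g") auto
  then have "Linf_norm S g \<le> ereal (max b 0)"
    by (rule order_trans) simp
  from Linf_AE_bound[OF this] show thesis by (intro that[of "max b 0"]) auto
qed

section \<open>Bounded functionals and coercive forms in the gradient norm\<close>

context
  fixes D :: "(real^'d) set"
  assumes D: "open D" "bounded D"
begin

lemma H10_zero: "(\<lambda>x. 0) \<in> H10 D"
  by (intro test_function_H10[OF D] test_function_zero)

lemma H10_scale: "u \<in> H10 D \<Longrightarrow> (\<lambda>x. c * u x) \<in> H10 D"
  using H10_add_scale[OF D H10_zero, of u c] by simp

lemma H10_function_space: "function_space (H10 D) (grad_norm D)"
  by (rule function_space.intro) (auto intro: H10_add_scale[OF D] H10_zero grad_norm_nonneg)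

text \<open>Continuity at 0 bounds \<open>F\<close> by 1 on a small ball, homogeneity extends this
  to all of \<open>H10\<close>, and the Poincare inequality replaces the full norm by that of the
  gradient.\<close>

lemma functional_linear_bounded:
  assumes F: "continuous_linear_functional_H10 D F"
  obtains K where "linear_on (H10 D) F" "0 \<le> K" "\<And>v. v \<in> H10 D \<Longrightarrow> \<bar>F v\<bar> \<le> K * grad_norm D v"
proof -
  have add: "\<And>u v. u \<in> H10 D \<Longrightarrow> v \<in> H10 D \<Longrightarrow> F (\<lambda>x. u x + v x) = F u + F v"
    and scale: "\<And>c u. u \<in> H10 D \<Longrightarrow> F (\<lambda>x. c * u x) = c * F u"
    and cont: "\<And>u e. u \<in> H10 D \<Longrightarrow> 0 < e \<Longrightarrow> \<exists>\<delta>>0. \<forall>v\<in>H10 D. H1_norm D (\<lambda>x. v x - u x) < \<delta> \<longrightarrow> \<bar>F v - F u\<bar> < e"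
    using F unfolding continuous_linear_functional_H10_def by blast+
  have lin: "linear_on (H10 D) F"
    unfolding linear_on_def by (intro ballI allI) (simp add: add scale H10_scale)
  have F0: "F (\<lambda>x. 0) = 0" using scale[OF H10_zero, of 0] by simp
  obtain \<delta> where \<delta>: "0 < \<delta>" "\<And>v. v \<in> H10 D \<Longrightarrow> H1_norm D v < \<delta> \<Longrightarrow> \<bar>F v\<bar> < 1"
    using cont[OF H10_zero, of 1] F0 by auto
  obtain P where P: "0 < P" "\<And>u. u \<in> H10 D \<Longrightarrow> H1_norm D u \<le> P * grad_norm D u"
    using poincare[OF D] by blast
  have bound: "\<bar>F v\<bar> \<le> 1 / \<delta> * H1_norm D v" if v: "v \<in> H10 D" for v
  proof (rule field_le_epsilon)
    fix e :: real assume e: "0 < e"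
    \<comment> \<open>The summand \<open>\<delta> * e\<close> permits the rescaling even when the
      norm vanishes, and reappears as the error \<open>e\<close>.\<close>
    let ?n = "H1_norm D v + \<delta> * e"
    have n: "0 < ?n" using e \<delta> H1_norm_nonneg[of D v] by (simp add: add_nonneg_pos)
    let ?t = "\<delta> / ?n"
    have H1v: "H1 D v" "H1 D (\<lambda>x. 0)" using v H10_zero by (auto intro: H10_imp_H1)
    have "H1_norm D (\<lambda>x. ?t * v x) \<le> ?t * H1_norm D v"
      using H1_norm_triangle[OF D H1v(2,1), of ?t] n \<delta>(1) by (simp add: H1_norm_zero[OF D])
    also have "\<dots> < ?t * ?n" using n \<delta>(1) e by (intro mult_strict_left_mono) auto
    also have "\<dots> = \<delta>" using n by simp
    finally have "\<bar>?t * F v\<bar> < 1" using \<delta>(2)[OF H10_scale[OF v, of ?t]] scale[OF v, of ?t] by simp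
    then have "?t * \<bar>F v\<bar> < 1" using n \<delta>(1) by (simp add: abs_mult)
    then have "\<bar>F v\<bar> < ?n / \<delta>" using n \<delta>(1) by (simp add: field_simps)
    also have "?n / \<delta> = 1 / \<delta> * H1_norm D v + e" using \<delta>(1) by (simp add: field_simps)
    finally show "\<bar>F v\<bar> \<le> 1 / \<delta> * H1_norm D v + e" by simp
  qed
  have "\<bar>F v\<bar> \<le> 1 / \<delta> * P * grad_norm D v" if v: "v \<in> H10 D" for v
  proof -
    have "1 / \<delta> * H1_norm D v \<le> 1 / \<delta> * (P * grad_norm D v)"
      using \<delta>(1) by (intro mult_left_mono P(2)[OF v]) auto
    then show ?thesis using bound[OF v] by (simp add: mult.assoc)
  qed
  with lin show thesis using \<delta>(1) P(1) by (intro that[of "1 / \<delta> * P"]) auto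
qed

end

context diffeo_domain
begin

text \<open>The constants combine the bounds of \<open>a\<close> with those of the determinant and
  of \<open>S x\<close>. The added 1 makes the upper constant positive whatever \<open>hi\<close>
  is, and lets it cover a perturbation bounded by 1 as well.\<close>

lemma coercive_form_pullback:
  assumes a: "(\<lambda>x. a (v x)) \<in> borel_measurable (lebesgue_on D)"
    "\<And>x. x \<in> D \<Longrightarrow> lo \<le> a (v x) \<and> a (v x) \<le> hi" and lo: "0 < lo"
  shows "coercive_form (H10 D) (grad_norm D) (wform (\<lambda>x. a (v x) * det (J x)))
    (lo / (fact CARD('d) * C ^ CARD('d)) / C\<^sup>2) ((\<bar>hi\<bar> + 1) * (fact CARD('d) * C ^ CARD('d)) * C\<^sup>2)"
    and "admissible_weight (\<lambda>x. a (v x) * det (J x))"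
proof -
  note DD = open_D bounded_D
  let ?d = "fact CARD('d) * C ^ CARD('d)"
  have d: "0 < ?d" using C_pos by simp
  have x: "AE x in lebesgue_on D. x \<in> D" using D_lebesgue by (simp add: AE_restrict_space_iff)
  have b: "AE x in lebesgue_on D. \<bar>a (v x)\<bar> \<le> \<bar>hi\<bar> + 1" using x
  proof eventually_elim
    case (elim x)
    show ?case using a(2)[OF elim] lo by linarith
  qed
  note w = admissible_weight_pullback[OF a(1) b]
  show adm: "admissible_weight (\<lambda>x. a (v x) * det (J x))" by (rule w(1)) simp
  have wb: "AE x in lebesgue_on D. \<bar>a (v x) * det (J x)\<bar> \<le> (\<bar>hi\<bar> + 1) * ?d" by (rule w(2)) simp
  interpret function_space "H10 D" "grad_norm D" by (rule H10_function_space[OF DD])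
  show "coercive_form (H10 D) (grad_norm D) (wform (\<lambda>x. a (v x) * det (J x))) (lo / ?d / C\<^sup>2) ((\<bar>hi\<bar> + 1) * ?d * C\<^sup>2)"
  proof unfold_locales
    show "symmetric_bilinear_on (H10 D) (wform (\<lambda>x. a (v x) * det (J x)))"
      by (rule wform_symmetric_bilinear[OF adm])
    show "0 < lo / ?d / C\<^sup>2" "0 < (\<bar>hi\<bar> + 1) * ?d * C\<^sup>2" using lo C_pos by (auto intro!: mult_pos_pos)
    show "lo / ?d / C\<^sup>2 * (grad_norm D u)\<^sup>2 \<le> wform (\<lambda>x. a (v x) * det (J x)) u u" if u: "u \<in> H10 D" for u
    proof (rule wform_coercive[OF adm])
      show "AE x in lebesgue_on D. lo / ?d \<le> a (v x) * det (J x)" using x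
      proof eventually_elim
        case (elim x)
        have "lo * (1 / ?d) \<le> a (v x) * det (J x)"
          using a(2)[OF elim] det_lower[OF elim] lo d by (intro mult_mono) auto
        then show ?case by simp
      qed
    qed (use lo d u H10_imp_H1 in auto)
    show "\<bar>wform (\<lambda>x. a (v x) * det (J x)) u w\<bar> \<le> (\<bar>hi\<bar> + 1) * ?d * C\<^sup>2 * grad_norm D u * grad_norm D w"
      if "u \<in> H10 D" "w \<in> H10 D" for u w
      using adm that C_pos by (intro wform_bound wb H10_imp_H1) (auto simp: admissible_weight_def)
  qed
qed

lemma load_functional:
  assumes g: "g \<in> borel_measurable borel" "integrable lborel (\<lambda>y. (g y)\<^sup>2)"
    and ae: "AE x in lebesgue_on D. f (v x) = g (v x)"
    and P: "\<And>u. u \<in> H10 D \<Longrightarrow> H1_norm D u \<le> P * grad_norm D u"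
  defines "l \<equiv> \<lambda>u. LINT x|lebesgue_on D. pullback_load v f x * u x"
  shows "linear_on (H10 D) l"
    and "u \<in> H10 D \<Longrightarrow> \<bar>l u\<bar> \<le>
      fact CARD('d) * C ^ CARD('d) * sqrt (C ^ CARD('d) * (LINT y|lborel. (g y)\<^sup>2)) * P * grad_norm D u"
proof -
  note DD = open_D bounded_D
  let ?M = "lebesgue_on D"
  note sq = pullback_load_square_integrable[OF g ae]
  have squ: "square_integrable ?M u" if "u \<in> H10 D" for u
    using H1D(1)[OF H10_imp_H1[OF that]] by (simp add: square_integrable_real_iff_L2)
  have int: "integrable ?M (\<lambda>x. pullback_load v f x * u x)" if "u \<in> H10 D" for u
    using square_integrable_inner[OF sq(1) squ[OF that]] by simp
  show "linear_on (H10 D) l"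
    unfolding linear_on_def l_def
  proof (intro ballI allI)
    fix u w c assume u: "u \<in> H10 D" and w: "w \<in> H10 D"
    have "(LINT x|?M. pullback_load v f x * (u x + c * w x)) =
      (LINT x|?M. pullback_load v f x * u x + c * (pullback_load v f x * w x))"
      by (simp add: algebra_simps)
    then show "(LINT x|?M. pullback_load v f x * (u x + c * w x)) =
      (LINT x|?M. pullback_load v f x * u x) + c * (LINT x|?M. pullback_load v f x * w x)"
      using int[OF u] int[OF w] by simp
  qed
  assume u: "u \<in> H10 D"
  let ?L = "fact CARD('d) * C ^ CARD('d) * sqrt (C ^ CARD('d) * (LINT y|lborel. (g y)\<^sup>2))"
  have L: "0 \<le> ?L" using C_pos by simp
  have "\<bar>l u\<bar> \<le> seminorm2 ?M (pullback_load v f) * seminorm2 ?M u"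
    using Cauchy_Schwarz_integral[OF sq(1) squ[OF u]] by (simp add: l_def)
  also have "\<dots> \<le> ?L * (P * grad_norm D u)"
    using order_trans[OF seminorm2_le_H1_norm[OF H10_imp_H1[OF u]] P[OF u]] sq(2) L
    by (intro mult_mono) auto
  finally show "\<bar>l u\<bar> \<le> ?L * P * grad_norm D u" by (simp add: mult.assoc)
qed

end

lemma integral_lebesgue_on_eq_lborel_AE:
  fixes k h :: "'a::euclidean_space \<Rightarrow> real"
  assumes D: "D \<in> sets borel" and h: "h \<in> borel_measurable borel" and ae: "AE x in lebesgue_on D. k x = h x"
  shows "(LINT x|lebesgue_on D. k x) = (LINT x|lborel. indicator D x * h x)"
proof -
  have D': "D \<in> sets lebesgue" using D by simp
  have "(LINT x|lebesgue_on D. k x) = (LINT x|lebesgue. indicator D x * k x)"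
    using D' by (simp add: integral_restrict_space)
  also have "\<dots> = (LINT x|lborel. indicator D x * h x)"
  proof (rule integral_lebesgue_eq_of_AE)
    show "(\<lambda>x. indicator D x * h x) \<in> borel_measurable borel" using D h by measurable
    have "AE x in lebesgue. x \<in> D \<longrightarrow> k x = h x" using ae D' by (simp add: AE_restrict_space_iff)
    then show "AE x in lborel. indicator D x * k x = indicator D x * h x"
      unfolding AE_completion_iff by eventually_elim (simp add: indicator_def)
  qed
  finally show ?thesis .
qed

text \<open>Selecting the least index involves countably many comparisons of measurable functions,
  and \<open>lim\<close> is measurable even before convergence is known.\<close>

lemma selection_measurable:
  fixes h :: "nat \<Rightarrow> 'a \<Rightarrow> real" and c :: "nat \<Rightarrow> real"
  assumes [measurable]: "\<And>j. h j \<in> borel_measurable M"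
  shows "(\<lambda>x. lim (\<lambda>n. c (LEAST j. \<forall>i. h j x \<le> h i x + inverse (real (Suc n))))) \<in> borel_measurable M"
proof -
  have sel: "(\<lambda>x. LEAST j. \<forall>i. h j x \<le> h i x + inverse (real (Suc n))) \<in> measurable M (count_space UNIV)" for n
    by measurable
  have "(\<lambda>x. c (LEAST j. \<forall>i. h j x \<le> h i x + inverse (real (Suc n)))) \<in> borel_measurable M" for n
    by (rule measurable_compose[OF sel]) simp
  then show ?thesis by (rule borel_measurable_lim_metric)
qed

context diffeo_domain
begin

text \<open>Two bounds serve different ends: the coefficient-dependent sum of the bounds for the
  \<psi> k only secures integrability, while the estimate of the form uses the uniform bound
  1.\<close>

lemma weighted_sum_form:
  fixes \<psi> :: "'n::finite \<Rightarrow> real^'d \<Rightarrow> real"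
  assumes \<psi>: "\<And>k. (\<lambda>x. \<psi> k (v x)) \<in> borel_measurable (lebesgue_on D)"
    "\<And>k. \<exists>b\<ge>0. AE x in lebesgue_on D. \<bar>\<psi> k (v x)\<bar> \<le> b"
    and a: "\<And>x. a x = (\<Sum>k\<in>UNIV. c k * \<psi> k x)"
  shows "\<And>k. admissible_weight (\<lambda>x. \<psi> k (v x) * det (J x))"
    and "admissible_weight (\<lambda>x. a (v x) * det (J x))"
    and "\<And>u w. H1 D u \<Longrightarrow> H1 D w \<Longrightarrow> wform (\<lambda>x. a (v x) * det (J x)) u w =
      (\<Sum>k\<in>UNIV. c k * wform (\<lambda>x. \<psi> k (v x) * det (J x)) u w)"
    and "\<And>u w. AE x in lebesgue_on D. \<bar>a (v x)\<bar> \<le> 1 \<Longrightarrow> H1 D u \<Longrightarrow> H1 D w \<Longrightarrow>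
      \<bar>wform (\<lambda>x. a (v x) * det (J x)) u w\<bar> \<le> fact CARD('d) * C ^ CARD('d) * C\<^sup>2 * grad_norm D u * grad_norm D w"
proof -
  show adm: "admissible_weight (\<lambda>x. \<psi> k (v x) * det (J x))" for k
    using \<psi>(2)[of k] admissible_weight_pullback(1)[OF \<psi>(1)[of k]] by blast
  have am: "(\<lambda>x. a (v x)) \<in> borel_measurable (lebesgue_on D)"
    unfolding a by (intro borel_measurable_sum borel_measurable_times borel_measurable_const \<psi>(1))
  from \<psi>(2) have "\<forall>k. \<exists>b. 0 \<le> b \<and> (AE x in lebesgue_on D. \<bar>\<psi> k (v x)\<bar> \<le> b)" by blast
  from choice[OF this] obtain b where b: "\<And>k. 0 \<le> b k" "\<And>k. AE x in lebesgue_on D. \<bar>\<psi> k (v x)\<bar> \<le> b k"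
    by blast
  have "AE x in lebesgue_on D. \<forall>k\<in>UNIV. \<bar>\<psi> k (v x)\<bar> \<le> b k"
    by (rule AE_finite_allI) (use b(2) in auto)
  then have ab: "AE x in lebesgue_on D. \<bar>a (v x)\<bar> \<le> (\<Sum>k\<in>UNIV. \<bar>c k\<bar> * b k)"
  proof eventually_elim
    case (elim x)
    have "\<bar>a (v x)\<bar> \<le> (\<Sum>k\<in>UNIV. \<bar>c k * \<psi> k (v x)\<bar>)" unfolding a by (rule sum_abs)
    also have "\<dots> \<le> (\<Sum>k\<in>UNIV. \<bar>c k\<bar> * b k)"
      using elim unfolding abs_mult by (intro sum_mono mult_left_mono) auto
    finally show ?case .
  qed
  have "0 \<le> (\<Sum>k\<in>UNIV. \<bar>c k\<bar> * b k)" using b(1) by (intro sum_nonneg mult_nonneg_nonneg) auto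
  from admissible_weight_pullback(1)[OF am ab this]
  show adma: "admissible_weight (\<lambda>x. a (v x) * det (J x))" .
  show "wform (\<lambda>x. a (v x) * det (J x)) u w = (\<Sum>k\<in>UNIV. c k * wform (\<lambda>x. \<psi> k (v x) * det (J x)) u w)"
    if "H1 D u" "H1 D w" for u w
  proof -
    have "wform (\<lambda>x. a (v x) * det (J x)) u w = wform (\<lambda>x. \<Sum>k\<in>UNIV. c k * (\<psi> k (v x) * det (J x))) u w"
      unfolding a by (simp add: sum_distrib_right mult.assoc)
    also have "\<dots> = (\<Sum>k\<in>UNIV. c k * wform (\<lambda>x. \<psi> k (v x) * det (J x)) u w)"
      by (rule wform_weight_sum[OF adm that])
    finally show ?thesis .
  qed
  show "\<bar>wform (\<lambda>x. a (v x) * det (J x)) u w\<bar> \<le> fact CARD('d) * C ^ CARD('d) * C\<^sup>2 * grad_norm D u * grad_norm D w"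
    if ae: "AE x in lebesgue_on D. \<bar>a (v x)\<bar> \<le> 1" and H: "H1 D u" "H1 D w" for u w
    using adma admissible_weight_pullback(2)[OF am ae] C_pos
    by (intro wform_bound H) (auto simp: admissible_weight_def)
qed

end

section \<open>Joint measurability in the parameter and the point\<close>

lemma cube_eq_cbox: "cube = cbox (\<chi> i. -1) (\<chi> i. 1)"
  by (auto simp: cube_def Gam_def mem_box_cart)

locale random_map =
  fixes D :: "(real^'d) set" and EV :: "real^'d \<Rightarrow> real^'d"
    and \<phi> :: "'m::finite \<Rightarrow> real^'d \<Rightarrow> real^'d" and \<mu> :: "'m \<Rightarrow> real"
    and V :: "real^'m \<Rightarrow> real^'d \<Rightarrow> real^'d"
  assumes D: "open D" "bounded D" and EV: "C1_closure D EV" and \<phi>: "\<And>k. C1_closure D (\<phi> k)"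
    and V: "\<And>z X. V z X = EV X + (\<Sum>k\<in>UNIV. (sqrt (\<mu> k) * z $ k) *\<^sub>R \<phi> k X)"
begin

text \<open>The coefficient fields are controlled only on the closure of \<open>D\<close>. Cutting
  them off produces a map that is Borel on the whole product space and agrees with \<open>V\<close>
  on \<open>D\<close>; \<open>Jt\<close> does the same for the Jacobian, which is affine in
  \<open>z\<close> like \<open>V\<close> itself.\<close>

definition Vt :: "(real^'m) \<times> (real^'d) \<Rightarrow> real^'d" where
  "Vt p = indicator D (snd p) *\<^sub>R EV (snd p) +
    (\<Sum>k\<in>UNIV. (sqrt (\<mu> k) * fst p $ k) *\<^sub>R (indicator D (snd p) *\<^sub>R \<phi> k (snd p)))"

definition Jt :: "(real^'m) \<times> (real^'d) \<Rightarrow> real^'d^'d" where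
  "Jt p = (\<chi> i j. indicator D (snd p) *\<^sub>R (jacobian EV (at (snd p)) $ i $ j) +
    (\<Sum>k\<in>UNIV. (sqrt (\<mu> k) * fst p $ k) * (indicator D (snd p) *\<^sub>R (jacobian (\<phi> k) (at (snd p)) $ i $ j))))"

lemma Vt_eq: "X \<in> D \<Longrightarrow> Vt (z, X) = V z X"
  by (simp add: Vt_def V)

lemma Jt_eq:
  assumes X: "X \<in> D" shows "Jt (z, X) = jacobian (V z) (at X)"
proof -
  let ?J = "jacobian EV (at X) + (\<Sum>k\<in>UNIV. (sqrt (\<mu> k) * z $ k) *\<^sub>R jacobian (\<phi> k) (at X))"
  have "(V z has_derivative (\<lambda>h. jacobian EV (at X) *v h +
      (\<Sum>k\<in>UNIV. (sqrt (\<mu> k) * z $ k) *\<^sub>R (jacobian (\<phi> k) (at X) *v h)))) (at X)"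
    unfolding V[abs_def]
    by (intro has_derivative_add has_derivative_sum has_derivative_scaleR_right
        C1_closure_jacobian(1)[OF EV X] C1_closure_jacobian(1)[OF \<phi> X])
  moreover have "(\<lambda>h. jacobian EV (at X) *v h +
      (\<Sum>k\<in>UNIV. (sqrt (\<mu> k) * z $ k) *\<^sub>R (jacobian (\<phi> k) (at X) *v h))) = (\<lambda>h. ?J *v h)"
  proof
    fix h
    have "(\<Sum>k\<in>S. (sqrt (\<mu> k) * z $ k) *\<^sub>R jacobian (\<phi> k) (at X)) *v h =
        (\<Sum>k\<in>S. (sqrt (\<mu> k) * z $ k) *\<^sub>R (jacobian (\<phi> k) (at X) *v h))" for S
      by (induction S rule: infinite_finite_induct)
        (auto simp: matrix_vector_mult_add_rdistrib scaleR_matrix_vector_assoc)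
    then show "jacobian EV (at X) *v h + (\<Sum>k\<in>UNIV. (sqrt (\<mu> k) * z $ k) *\<^sub>R (jacobian (\<phi> k) (at X) *v h)) = ?J *v h"
      by (simp add: matrix_vector_mult_add_rdistrib)
  qed
  ultimately have "(V z has_derivative (\<lambda>h. ?J *v h)) (at X)" by simp
  then have "jacobian (V z) (at X) = ?J"
    unfolding jacobian_def by (subst frechet_derivative_at[symmetric]) auto
  then show ?thesis using X by (simp add: Jt_def vec_eq_iff)
qed

lemma indicator_comp_measurable:
  fixes h :: "real^'d \<Rightarrow> 'b::euclidean_space"
  assumes "continuous_on D h"
  shows "(\<lambda>p. indicator D (snd p) *\<^sub>R h (snd p)) \<in> borel_measurable (borel \<Otimes>\<^sub>M borel)"
proof -
  have "(\<lambda>x. indicator D x *\<^sub>R h x) \<in> borel_measurable borel"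
    using D(1) assms by (intro borel_measurable_continuous_on_indicator) auto
  from measurable_compose[OF measurable_snd this] show ?thesis .
qed

lemma continuous_on_D: "C1_closure D h \<Longrightarrow> continuous_on D h"
  unfolding C1_closure_def using continuous_on_subset[OF _ closure_subset] by blast

lemma component_fst_measurable: "(\<lambda>p. fst p $ k) \<in> borel_measurable (borel \<Otimes>\<^sub>M borel)"
  by (intro measurable_compose[OF measurable_fst] borel_measurable_continuous_onI continuous_intros)

lemma Vt_measurable: "Vt \<in> borel_measurable (borel \<Otimes>\<^sub>M borel)"
  unfolding Vt_def
  by (intro borel_measurable_add borel_measurable_sum borel_measurable_scaleR borel_measurable_times
      borel_measurable_const component_fst_measurable indicator_comp_measurable continuous_on_D EV \<phi>)

lemma Jt_measurable: "(\<lambda>p. Jt p $ i $ j) \<in> borel_measurable (borel \<Otimes>\<^sub>M borel)"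
  unfolding Jt_def vec_lambda_beta
  by (intro borel_measurable_add borel_measurable_sum borel_measurable_times
      borel_measurable_const component_fst_measurable indicator_comp_measurable continuous_intros
      C1_closure_jacobian(2) EV \<phi>)

text \<open>An open set is a countable union of compact sets and \<open>cube\<close> is compact, so
  the hold-all domain is a countable union of compact images.\<close>

lemma image_borel: "(\<Union>z\<in>cube. V z ` D) \<in> sets borel"
proof -
  obtain K where K: "\<And>n::nat. compact (K n)" "\<And>n. K n \<subseteq> D" "(\<Union>n. K n) = D"
    by (rule open_Union_compact_subsets[OF D(1)]) (rule that)
  have c: "continuous_on (closure D) EV" "\<And>k. continuous_on (closure D) (\<phi> k)"
    using EV \<phi> by (auto simp: C1_closure_def)
  have "compact ((\<lambda>p. V (fst p) (snd p)) ` (cube \<times> K n))" for n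
  proof (rule compact_continuous_image)
    have "K n \<subseteq> closure D" using K(2) closure_subset by blast
    then have "continuous_on (cube \<times> K n) (\<lambda>p. EV (snd p))" "\<And>k. continuous_on (cube \<times> K n) (\<lambda>p. \<phi> k (snd p))"
      by (auto intro!: continuous_on_compose2[OF c(1)] continuous_on_compose2[OF c(2)] continuous_intros)
    then show "continuous_on (cube \<times> K n) (\<lambda>p. V (fst p) (snd p))"
      unfolding V by (intro continuous_intros)
    show "compact (cube \<times> K n)" by (intro compact_Times K) (simp add: cube_eq_cbox)
  qed
  then have "(\<Union>n. (\<lambda>p. V (fst p) (snd p)) ` (cube \<times> K n)) \<in> sets borel"
    by (intro sets.countable_UN) (auto intro: borel_compact)
  moreover have "(\<Union>n. (\<lambda>p. V (fst p) (snd p)) ` (cube \<times> K n)) = (\<Union>z\<in>cube. V z ` D)"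
    unfolding K(3)[symmetric] by force
  ultimately show ?thesis by simp
qed

text \<open>The diagonal of \<open>wform\<close> on a test function, rewritten with the classical
  gradient in place of the chosen weak one and with jointly Borel ingredients, so that measurability
  in \<open>z\<close> follows from Fubini.\<close>

definition energy :: "(real^'d \<Rightarrow> real) \<Rightarrow> (real^'d \<Rightarrow> real) \<Rightarrow> real^'m \<Rightarrow> real" where
  "energy g w z = (LINT X|lborel. indicator D X * (g (Vt (z, X)) * det (Jt (z, X)) *
     (cramer_solve (transpose (Jt (z, X))) (grad w X) \<bullet> cramer_solve (transpose (Jt (z, X))) (grad w X))))"

definition load :: "(real^'d \<Rightarrow> real) \<Rightarrow> (real^'d \<Rightarrow> real) \<Rightarrow> real^'m \<Rightarrow> real" where
  "load g w z = (LINT X|lborel. indicator D X * (g (Vt (z, X)) * det (Jt (z, X)) * w X))"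

lemma energy_integrand_measurable:
  assumes g: "g \<in> borel_measurable borel" and w: "test_function D w"
  shows "(\<lambda>p. g (Vt p) * det (Jt p) *
     (cramer_solve (transpose (Jt p)) (grad w (snd p)) \<bullet> cramer_solve (transpose (Jt p)) (grad w (snd p))))
     \<in> borel_measurable (borel \<Otimes>\<^sub>M borel)"
proof -
  have "grad w \<in> borel_measurable borel"
    by (intro borel_measurable_continuous_onI grad_continuous[OF w])
  then have "(\<lambda>p. cramer_solve (transpose (Jt p)) (grad w (snd p))) \<in> borel_measurable (borel \<Otimes>\<^sub>M borel)"
    by (intro borel_measurable_cramer_solve measurable_compose[OF measurable_snd]) (auto simp: transpose_def Jt_measurable)
  then show ?thesis
    by (intro borel_measurable_times borel_measurable_inner borel_measurable_det Jt_measurable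
        measurable_compose[OF Vt_measurable g])
qed

lemma load_integrand_measurable:
  assumes g: "g \<in> borel_measurable borel" and w: "test_function D w"
  shows "(\<lambda>p. g (Vt p) * det (Jt p) * w (snd p)) \<in> borel_measurable (borel \<Otimes>\<^sub>M borel)"
proof -
  have "w \<in> borel_measurable borel"
    by (intro borel_measurable_continuous_onI test_function_continuous[OF w])
  then show ?thesis
    by (intro borel_measurable_times borel_measurable_det Jt_measurable
        measurable_compose[OF Vt_measurable g] measurable_compose[OF measurable_snd])
qed

lemma integral_section_measurable:
  assumes h: "h \<in> borel_measurable (borel \<Otimes>\<^sub>M borel)"
  shows "(\<lambda>z. LINT X|lborel. indicator D X * (h (z, X) :: real)) \<in> borel_measurable borel"
proof -
  have "D \<in> sets borel" using D(1) by simp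
  then have "(\<lambda>p. indicator D (snd p) * h p) \<in> borel_measurable (borel \<Otimes>\<^sub>M borel)"
    using h by measurable
  then have "(\<lambda>(z, X). indicator D X * h (z, X)) \<in> borel_measurable (borel \<Otimes>\<^sub>M lborel)"
    by (simp add: case_prod_beta' cong: measurable_cong_sets)
  then show ?thesis by (rule lborel.borel_measurable_lebesgue_integral)
qed

lemma energy_measurable:
  "g \<in> borel_measurable borel \<Longrightarrow> test_function D w \<Longrightarrow> energy g w \<in> borel_measurable borel"
  unfolding energy_def[abs_def] by (rule integral_section_measurable[OF energy_integrand_measurable, unfolded snd_conv])

lemma load_measurable:
  "g \<in> borel_measurable borel \<Longrightarrow> test_function D w \<Longrightarrow> load g w \<in> borel_measurable borel"
  unfolding load_def[abs_def] by (rule integral_section_measurable[OF load_integrand_measurable, unfolded snd_conv])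

lemma section_measurable:
  "h \<in> borel_measurable (borel \<Otimes>\<^sub>M borel) \<Longrightarrow> (\<lambda>X. h (z, X)) \<in> borel_measurable borel"
  by (rule measurable_compose[OF measurable_Pair1']) auto

lemma wform_eq_energy:
  assumes dd: "diffeo_domain D (V z) C" and g: "g \<in> borel_measurable borel" and w: "test_function D w"
    and ae: "AE X in lebesgue_on D. a (V z X) = g (V z X)"
  shows "diffeo_domain.wform D (V z) (\<lambda>X. a (V z X) * det (jacobian (V z) (at X))) w w = energy g w z"
proof -
  interpret diffeo_domain D "V z" C by fact
  have D': "D \<in> sets borel" using D by simp
  have x: "AE X in lebesgue_on D. X \<in> D" using D_lebesgue by (simp add: AE_restrict_space_iff)
  show ?thesis
    unfolding wform_def energy_def
  proof (rule integral_lebesgue_on_eq_lborel_AE[OF D'])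
    show "(\<lambda>X. g (Vt (z, X)) * det (Jt (z, X)) *
     (cramer_solve (transpose (Jt (z, X))) (grad w X) \<bullet> cramer_solve (transpose (Jt (z, X))) (grad w X))) \<in> borel_measurable borel"
      using section_measurable[OF energy_integrand_measurable[OF g w], of z] by simp
    show "AE X in lebesgue_on D. a (V z X) * det (J X) * (S X (wgrad D w X) \<bullet> S X (wgrad D w X)) =
      g (Vt (z, X)) * det (Jt (z, X)) *
     (cramer_solve (transpose (Jt (z, X))) (grad w X) \<bullet> cramer_solve (transpose (Jt (z, X))) (grad w X))"
      using x ae wgrad_test_function[OF D w] by eventually_elim (simp add: Vt_eq Jt_eq)
  qed
qed

lemma pullback_load_eq_load:
  assumes dd: "diffeo_domain D (V z) C" and g: "g \<in> borel_measurable borel" and w: "test_function D w"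
    and ae: "AE X in lebesgue_on D. f (V z X) = g (V z X)"
  shows "(LINT X|lebesgue_on D. pullback_load (V z) f X * w X) = load g w z"
proof -
  interpret diffeo_domain D "V z" C by fact
  have D': "D \<in> sets borel" using D by simp
  have x: "AE X in lebesgue_on D. X \<in> D" using D_lebesgue by (simp add: AE_restrict_space_iff)
  show ?thesis
    unfolding load_def
  proof (rule integral_lebesgue_on_eq_lborel_AE[OF D'])
    show "(\<lambda>X. g (Vt (z, X)) * det (Jt (z, X)) * w X) \<in> borel_measurable borel"
      using section_measurable[OF load_integrand_measurable[OF g w], of z] by simp
    show "AE X in lebesgue_on D. pullback_load (V z) f X * w X = g (Vt (z, X)) * det (Jt (z, X)) * w X"
      using x ae by eventually_elim (simp add: pullback_load_def Vt_eq Jt_eq)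
  qed
qed

end

section \<open>The expansion\<close>

theorem corollary4p6:
  fixes Dref Dhold :: "(real^'d) set"
    and \<rho>X :: "'n::finite \<Rightarrow> real \<Rightarrow> real" and \<rho>Y :: "'m::finite \<Rightarrow> real \<Rightarrow> real"
    and EV :: "real^'d \<Rightarrow> real^'d" and \<phi> :: "'m \<Rightarrow> real^'d \<Rightarrow> real^'d" and \<mu> :: "'m \<Rightarrow> real"
    and V :: "real^'m \<Rightarrow> real^'d \<Rightarrow> real^'d" and Cuni :: real
    and a_s :: "real^'d \<Rightarrow> real" and a_lo a_hi :: real
    and \<psi> :: "'n \<Rightarrow> real^'d \<Rightarrow> real" and lam :: "'n \<Rightarrow> real"
    and a_r :: "real^'n \<Rightarrow> real^'d \<Rightarrow> real"
    and f :: "real^'d \<Rightarrow> real"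
    and A_s :: "real^'m \<Rightarrow> real^'d \<Rightarrow> real^'d^'d"
    and A_r :: "real^'n \<Rightarrow> real^'m \<Rightarrow> real^'d \<Rightarrow> real^'d^'d"
    and f_ref :: "real^'m \<Rightarrow> real^'d \<Rightarrow> real"
    and F :: "(real^'d \<Rightarrow> real) \<Rightarrow> real"
    and u0 :: "real^'m \<Rightarrow> real^'d \<Rightarrow> real"
  assumes Dref: "bounded_lipschitz_domain Dref"
    \<comment> \<open>random parameters\<close>
    and \<rho>X: "iid_centered_densities \<rho>X"
    and \<rho>Y: "iid_centered_densities \<rho>Y"
    \<comment> \<open>random domain\<close>
    and EV: "C1_closure Dref EV"
    and \<phi>: "\<And>k. C1_closure Dref (\<phi> k)"
    and \<mu>: "\<And>k. 0 \<le> \<mu> k"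
    and V: "\<And>z X. V z X = EV X + (\<Sum>k\<in>UNIV. (sqrt (\<mu> k) * z $ k) *\<^sub>R \<phi> k X)"
    and V_diffeo: "AE z in param_law \<rho>Y. C1_diffeo Dref (V z) \<and>
          (\<forall>X\<in>Dref. det (jacobian (V z) (at X)) > 0) \<and>
          C1_norm Dref (V z) \<le> Cuni \<and>
          C1_norm (V z ` Dref) (the_inv_into (closure Dref) (V z)) \<le> Cuni"
    and Dhold: "Dhold = (\<Union>z\<in>cube. V z ` Dref)"
    \<comment> \<open>diffusion coefficient and load\<close>
    and a_s_analytic: "\<exists>U. open U \<and> Dhold \<subseteq> U \<and> real_analytic_on U a_s"
    and a_lo: "0 < a_lo"
    and a_s_bounds: "\<And>x. x \<in> Dhold \<Longrightarrow> a_lo \<le> a_s x \<and> a_s x \<le> a_hi"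
    and lam: "\<And>k. 0 \<le> lam k"
    and \<psi>: "\<And>k. Linf Dhold (\<psi> k)"
    and a_r: "\<And>y x. a_r y x = (\<Sum>k\<in>UNIV. sqrt (lam k) * \<psi> k x * y $ k)"
    and a_r_bound: "AE (y, z) in param_law \<rho>X \<Otimes>\<^sub>M param_law \<rho>Y.
          Linf_norm (V z ` Dref) (a_r y) \<le> 1"
    and f: "L2 Dhold f"
    \<comment> \<open>transported data\<close>
    and A_s: "\<And>z. A_s z = pullback_coeff (V z) a_s"
    and A_r: "\<And>y z. A_r y z = pullback_coeff (V z) (a_r y)"
    and f_ref: "\<And>z. f_ref z = pullback_load (V z) f"
    \<comment> \<open>functional and unperturbed solution\<close>
    and F: "continuous_linear_functional_H10 Dref F"
    and u0: "AE z in param_law \<rho>Y. weak_solution Dref (A_s z) (f_ref z) (u0 z)"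
  shows "\<exists>\<epsilon>0>0. \<exists>C>0. \<forall>\<epsilon> (u\<epsilon> :: real^'n \<Rightarrow> real^'m \<Rightarrow> real^'d \<Rightarrow> real).
           0 < \<epsilon> \<and> \<epsilon> \<le> \<epsilon>0 \<and>
           (AE (y, z) in param_law \<rho>X \<Otimes>\<^sub>M param_law \<rho>Y.
              weak_solution Dref (\<lambda>X. A_s z X + \<epsilon> *\<^sub>R A_r y z X) (f_ref z) (u\<epsilon> y z)) \<longrightarrow>
           \<bar>expect \<rho>X \<rho>Y (\<lambda>y z. F (u\<epsilon> y z)) - expect \<rho>X \<rho>Y (\<lambda>y z. F (u0 z))\<bar> \<le> C * \<epsilon>\<^sup>2 \<and>
           \<bar>varc \<rho>X \<rho>Y (\<lambda>y z. F (u\<epsilon> y z)) - varc \<rho>X \<rho>Y (\<lambda>y z. F (u0 z))\<bar> \<le> C * \<epsilon>\<^sup>2"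
proof -
  have D: "open Dref" "bounded Dref"
    using Dref by (auto simp: bounded_lipschitz_domain_def)
  let ?PX = "param_law \<rho>X" and ?PY = "param_law \<rho>Y" and ?M = "lebesgue_on Dref" and ?H = "H10 Dref"
  let ?n = "grad_norm Dref"
  interpret X: prob_space ?PX by (rule prob_space_param_law[OF \<rho>X])
  interpret Y: prob_space ?PY by (rule prob_space_param_law[OF \<rho>Y])
  interpret XY: pair_prob_space ?PX ?PY ..
  interpret R: random_map Dref EV \<phi> \<mu> V by unfold_locales (use D EV \<phi> V in auto)
  have Dhold_borel: "Dhold \<in> sets borel" unfolding Dhold by (rule R.image_borel)

  \<comment> \<open>Borel versions of the data, the dense sequence and the constants\<close>
  obtain U where U: "open U" "Dhold \<subseteq> U" "real_analytic_on U a_s" using a_s_analytic by blast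
  define as' where "as' x = (if x \<in> U then a_s x else 0)" for x
  have as'_borel: "as' \<in> borel_measurable borel"
    unfolding as'_def[abs_def] by (rule real_analytic_on_borel_measurable[OF U(1,3)])
  have as'_eq: "as' x = a_s x" if "x \<in> Dhold" for x using that U(2) by (auto simp: as'_def)
  \<comment> \<open>Joint measurability with the random map needs Borel functions, so each \<psi> k
    is replaced off a null set of the hold-all domain.\<close>
  have "\<exists>g. g \<in> borel_measurable borel \<and> (AE x in lebesgue_on Dhold. \<psi> k x = g x)" for k
    by (rule borel_representative[OF Dhold_borel, of "\<psi> k"]) (use \<psi>[of k] in \<open>auto simp: Linf_def\<close>)
  then obtain \<psi>' where \<psi>': "\<And>k. \<psi>' k \<in> borel_measurable borel" "\<And>k. AE x in lebesgue_on Dhold. \<psi> k x = \<psi>' k x"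
    by metis
  obtain f' where f': "f' \<in> borel_measurable borel" "AE x in lebesgue_on Dhold. f x = f' x" "integrable lborel (\<lambda>x. (f' x)\<^sup>2)"
    by (rule L2_borel_representative[OF Dhold_borel f]) (rule that)
  obtain P where P: "0 < P" "\<And>u. u \<in> ?H \<Longrightarrow> H1_norm Dref u \<le> P * ?n u"
    by (rule poincare[OF D]) (rule that)
  obtain K where K: "linear_on ?H F" "0 \<le> K" "\<And>v. v \<in> ?H \<Longrightarrow> \<bar>F v\<bar> \<le> K * ?n v"
    by (rule functional_linear_bounded[OF D F]) (rule that)
  obtain w :: "nat \<Rightarrow> real^'d \<Rightarrow> real" where w: "\<And>n. test_function Dref (w n)"
    "\<And>u e. u \<in> ?H \<Longrightarrow> 0 < e \<Longrightarrow> \<exists>n. H1_norm Dref (\<lambda>x. u x - w n x) < e"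
    by (rule test_functions_countable_dense[OF D]) (rule that)
  have wH: "w j \<in> ?H" for j by (rule test_function_H10[OF D w(1)])
  have w_dense: "\<exists>n. ?n (\<lambda>x. u x - w n x) < e" if u: "u \<in> ?H" and e: "0 < e" for u e
  proof -
    obtain n where n: "H1_norm Dref (\<lambda>x. u x - w n x) < e" using w(2)[OF u e] by auto
    have "H1 Dref (\<lambda>x. u x - w n x)" by (intro H10_imp_H1 H10_diff[OF D] u wH)
    from grad_norm_le_H1_norm[OF this] n show ?thesis by (intro exI[of _ n]) simp
  qed

  \<comment> \<open>The 1 makes the bound positive without a sign condition on \<open>Cuni\<close>.
    None of the constants that follow depends on the parameters or on \<epsilon>.\<close>
  define C where "C = \<bar>Cuni\<bar> + 1"
  define dU where "dU = fact CARD('d) * C ^ CARD('d)"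
  define \<alpha> where "\<alpha> = a_lo / dU / C\<^sup>2"
  define \<beta> where "\<beta> = (\<bar>a_hi\<bar> + 1) * dU * C\<^sup>2"
  define L where "L = dU * sqrt (C ^ CARD('d) * (LINT y|lborel. (f' y)\<^sup>2)) * P"
  have C: "0 < C" "Cuni \<le> C" by (auto simp: C_def)
  have dU: "0 < dU" using C by (simp add: dU_def)
  have \<alpha>: "0 < \<alpha>" and \<beta>: "0 < \<beta>" using C dU a_lo by (auto simp: \<alpha>_def \<beta>_def intro!: mult_pos_pos)
  have L: "0 \<le> L" using C dU P by (simp add: L_def)

  \<comment> \<open>Forms, loads and equations for almost every realisation\<close>
  define form where "form z m = diffeo_domain.wform Dref (V z) (\<lambda>X. m (V z X) * det (jacobian (V z) (at X)))"
    for z and m :: "real^'d \<Rightarrow> real"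
  define l where "l z u = (LINT X|?M. f_ref z X * u X)" for z u
  \<comment> \<open>Membership in \<open>cube\<close> places the image of \<open>Dref\<close> inside
    \<open>Dhold\<close>, where the data are controlled.\<close>
  define good where "good z \<longleftrightarrow> z \<in> cube \<and> diffeo_domain Dref (V z) C \<and> weak_solution Dref (A_s z) (f_ref z) (u0 z)" for z
  have AE_good: "AE z in ?PY. good z"
    using V_diffeo u0 AE_param_law_cube[OF \<rho>Y]
    by eventually_elim (use D C in \<open>auto simp: good_def diffeo_domain_def intro: order_trans\<close>)

  have pull: "AE X in ?M. Q (V z X)" if z: "good z" and ae: "AE x in lebesgue_on Dhold. Q x" for z and Q :: "real^'d \<Rightarrow> bool"
  proof -
    interpret G: diffeo_domain Dref "V z" C using z by (simp add: good_def)
    have sub: "V z ` Dref \<subseteq> Dhold" using z by (auto simp: Dhold good_def)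
    have "AE x in lebesgue. x \<in> Dhold \<longrightarrow> Q x" using ae Dhold_borel by (simp add: AE_restrict_space_iff)
    then have "AE x in lebesgue. x \<in> V z ` Dref \<longrightarrow> Q x" by eventually_elim (use sub in auto)
    then have "AE x in lebesgue_on (V z ` Dref). Q x" using G.open_image by (simp add: AE_restrict_space_iff)
    then show ?thesis by (rule G.AE_pullback)
  qed
  have in_Dhold: "V z X \<in> Dhold" if "good z" "X \<in> Dref" for z X
    using that by (auto simp: Dhold good_def)

  have as_meas: "(\<lambda>X. a_s (V z X)) \<in> borel_measurable ?M" if z: "good z" for z
  proof -
    interpret G: diffeo_domain Dref "V z" C using z by (simp add: good_def)
    show ?thesis
      by (rule measurable_cong[THEN iffD1, OF _ G.comp_v_measurable[OF as'_borel]])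
        (simp add: as'_eq in_Dhold[OF z])
  qed
  have form_s: "coercive_form ?H ?n (form z a_s) \<alpha> \<beta>"
    "diffeo_domain.admissible_weight Dref (\<lambda>X. a_s (V z X) * det (jacobian (V z) (at X)))" if z: "good z" for z
  proof -
    interpret G: diffeo_domain Dref "V z" C using z by (simp add: good_def)
    note * = G.coercive_form_pullback[OF as_meas[OF z] a_s_bounds[OF in_Dhold[OF z]] a_lo]
    show "coercive_form ?H ?n (form z a_s) \<alpha> \<beta>"
      using *(1) by (simp add: form_def \<alpha>_def \<beta>_def dU_def)
    show "G.admissible_weight (\<lambda>X. a_s (V z X) * det (jacobian (V z) (at X)))" by (rule *(2))
  qed
  have load: "linear_on ?H (l z)" "\<And>u. u \<in> ?H \<Longrightarrow> \<bar>l z u\<bar> \<le> L * ?n u" if z: "good z" for z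
  proof -
    interpret G: diffeo_domain Dref "V z" C using z by (simp add: good_def)
    show "linear_on ?H (l z)"
      unfolding l_def[abs_def] f_ref
      by (rule G.load_functional(1)[OF f'(1,3) pull[OF z f'(2)]]) (rule P(2))
    show "\<bar>l z u\<bar> \<le> L * ?n u" if u: "u \<in> ?H" for u
      unfolding l_def f_ref L_def dU_def
      by (rule G.load_functional(2)[OF f'(1,3) pull[OF z f'(2)] _ u]) (rule P(2))
  qed
  have \<psi>_meas: "(\<lambda>X. \<psi> k (V z X)) \<in> borel_measurable ?M"
    and \<psi>_bound: "\<exists>b\<ge>0. AE X in ?M. \<bar>\<psi> k (V z X)\<bar> \<le> b" if z: "good z" for z k
  proof -
    interpret G: diffeo_domain Dref "V z" C using z by (simp add: good_def)
    show "(\<lambda>X. \<psi> k (V z X)) \<in> borel_measurable ?M"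
    proof (rule borel_measurable_lebesgue_on_AE[OF G.D_lebesgue G.comp_v_measurable[OF \<psi>'(1)[of k]]])
      show "AE X in ?M. \<psi>' k (V z X) = \<psi> k (V z X)" using pull[OF z \<psi>'(2)[of k]] by eventually_elim simp
    qed
    obtain b where "0 \<le> b" "AE x in lebesgue_on Dhold. \<bar>\<psi> k x\<bar> \<le> b" by (rule Linf_bound_obtain[OF \<psi>[of k]])
    then show "\<exists>b\<ge>0. AE X in ?M. \<bar>\<psi> k (V z X)\<bar> \<le> b" using pull[OF z] by blast
  qed
  have a_r': "a_r y x = (\<Sum>k\<in>UNIV. (sqrt (lam k) * y $ k) * \<psi> k x)" for y x
    unfolding a_r by (intro sum.cong) auto
  have form_r: "symmetric_bilinear_on ?H (form z (a_r y))"
    "diffeo_domain.admissible_weight Dref (\<lambda>X. a_r y (V z X) * det (jacobian (V z) (at X)))"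
    "\<And>u v. u \<in> ?H \<Longrightarrow> v \<in> ?H \<Longrightarrow> form z (a_r y) u v = (\<Sum>k\<in>UNIV. (sqrt (lam k) * y $ k) * form z (\<psi> k) u v)"
    "\<And>u v. Linf_norm (V z ` Dref) (a_r y) \<le> 1 \<Longrightarrow> u \<in> ?H \<Longrightarrow> v \<in> ?H \<Longrightarrow> \<bar>form z (a_r y) u v\<bar> \<le> \<beta> * ?n u * ?n v"
    if z: "good z" for y z
  proof -
    interpret G: diffeo_domain Dref "V z" C using z by (simp add: good_def)
    note * = G.weighted_sum_form[of \<psi> "a_r y", OF \<psi>_meas[OF z] \<psi>_bound[OF z] a_r']
    show "G.admissible_weight (\<lambda>X. a_r y (V z X) * det (jacobian (V z) (at X)))" by (rule *(2))
    show "symmetric_bilinear_on ?H (form z (a_r y))"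
      unfolding form_def by (rule G.wform_symmetric_bilinear[OF *(2)])
    show "form z (a_r y) u v = (\<Sum>k\<in>UNIV. (sqrt (lam k) * y $ k) * form z (\<psi> k) u v)"
      if "u \<in> ?H" "v \<in> ?H" for u v
      unfolding form_def by (intro *(3) H10_imp_H1 that)
    show "\<bar>form z (a_r y) u v\<bar> \<le> \<beta> * ?n u * ?n v"
      if n: "Linf_norm (V z ` Dref) (a_r y) \<le> 1" and uv: "u \<in> ?H" "v \<in> ?H" for u v
    proof -
      have "AE x in lebesgue_on (V z ` Dref). \<bar>a_r y x\<bar> \<le> 1"
        by (rule Linf_AE_bound) (use n in \<open>simp add: one_ereal_def\<close>)
      then have "AE X in ?M. \<bar>a_r y (V z X)\<bar> \<le> 1" by (rule G.AE_pullback)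
      from *(4)[OF this H10_imp_H1[OF uv(1)] H10_imp_H1[OF uv(2)]]
      have "\<bar>form z (a_r y) u v\<bar> \<le> 1 * (dU * C\<^sup>2 * (?n u * ?n v))" by (simp add: form_def dU_def mult.assoc)
      also have "\<dots> \<le> (\<bar>a_hi\<bar> + 1) * (dU * C\<^sup>2 * (?n u * ?n v))"
        using dU grad_norm_nonneg by (intro mult_right_mono mult_nonneg_nonneg) auto
      finally show ?thesis by (simp add: \<beta>_def mult.assoc)
    qed
  qed
  have sol0: "u0 z \<in> ?H" "\<And>v. v \<in> ?H \<Longrightarrow> form z a_s (u0 z) v = l z v" if z: "good z" for z
  proof -
    interpret G: diffeo_domain Dref "V z" C using z by (simp add: good_def)
    have ws: "weak_solution Dref (pullback_coeff (V z) a_s) (f_ref z) (u0 z)" using z by (simp add: good_def A_s)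
    then show u: "u0 z \<in> ?H" by (simp add: weak_solution_def)
    show "form z a_s (u0 z) v = l z v" if v: "v \<in> ?H" for v
      \<comment> \<open>The unperturbed equation is the case of factor 0 in the identity for
        perturbed coefficients, with \<open>a_s\<close> filling both slots.\<close>
      using G.pullback_coeff_form[OF form_s(2)[OF z] form_s(2)[OF z] H10_imp_H1[OF u] H10_imp_H1[OF v], of 0]
        ws v by (simp add: form_def l_def weak_solution_def)
  qed
  have sol: "u \<in> ?H" "\<And>v. v \<in> ?H \<Longrightarrow> form z a_s u v + \<epsilon> * form z (a_r y) u v = l z v"
    if z: "good z" and ws: "weak_solution Dref (\<lambda>X. A_s z X + \<epsilon> *\<^sub>R A_r y z X) (f_ref z) u" for z y u \<epsilon>
  proof -
    interpret G: diffeo_domain Dref "V z" C using z by (simp add: good_def)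
    show u: "u \<in> ?H" using ws by (simp add: weak_solution_def)
    show "form z a_s u v + \<epsilon> * form z (a_r y) u v = l z v" if v: "v \<in> ?H" for v
      using G.pullback_coeff_form[OF form_s(2)[OF z] form_r(2)[OF z] H10_imp_H1[OF u] H10_imp_H1[OF v], of \<epsilon> y]
        ws v by (simp add: form_def l_def weak_solution_def A_s A_r)
  qed

  \<comment> \<open>Measurable versions of the functional of the solutions\<close>
  define E where "E \<epsilon> j p = (R.energy as' (w j) (snd p) +
      \<epsilon> * (\<Sum>k\<in>UNIV. (sqrt (lam k) * fst p $ k) * R.energy (\<psi>' k) (w j) (snd p))) / 2 - R.load f' (w j) (snd p)"
    for \<epsilon> and j :: nat and p :: "(real^'n) \<times> (real^'m)"
  have E_meas: "E \<epsilon> j \<in> borel_measurable (borel \<Otimes>\<^sub>M borel)" for \<epsilon> j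
  proof -
    have e: "(\<lambda>p. R.energy g (w j) (snd p)) \<in> borel_measurable (borel \<Otimes>\<^sub>M borel)" if "g \<in> borel_measurable borel" for g
      by (rule measurable_compose[OF measurable_snd R.energy_measurable[OF that w(1)]])
    have ld: "(\<lambda>p. R.load f' (w j) (snd p)) \<in> borel_measurable (borel \<Otimes>\<^sub>M borel)"
      by (rule measurable_compose[OF measurable_snd R.load_measurable[OF f'(1) w(1)]])
    have c: "(\<lambda>p. fst p $ k) \<in> borel_measurable (borel \<Otimes>\<^sub>M borel)" for k
      by (intro measurable_compose[OF measurable_fst] borel_measurable_continuous_onI continuous_intros)
    show ?thesis
      unfolding E_def[abs_def]
      by (intro borel_measurable_diff borel_measurable_divide borel_measurable_add borel_measurable_times
          borel_measurable_sum borel_measurable_const e ld c as'_borel \<psi>'(1))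
  qed
  have E_eq: "E \<epsilon> j (y, z) = (form z a_s (w j) (w j) + \<epsilon> * form z (a_r y) (w j) (w j)) / 2 - l z (w j)"
    if z: "good z" for \<epsilon> j y z
  proof -
    have dd: "diffeo_domain Dref (V z) C" using z by (simp add: good_def)
    interpret G: diffeo_domain Dref "V z" C by fact
    have x: "AE X in ?M. X \<in> Dref" using G.D_lebesgue by (simp add: AE_restrict_space_iff)
    have "AE X in ?M. a_s (V z X) = as' (V z X)"
      using x by eventually_elim (simp add: as'_eq in_Dhold[OF z])
    then have "form z a_s (w j) (w j) = R.energy as' (w j) z"
      unfolding form_def by (rule R.wform_eq_energy[OF dd as'_borel w(1)])
    moreover have "form z (\<psi> k) (w j) (w j) = R.energy (\<psi>' k) (w j) z" for k
      unfolding form_def by (rule R.wform_eq_energy[OF dd \<psi>'(1) w(1) pull[OF z \<psi>'(2)]])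
    moreover have "l z (w j) = R.load f' (w j) z"
      unfolding l_def f_ref by (rule R.pullback_load_eq_load[OF dd f'(1) w(1) pull[OF z f'(2)]])
    ultimately show ?thesis by (simp add: E_def form_r(3)[OF z wH wH])
  qed
  define G where "G \<epsilon> p = lim (\<lambda>n. F (w (LEAST j. \<forall>i. E \<epsilon> j p \<le> E \<epsilon> i p + inverse (real (Suc n)))))" for \<epsilon> p
  have G_meas: "G \<epsilon> \<in> borel_measurable (borel \<Otimes>\<^sub>M borel)" for \<epsilon>
    unfolding G_def[abs_def] by (rule selection_measurable[OF E_meas])
  \<comment> \<open>For \<epsilon> = 0 the energies do not involve \<open>y\<close>, so the section
    at \<open>y = 0\<close> serves the unperturbed solution.\<close>
  have G0: "F (u0 z) = G 0 (0, z)" if z: "good z" for z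
  proof -
    interpret B: coercive_form ?H ?n "form z a_s" \<alpha> \<beta> by (rule form_s(1)[OF z])
    have "(\<lambda>n. F (w (LEAST j. \<forall>i. E 0 j (0, z) \<le> E 0 i (0, z) + inverse (real (Suc n))))) \<longlonglongrightarrow> F (u0 z)"
      by (rule B.energy_selection_tendsto[OF load(1)[OF z] sol0[OF z] K(1,3) wH w_dense[OF sol0(1)[OF z]]])
        (simp_all add: E_eq[OF z])
    then show ?thesis unfolding G_def by (rule limI[symmetric])
  qed

  \<comment> \<open>Constants and estimates for small \<epsilon>\<close>
  define \<epsilon>0 where "\<epsilon>0 = min 1 (\<alpha> / (2 * \<beta>))"
  define K1 where "K1 = 2 * \<beta> * L / \<alpha>\<^sup>2 * K"
  define K2 where "K2 = 2 * \<beta> * L / \<alpha>\<^sup>2 * (1 + \<beta> * (K + 1) / \<alpha>)"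
  \<comment> \<open>\<open>L / \<alpha>\<close> bounds the norm of the unperturbed solution and
    \<open>K\<close> is the norm of \<open>F\<close>; \<open>K1\<close> and \<open>K2\<close> are
    the constants of \<open>first_order_expansion\<close>.\<close>
  define M where "M = K * (L / \<alpha>)"
  define C0 where "C0 = K2 + (2 * M * K2 + K1\<^sup>2 + K2 * (2 * M + K1)) + 1"
  have \<epsilon>0: "0 < \<epsilon>0" using \<alpha> \<beta> by (simp add: \<epsilon>0_def)
  have pos: "0 \<le> M" "0 \<le> K1" "0 \<le> K2" using \<alpha> \<beta> K(2) L by (auto simp: M_def K1_def K2_def)
  have var_pos: "0 \<le> 2 * M * K2 + K1\<^sup>2 + K2 * (2 * M + K1)" using pos by simp
  have C0: "0 < C0" "K2 \<le> C0" "2 * M * K2 + K1\<^sup>2 + K2 * (2 * M + K1) \<le> C0"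
    unfolding C0_def using pos(3) var_pos by linarith+
  have "\<bar>expect \<rho>X \<rho>Y (\<lambda>y z. F (u\<epsilon> y z)) - expect \<rho>X \<rho>Y (\<lambda>y z. F (u0 z))\<bar> \<le> C0 * \<epsilon>\<^sup>2 \<and>
      \<bar>varc \<rho>X \<rho>Y (\<lambda>y z. F (u\<epsilon> y z)) - varc \<rho>X \<rho>Y (\<lambda>y z. F (u0 z))\<bar> \<le> C0 * \<epsilon>\<^sup>2"
    if \<epsilon>: "0 < \<epsilon>" "\<epsilon> \<le> \<epsilon>0" and u\<epsilon>: "AE (y, z) in ?PX \<Otimes>\<^sub>M ?PY.
        weak_solution Dref (\<lambda>X. A_s z X + \<epsilon> *\<^sub>R A_r y z X) (f_ref z) (u\<epsilon> y z)"
    for \<epsilon> and u\<epsilon> :: "real^'n \<Rightarrow> real^'m \<Rightarrow> real^'d \<Rightarrow> real"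
  proof -
    \<comment> \<open>The two entries of the minimum in \<epsilon>0 provide the last two conditions,
      which are those of \<open>perturbed_coercive_form\<close>.\<close>
    have \<epsilon>': "0 < \<epsilon>" "\<epsilon> \<le> 1" "\<epsilon> * \<beta> \<le> \<alpha> / 2"
      using \<epsilon> \<beta> by (auto simp: \<epsilon>0_def field_simps)
    define sol_pair where "sol_pair p \<longleftrightarrow> Linf_norm (V (snd p) ` Dref) (a_r (fst p)) \<le> 1 \<and>
        weak_solution Dref (\<lambda>X. A_s (snd p) X + \<epsilon> *\<^sub>R A_r (fst p) (snd p) X) (f_ref (snd p)) (u\<epsilon> (fst p) (snd p))" for p
    have AE_pair: "AE p in ?PX \<Otimes>\<^sub>M ?PY. sol_pair p"
      using a_r_bound u\<epsilon> by eventually_elim (simp add: sol_pair_def case_prod_beta)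
    have AE_good_pair: "AE p in ?PX \<Otimes>\<^sub>M ?PY. good (snd p)"
      by (rule AE_pair_snd[OF X.prob_space_axioms Y.prob_space_axioms AE_good])
    \<comment> \<open>The representative \<open>v\<close> precedes the quantifier over
      \<open>y\<close>: it depends on \<open>z\<close> and \<epsilon> only, so the first-order term
      stays linear in \<open>y\<close>.\<close>
    have expansion: "\<exists>v\<in>?H. \<forall>y. sol_pair (y, z) \<longrightarrow>
        \<bar>F (u\<epsilon> y z) - F (u0 z) + \<epsilon> * form z (a_r y) (u0 z) v\<bar> \<le> K2 * \<epsilon>\<^sup>2 \<and> \<bar>F (u\<epsilon> y z) - F (u0 z)\<bar> \<le> K1 * \<epsilon>"
      if z: "good z" for z
    proof -
      interpret B: coercive_form ?H ?n "form z a_s" \<alpha> \<beta> by (rule form_s(1)[OF z])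
      show ?thesis
      proof (rule B.first_order_expansion[OF load(1)[OF z] L load(2)[OF z] K sol0[OF z] \<epsilon>'])
        fix v
        assume v: "v \<in> ?H"
          "\<And>Q u. symmetric_bilinear_on ?H Q \<Longrightarrow> (\<And>u v. u \<in> ?H \<Longrightarrow> v \<in> ?H \<Longrightarrow> \<bar>Q u v\<bar> \<le> \<beta> * ?n u * ?n v) \<Longrightarrow>
            u \<in> ?H \<Longrightarrow> (\<And>v. v \<in> ?H \<Longrightarrow> form z a_s u v + \<epsilon> * Q u v = l z v) \<Longrightarrow>
            \<bar>F u - F (u0 z) + \<epsilon> * Q (u0 z) v\<bar> \<le> 2 * \<beta> * L / \<alpha>\<^sup>2 * (1 + \<beta> * (K + 1) / \<alpha>) * \<epsilon>\<^sup>2 \<and>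
            \<bar>F u - F (u0 z)\<bar> \<le> 2 * \<beta> * L / \<alpha>\<^sup>2 * K * \<epsilon>"
        show ?thesis
        proof (intro bexI[OF _ v(1)] allI impI)
          fix y assume "sol_pair (y, z)"
          then have n: "Linf_norm (V z ` Dref) (a_r y) \<le> 1"
            and ws: "weak_solution Dref (\<lambda>X. A_s z X + \<epsilon> *\<^sub>R A_r y z X) (f_ref z) (u\<epsilon> y z)"
            by (auto simp: sol_pair_def)
          show "\<bar>F (u\<epsilon> y z) - F (u0 z) + \<epsilon> * form z (a_r y) (u0 z) v\<bar> \<le> K2 * \<epsilon>\<^sup>2 \<and> \<bar>F (u\<epsilon> y z) - F (u0 z)\<bar> \<le> K1 * \<epsilon>"
            unfolding K1_def K2_def
            by (rule v(2)[OF form_r(1)[OF z] form_r(4)[OF z n] sol[OF z ws]])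
        qed
      qed
    qed
    have G\<epsilon>: "F (u\<epsilon> y z) = G \<epsilon> (y, z)" if z: "good z" and yz: "sol_pair (y, z)" for y z
    proof -
      have n: "Linf_norm (V z ` Dref) (a_r y) \<le> 1"
        and ws: "weak_solution Dref (\<lambda>X. A_s z X + \<epsilon> *\<^sub>R A_r y z X) (f_ref z) (u\<epsilon> y z)"
        using yz by (auto simp: sol_pair_def)
      interpret B0: coercive_form ?H ?n "form z a_s" \<alpha> \<beta> by (rule form_s(1)[OF z])
      interpret B: coercive_form ?H ?n "\<lambda>u v. form z a_s u v + \<epsilon> * form z (a_r y) u v" "\<alpha> / 2" "2 * \<beta>"
        by (rule B0.perturbed_coercive_form[OF form_r(1)[OF z] form_r(4)[OF z n] \<epsilon>'])
      have "(\<lambda>n. F (w (LEAST j. \<forall>i. E \<epsilon> j (y, z) \<le> E \<epsilon> i (y, z) + inverse (real (Suc n))))) \<longlonglongrightarrow> F (u\<epsilon> y z)"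
        by (rule B.energy_selection_tendsto[OF load(1)[OF z] sol[OF z ws] K(1,3) wH w_dense[OF sol(1)[OF z ws]]])
          (simp_all add: E_eq[OF z])
      then show ?thesis unfolding G_def by (rule limI[symmetric])
    qed
    have h1: "AE (y, z) in ?PX \<Otimes>\<^sub>M ?PY. F (u\<epsilon> y z) = G \<epsilon> (y, z)"
      using AE_pair AE_good_pair by eventually_elim (auto simp: G\<epsilon>)
    have h2: "AE z in ?PY. F (u0 z) = G 0 (0, z)" using AE_good by eventually_elim (rule G0)
    have h3: "AE z in ?PY. \<bar>F (u0 z)\<bar> \<le> M" using AE_good
    proof eventually_elim
      case (elim z)
      interpret B: coercive_form ?H ?n "form z a_s" \<alpha> \<beta> by (rule form_s(1)[OF elim])
      have "\<alpha> * ?n (u0 z) \<le> L"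
        by (rule B.solution_bound[of "u0 z" "l z"]) (use sol0[OF elim] load(2)[OF elim] L in auto)
      then have "?n (u0 z) \<le> L / \<alpha>" using \<alpha> by (simp add: pos_le_divide_eq mult.commute)
      then have "K * ?n (u0 z) \<le> M" unfolding M_def by (intro mult_left_mono K(2))
      then show ?case using K(3)[OF sol0(1)[OF elim]] by linarith
    qed
    have h4: "AE (y, z) in ?PX \<Otimes>\<^sub>M ?PY. \<bar>F (u\<epsilon> y z) - F (u0 z)\<bar> \<le> K1 * \<epsilon>"
      using AE_pair AE_good_pair
    proof eventually_elim
      case (elim p)
      then show ?case using expansion[of "snd p"] by (cases p) auto
    qed
    have h5: "AE z in ?PY. \<exists>c. AE y in ?PX. \<bar>F (u\<epsilon> y z) - F (u0 z) + (\<Sum>k\<in>UNIV. c k * y $ k)\<bar> \<le> K2 * \<epsilon>\<^sup>2"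
      using AE_pair_swapped[OF X.sigma_finite_measure_axioms Y.sigma_finite_measure_axioms AE_pair] AE_good
    proof eventually_elim
      case (elim z)
      obtain v where v: "v \<in> ?H" "\<And>y. sol_pair (y, z) \<Longrightarrow>
          \<bar>F (u\<epsilon> y z) - F (u0 z) + \<epsilon> * form z (a_r y) (u0 z) v\<bar> \<le> K2 * \<epsilon>\<^sup>2"
        using expansion[OF elim(2)] by blast
      \<comment> \<open>The coefficients of the linear term are free of \<open>y\<close> because
        neither \<open>u0 z\<close> nor \<open>v\<close> involves it.\<close>
      define c where "c k = \<epsilon> * (sqrt (lam k) * form z (\<psi> k) (u0 z) v)" for k
      have eq: "\<epsilon> * form z (a_r y) (u0 z) v = (\<Sum>k\<in>UNIV. c k * y $ k)" for y
        unfolding form_r(3)[OF elim(2) sol0(1)[OF elim(2)] v(1)] c_def sum_distrib_left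
        by (intro sum.cong) auto
      have "AE y in ?PX. \<bar>F (u\<epsilon> y z) - F (u0 z) + (\<Sum>k\<in>UNIV. c k * y $ k)\<bar> \<le> K2 * \<epsilon>\<^sup>2"
        using elim(1) by eventually_elim (use v(2) eq in metis)
      then show ?case by blast
    qed
    have G0_meas: "(\<lambda>z. G 0 (0, z)) \<in> borel_measurable borel"
      by (rule measurable_compose[OF _ G_meas]) simp
    note * = expect_varc_perturbation[OF \<rho>X \<rho>Y G_meas G0_meas h1 h2 h3 h4 h5 pos \<epsilon>'(1,2)]
    show ?thesis
      using *(1) *(2) mult_right_mono[OF C0(2), of "\<epsilon>\<^sup>2"] mult_right_mono[OF C0(3), of "\<epsilon>\<^sup>2"] by simp
  qed
  then show ?thesis using \<epsilon>0 C0(1) by blast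
qed

end
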